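(* Let $K$ be an algebraically closed field of characteristic $\ne2$, $G=\mathrm{PGL}_n(K)$, $n=2^st$ with $t$ odd and $s,t\ge1$. Let $1\le r\le s$, so $n=2^r\cdot 2^{s-r}t$, and let $D=D_r\times\bar U$ where $\bar U=\bar U_1\otimes I_{2^r}$ and $\bar U_1$ is either trivial or a toral elementary abelian $2$-subgroup of $\mathrm{PGL}_{2^{s-r}t}(K)$ with $C_{\mathrm{PGL}_{2^{s-r}t}(K)}(\bar U_1)$ connected. Then $$N_G(D)/C_G(D)\cong 2^{\mathrm{rk}\bar U\cdot r}:\big(\mathrm{GL}_r(2)\times W_{\mathrm{PGL}_{2^{s-r}t}(K)}(\bar U_1)\big),$$ a split extension of an elementary abelian group of order $2^{r\cdot\mathrm{rk}\bar U}$ by $\mathrm{GL}_r(2)\times W_{\mathrm{PGL}_{2^{s-r}t}(K)}(\bar U_1)$.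
   Context: $W_X(Y)=N_X(Y)/C_X(Y)$; $\mathrm{rk}$ is the rank of an elementary abelian group. Notation ($p=2$): for $0\le s'\le r-1$, $A_{s'}$ is the $2^r\times2^r$ diagonal matrix with $(A_{s'})_{ii}=(-1)^{\lfloor(i-1)/2^{s'}\rfloor}$ and $\bar A_{s'}$ its image (as $I_{n/2^r}\otimes A_{s'}$, block diagonal) in $\mathrm{PGL}_n(K)$; $D_r=\langle\bar A_0,\dots,\bar A_{r-1}\rangle$. $\bar U_1\otimes I_{2^r}$ is the image of $\{u\otimes I_{2^r}\}$ (Kronecker product replacing each entry by that scalar times $I_{2^r}$). Toral: contained in a maximal torus. *)

theory Defs
  imports "Jordan_Normal_Form.Determinant" "HOL-Algebra.Group_Action" "HOL-Algebra.Generated_Groups"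
    "HOL-Algebra.Coset" "HOL-Library.Z2"
begin

definition alg_closed_field :: "'a::field itself \<Rightarrow> bool" where
  "alg_closed_field _ \<longleftrightarrow> (\<forall>p :: 'a poly. degree p \<ge> 1 \<longrightarrow> (\<exists>x. poly p x = 0))"

definition GLm :: "nat \<Rightarrow> 'a::field mat set" where
  "GLm n = {A \<in> carrier_mat n n. det A \<noteq> 0}"

definition GL_grp :: "nat \<Rightarrow> 'a::field mat monoid" where
  "GL_grp n = \<lparr>carrier = GLm n, mult = (\<lambda>A B. A * B), one = 1\<^sub>m n\<rparr>"

definition cls :: "'a::field mat \<Rightarrow> 'a mat set" where
  "cls A = {c \<cdot>\<^sub>m A | c. c \<noteq> 0}"

definition PGL :: "nat \<Rightarrow> 'a::field mat set monoid" where
  "PGL n = \<lparr>carrier = cls ` GLm n,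
            mult = (\<lambda>X Y. {A * B | A B. A \<in> X \<and> B \<in> Y}),
            one = cls (1\<^sub>m n)\<rparr>"

definition centralizer :: "('g, 'b) monoid_scheme \<Rightarrow> 'g set \<Rightarrow> 'g set" where
  "centralizer G H = {g \<in> carrier G. \<forall>h \<in> H. g \<otimes>\<^bsub>G\<^esub> h = h \<otimes>\<^bsub>G\<^esub> g}"

definition Weyl :: "('g, 'b) monoid_scheme \<Rightarrow> 'g set \<Rightarrow> 'g set monoid" where
  "Weyl G H = (G\<lparr>carrier := normalizer G H\<rparr>) Mod (centralizer G H)"

definition elem_ab_2 :: "('g, 'b) monoid_scheme \<Rightarrow> 'g set \<Rightarrow> bool" where
  "elem_ab_2 G H \<longleftrightarrow> subgroup H G \<and> finite H \<and>
     (\<forall>x \<in> H. \<forall>y \<in> H. x \<otimes>\<^bsub>G\<^esub> y = y \<otimes>\<^bsub>G\<^esub> x) \<and> (\<forall>x \<in> H. x \<otimes>\<^bsub>G\<^esub> x = \<one>\<^bsub>G\<^esub>)"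

definition rk :: "'g set \<Rightarrow> nat" where
  "rk H = (THE k. card H = 2 ^ k)"

definition std_torus :: "nat \<Rightarrow> 'a::field mat set set" where
  "std_torus n = cls ` {A \<in> GLm n. diagonal_mat A}"

(* toral: contained in a maximal torus, i.e. in a conjugate of the standard one *)
definition toral :: "nat \<Rightarrow> 'a::field mat set set \<Rightarrow> bool" where
  "toral n U \<longleftrightarrow> (\<exists>g \<in> carrier (PGL n).
      (\<lambda>x. g \<otimes>\<^bsub>PGL n\<^esub> x \<otimes>\<^bsub>PGL n\<^esub> inv\<^bsub>PGL n\<^esub> g) ` U \<subseteq> std_torus n)"

inductive_set mpoly_fun :: "nat \<Rightarrow> ('a::field mat \<Rightarrow> 'a) set" for n where
  const: "(\<lambda>A. c) \<in> mpoly_fun n"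
| entry: "i < n \<Longrightarrow> j < n \<Longrightarrow> (\<lambda>A. A $$ (i, j)) \<in> mpoly_fun n"
| add: "f \<in> mpoly_fun n \<Longrightarrow> g \<in> mpoly_fun n \<Longrightarrow> (\<lambda>A. f A + g A) \<in> mpoly_fun n"
| mult: "f \<in> mpoly_fun n \<Longrightarrow> g \<in> mpoly_fun n \<Longrightarrow> (\<lambda>A. f A * g A) \<in> mpoly_fun n"

definition zar_closed_GL :: "nat \<Rightarrow> 'a::field mat set \<Rightarrow> bool" where
  "zar_closed_GL n S \<longleftrightarrow> (\<exists>F \<subseteq> mpoly_fun n. S = {A \<in> GLm n. \<forall>f \<in> F. f A = 0})"

(* Zariski closed subsets of PGL_n (quotient topology from GL_n) *)
definition zar_closed_PGL :: "nat \<Rightarrow> 'a::field mat set set \<Rightarrow> bool" where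
  "zar_closed_PGL n S \<longleftrightarrow> S \<subseteq> carrier (PGL n) \<and> zar_closed_GL n (\<Union>S)"

definition zar_connected :: "nat \<Rightarrow> 'a::field mat set set \<Rightarrow> bool" where
  "zar_connected n H \<longleftrightarrow> \<not> (\<exists>A B. zar_closed_PGL n A \<and> zar_closed_PGL n B \<and> H \<subseteq> A \<union> B \<and>
      A \<inter> H \<noteq> {} \<and> B \<inter> H \<noteq> {} \<and> A \<inter> B \<inter> H = {})"

(* \bar A_{s'} = image of I_{n/2^r} \<otimes> A_{s'} in PGL_n (0-based indices) *)
definition Abar :: "nat \<Rightarrow> nat \<Rightarrow> nat \<Rightarrow> 'a::field mat set" where
  "Abar n r s' = cls (mat n n (\<lambda>(i, j). if i = j then (- 1) ^ ((i mod 2 ^ r) div 2 ^ s') else 0))"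

definition D_r :: "nat \<Rightarrow> nat \<Rightarrow> 'a::field mat set set" where
  "D_r n r = generate (PGL n) {Abar n r s' | s'. s' < r}"

(* u \<otimes> I_k : each entry u_ab replaced by u_ab I_k *)
definition kron_I :: "'a::field mat \<Rightarrow> nat \<Rightarrow> 'a mat" where
  "kron_I u k = mat (dim_row u * k) (dim_col u * k)
     (\<lambda>(i, j). if i mod k = j mod k then u $$ (i div k, j div k) else 0)"

definition Ubar :: "nat \<Rightarrow> 'a::field mat set set \<Rightarrow> 'a mat set set" where
  "Ubar r U1 = {cls (kron_I u (2 ^ r)) | u. u \<in> \<Union>U1}"

end

theory Submission
  imports Defs "HOL-Algebra.Sylow" "HOL-Algebra.Multiplicative_Group"
begin

text \<open>Write \<open>m = 2 ^ (s - r) * t\<close>. Connectedness of the centralizer of \<open>U1\<close> forces every matrix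
  that commutes with \<open>U1\<close> in \<open>PGL m\<close> to commute with lifts of \<open>U1\<close> on the nose. Consequently
  \<open>Ubar r U1\<close> consists of exactly those elements of \<open>D\<close> whose lifts commute with all lifts of the
  centralizer of \<open>D\<close> (translations of the \<open>2 ^ r\<close> coordinates detect the remaining elements), so
  the normalizer of \<open>D\<close> preserves \<open>Ubar r U1\<close>. Its action on \<open>D\<close> is therefore block triangular:
  the automorphisms of \<open>D_r\<close> are realised by permutation matrices of linear maps of bit vectors,
  the unipotent part \<open>Hom(D_r, Ubar)\<close> by translations that depend on the eigenvectors of \<open>U1\<close>,
  and an element that centralizes \<open>D_r\<close> acts on \<open>Ubar r U1\<close> like one of its \<open>m \<times> m\<close> blocks.\<close>

subsection \<open>Conjugation and Weyl groups\<close>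

text \<open>The obstacle is that conjugation in PGL controls lifts only up to a scalar. The lifts of
  an element of the centralizer of \<open>D\<close> and of an element of \<open>D\<close> commute up
  to a scalar that depends only on the two classes, and this scalar is a sign because the elements
  of \<open>D\<close> square to 1. \<open>Ubar\<close> is the kernel of this pairing on the side of
  \<open>D\<close>, hence is determined by \<open>D\<close> alone. This is what keeps the normalizer
  from mixing \<open>D_r\<close> and \<open>Ubar\<close> arbitrarily. The group theory is separated
  from the matrices in \<open>weyl_extension\<close>. A class in the Weyl group is determined by its
  action on \<open>D\<close>. The unipotent part is parametrized by \<open>r\<close> free values in
  \<open>Ubar\<close>, which explains its order, and the complement is the image of the product of
  GL_r(2) with the normalizer of \<open>U1\<close>; the kernel there is the centralizer of
  \<open>U1\<close>. Square roots in the field allow lifts of \<open>Ubar\<close> with eigenvalues 1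
  and -1, so that their signs can be matched with those of \<open>D_r\<close>.\<close>

definition conj_by :: "('g, 'b) monoid_scheme \<Rightarrow> 'g \<Rightarrow> 'g \<Rightarrow> 'g" where
  "conj_by G g x = g \<otimes>\<^bsub>G\<^esub> x \<otimes>\<^bsub>G\<^esub> inv\<^bsub>G\<^esub> g"

definition Weyl_class :: "('g, 'b) monoid_scheme \<Rightarrow> 'g set \<Rightarrow> 'g \<Rightarrow> 'g set" where
  "Weyl_class G H g = centralizer G H #>\<^bsub>G\<^esub> g"

context group
begin

lemma conj_by_closed [simp]: "g \<in> carrier G \<Longrightarrow> x \<in> carrier G \<Longrightarrow> conj_by G g x \<in> carrier G"
  by (simp add: conj_by_def)

lemma conj_by_eq_iff:
  assumes "g \<in> carrier G" "x \<in> carrier G" "y \<in> carrier G"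
  shows "conj_by G g x = y \<longleftrightarrow> g \<otimes> x = y \<otimes> g"
  using assms by (metis conj_by_def inv_solve_right m_closed)

lemma conj_by_one [simp]: "x \<in> carrier G \<Longrightarrow> conj_by G \<one> x = x"
  by (simp add: conj_by_def)

lemma conj_by_mult_left:
  "g \<in> carrier G \<Longrightarrow> h \<in> carrier G \<Longrightarrow> x \<in> carrier G \<Longrightarrow>
    conj_by G (g \<otimes> h) x = conj_by G g (conj_by G h x)"
  by (simp add: conj_by_def inv_mult_group m_assoc)

lemma conj_by_mult:
  assumes "g \<in> carrier G" "x \<in> carrier G" "y \<in> carrier G"
  shows "conj_by G g (x \<otimes> y) = conj_by G g x \<otimes> conj_by G g y"
proof -
  have "inv g \<otimes> (g \<otimes> (y \<otimes> inv g)) = y \<otimes> inv g"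
    using assms by (simp flip: m_assoc)
  then show ?thesis using assms by (simp add: conj_by_def m_assoc)
qed

lemma conj_by_inv:
  assumes "g \<in> carrier G" "x \<in> carrier G"
  shows "conj_by G g (inv x) = inv (conj_by G g x)"
  using assms by (simp add: conj_by_def inv_mult_group m_assoc)

lemma conj_by_cancel [simp]:
  assumes "g \<in> carrier G" "x \<in> carrier G"
  shows "conj_by G (inv g) (conj_by G g x) = x" "conj_by G g (conj_by G (inv g) x) = x"
  using assms by (simp_all flip: conj_by_mult_left)

lemma conj_by_id [simp]: "g \<in> carrier G \<Longrightarrow> conj_by G g \<one> = \<one>"
  by (simp add: conj_by_def)

lemma inj_on_conj_by: "g \<in> carrier G \<Longrightarrow> inj_on (conj_by G g) (carrier G)"
  by (metis conj_by_cancel(1) inj_onI)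

text \<open>\<open>normalizer\<close> is defined as the stabilizer of a set. An injective map of a
  finite set into itself is onto, so preserving \<open>H\<close> in one direction suffices.\<close>

lemma mem_normalizer_iff:
  assumes "H \<subseteq> carrier G" "finite H"
  shows "g \<in> normalizer G H \<longleftrightarrow> g \<in> carrier G \<and> (\<forall>h\<in>H. conj_by G g h \<in> H)"
proof -
  have im: "g <# H #> inv g = conj_by G g ` H"
    by (auto simp: l_coset_def r_coset_def conj_by_def)
  have "conj_by G g ` H = H" if "g \<in> carrier G" "\<forall>h\<in>H. conj_by G g h \<in> H"
    using that assms inj_on_conj_by[OF that(1)]
    by (intro endo_inj_surj) (auto intro: inj_on_subset)
  then show ?thesis
    using assms im by (auto simp: normalizer_def stabilizer_def)
qed

lemma mem_centralizer_iff:
  assumes "H \<subseteq> carrier G"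
  shows "g \<in> centralizer G H \<longleftrightarrow> g \<in> carrier G \<and> (\<forall>h\<in>H. conj_by G g h = h)"
  using assms conj_by_eq_iff unfolding centralizer_def by (smt (verit, best) mem_Collect_eq subsetD)

lemma subgroup_normalizer:
  assumes "H \<subseteq> carrier G" "finite H"
  shows "subgroup (normalizer G H) G"
proof (rule subgroupI)
  show "inv g \<in> normalizer G H" if "g \<in> normalizer G H" for g
  proof -
    have g: "g \<in> carrier G" "\<forall>h\<in>H. conj_by G g h \<in> H"
      using that assms by (auto simp: mem_normalizer_iff)
    have "conj_by G g ` H = H"
      using g assms inj_on_conj_by[OF g(1)] by (intro endo_inj_surj) (auto intro: inj_on_subset)
    have "conj_by G (inv g) h \<in> H" if "h \<in> H" for h
    proof -
      obtain h' where h': "h' \<in> H" "h = conj_by G g h'"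
        using \<open>conj_by G g ` H = H\<close> \<open>h \<in> H\<close> by blast
      moreover have "h' \<in> carrier G" using h'(1) assms(1) by blast
      ultimately show ?thesis using g(1) by simp
    qed
    then show ?thesis using g(1) assms by (simp add: mem_normalizer_iff)
  qed
  show "normalizer G H \<noteq> {}"
    using assms mem_normalizer_iff[of H \<one>] by auto
  show "normalizer G H \<subseteq> carrier G"
    using assms by (auto simp: mem_normalizer_iff)
  show "g \<otimes> h \<in> normalizer G H" if "g \<in> normalizer G H" "h \<in> normalizer G H" for g h
  proof -
    have c: "g \<in> carrier G" "h \<in> carrier G" and "\<forall>y\<in>H. conj_by G g y \<in> H" "\<forall>y\<in>H. conj_by G h y \<in> H"
      using that assms by (auto simp: mem_normalizer_iff)
    then have "\<forall>y\<in>H. conj_by G (g \<otimes> h) y \<in> H"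
      using assms(1) conj_by_mult_left[OF c] by auto
    then show ?thesis using c assms by (simp add: mem_normalizer_iff)
  qed
qed

text \<open>The centralizer is the kernel of the conjugation action of the normalizer on
  \<open>H\<close>; this makes \<open>Weyl\<close> a quotient group.\<close>

lemma normal_centralizer:
  assumes "H \<subseteq> carrier G" "finite H"
  shows "centralizer G H \<lhd> G\<lparr>carrier := normalizer G H\<rparr>" (is "_ \<lhd> ?N")
proof -
  interpret N: group "G\<lparr>carrier := normalizer G H\<rparr>"
    using subgroup_normalizer[OF assms] subgroup_imp_group by blast
  have sub: "centralizer G H \<subseteq> normalizer G H"
    using assms by (auto simp: mem_normalizer_iff mem_centralizer_iff)
  have inv: "inv\<^bsub>G\<lparr>carrier := normalizer G H\<rparr>\<^esub> g = inv g" if "g \<in> normalizer G H" for g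
    using that subgroup_normalizer[OF assms] m_inv_consistent by blast
  have "subgroup (centralizer G H) (G\<lparr>carrier := normalizer G H\<rparr>)"
  proof (rule N.subgroupI)
    show "centralizer G H \<noteq> {}"
      using assms mem_centralizer_iff[of H \<one>] by auto
    show "inv\<^bsub>G\<lparr>carrier := normalizer G H\<rparr>\<^esub> g \<in> centralizer G H" if "g \<in> centralizer G H" for g
    proof -
      have gc: "g \<in> carrier G" "\<forall>h\<in>H. conj_by G g h = h" and gN: "g \<in> normalizer G H"
        using that sub assms by (auto simp: mem_centralizer_iff)
      have "conj_by G (inv g) h = h" if "h \<in> H" for h
        using conj_by_cancel(1)[OF gc(1), of h] gc(2) that assms(1) by auto
      then show ?thesis using gc(1) gN assms by (simp add: inv mem_centralizer_iff)
    qed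
    show "centralizer G H \<subseteq> carrier (G\<lparr>carrier := normalizer G H\<rparr>)"
      using sub by simp
    show "g \<otimes>\<^bsub>G\<lparr>carrier := normalizer G H\<rparr>\<^esub> h \<in> centralizer G H"
      if "g \<in> centralizer G H" "h \<in> centralizer G H" for g h
    proof -
      have c: "g \<in> carrier G" "h \<in> carrier G" and "\<forall>y\<in>H. conj_by G g y = y" "\<forall>y\<in>H. conj_by G h y = y"
        using that assms by (auto simp: mem_centralizer_iff)
      then have "\<forall>y\<in>H. conj_by G (g \<otimes> h) y = y"
        using assms(1) conj_by_mult_left[OF c] by (metis subsetD)
      then show ?thesis using c assms by (simp add: mem_centralizer_iff)
    qed
  qed
  moreover have "g \<otimes>\<^bsub>?N\<^esub> h \<otimes>\<^bsub>?N\<^esub> inv\<^bsub>?N\<^esub> g \<in> centralizer G H"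
    if g: "g \<in> normalizer G H" and h: "h \<in> centralizer G H" for g h
  proof -
    have ig: "inv g \<in> normalizer G H"
      using g subgroup_normalizer[OF assms] by (simp add: subgroup.m_inv_closed)
    have c: "g \<in> carrier G" "h \<in> carrier G" and hy: "\<forall>y\<in>H. conj_by G h y = y"
      and y: "\<forall>y\<in>H. conj_by G (inv g) y \<in> H"
      using g h ig assms by (auto simp: mem_centralizer_iff mem_normalizer_iff)
    have "conj_by G (g \<otimes> h \<otimes> inv g) y = y" if "y \<in> H" for y
    proof -
      have yc: "y \<in> carrier G" using that assms(1) by blast
      then have "conj_by G (g \<otimes> h \<otimes> inv g) y = conj_by G g (conj_by G h (conj_by G (inv g) y))"
        using c by (simp add: conj_by_mult_left)
      then show ?thesis using hy y that c yc by simp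
    qed
    then show ?thesis using c assms g by (simp add: mem_centralizer_iff inv)
  qed
  ultimately show ?thesis
    unfolding N.normal_inv_iff by simp
qed

lemma group_Weyl:
  assumes "H \<subseteq> carrier G" "finite H"
  shows "group (Weyl G H)"
  unfolding Weyl_def by (rule normal.factorgroup_is_group[OF normal_centralizer[OF assms]])

lemma carrier_Weyl: "carrier (Weyl G H) = Weyl_class G H ` normalizer G H"
  by (simp add: Weyl_def Weyl_class_def carrier_FactGroup)

lemma one_Weyl:
  assumes "H \<subseteq> carrier G" "finite H"
  shows "\<one>\<^bsub>Weyl G H\<^esub> = Weyl_class G H \<one>"
  using assms by (auto simp: Weyl_def Weyl_class_def r_coset_def mem_centralizer_iff)

lemma mult_Weyl:
  assumes "H \<subseteq> carrier G" "finite H" "g \<in> normalizer G H" "h \<in> normalizer G H"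
  shows "Weyl_class G H g \<otimes>\<^bsub>Weyl G H\<^esub> Weyl_class G H h = Weyl_class G H (g \<otimes> h)"
  using normal.rcos_sum[OF normal_centralizer[OF assms(1,2)], of g h] assms(3,4)
  by (simp add: Weyl_def Weyl_class_def)

lemma inv_Weyl:
  assumes "H \<subseteq> carrier G" "finite H" "g \<in> normalizer G H"
  shows "inv\<^bsub>Weyl G H\<^esub> (Weyl_class G H g) = Weyl_class G H (inv g)"
proof -
  interpret W: group "Weyl G H" using group_Weyl assms by blast
  have ig: "inv g \<in> normalizer G H" and gc: "g \<in> carrier G"
    using subgroup.m_inv_closed[OF subgroup_normalizer[OF assms(1,2)] assms(3)]
      subgroup.mem_carrier[OF subgroup_normalizer[OF assms(1,2)] assms(3)] by simp_all
  show ?thesis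
  proof (rule W.inv_equality)
    show "Weyl_class G H (inv g) \<otimes>\<^bsub>Weyl G H\<^esub> Weyl_class G H g = \<one>\<^bsub>Weyl G H\<^esub>"
      using mult_Weyl[OF assms(1,2) ig assms(3)] one_Weyl[OF assms(1,2)] gc by simp
  qed (use assms(3) ig carrier_Weyl in blast)+
qed

text \<open>The Weyl group acts faithfully on \<open>H\<close>, which turns equations between cosets
  into comparisons of conjugation actions.\<close>

lemma Weyl_class_eq_iff:
  assumes H: "H \<subseteq> carrier G" "finite H" and g: "g \<in> normalizer G H" and h: "h \<in> normalizer G H"
  shows "Weyl_class G H g = Weyl_class G H h \<longleftrightarrow> (\<forall>y\<in>H. conj_by G g y = conj_by G h y)"
proof -
  interpret N: group "G\<lparr>carrier := normalizer G H\<rparr>"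
    using subgroup_normalizer[OF H] subgroup_imp_group by blast
  interpret C: normal "centralizer G H" "G\<lparr>carrier := normalizer G H\<rparr>"
    by (rule normal_centralizer[OF H])
  have c: "g \<in> carrier G" "h \<in> carrier G" using g h H by (auto simp: mem_normalizer_iff)
  have ih: "inv h \<in> normalizer G H"
    using h subgroup_normalizer[OF H] by (simp add: subgroup.m_inv_closed)
  have y: "conj_by G h y \<in> H" "conj_by G (inv h) y \<in> H" if "y \<in> H" for y
    using that h ih H by (auto simp: mem_normalizer_iff)
  show ?thesis
  proof
    assume "Weyl_class G H g = Weyl_class G H h"
    then have "g \<in> Weyl_class G H h"
      using N.rcos_self[OF _ C.is_subgroup] g unfolding Weyl_class_def by force
    then obtain k where k: "k \<in> centralizer G H" "g = k \<otimes> h"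
      by (auto simp: Weyl_class_def r_coset_def)
    have kc: "k \<in> carrier G" "\<forall>y\<in>H. conj_by G k y = y"
      using k(1) H(1) by (auto simp: mem_centralizer_iff)
    show "\<forall>y\<in>H. conj_by G g y = conj_by G h y"
      using y(1) kc conj_by_mult_left[OF kc(1) c(2)] k(2) H(1) by (metis subsetD)
  next
    assume eq: "\<forall>y\<in>H. conj_by G g y = conj_by G h y"
    have "conj_by G (g \<otimes> inv h) y = y" if "y \<in> H" for y
    proof -
      have "y \<in> carrier G" using that H(1) by blast
      then have "conj_by G (g \<otimes> inv h) y = conj_by G g (conj_by G (inv h) y)"
        using c by (simp add: conj_by_mult_left)
      also have "\<dots> = conj_by G h (conj_by G (inv h) y)"
        using eq y(2)[OF that] by blast
      finally show ?thesis using c \<open>y \<in> carrier G\<close> by simp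
    qed
    then have "g \<otimes> inv h \<in> centralizer G H"
      using c H by (simp add: mem_centralizer_iff)
    then have "(g \<otimes> inv h) \<otimes> h \<in> Weyl_class G H h"
      by (auto simp: Weyl_class_def r_coset_def)
    then have "g \<in> Weyl_class G H h" using c by (simp add: m_assoc)
    then show "Weyl_class G H g = Weyl_class G H h"
      using N.repr_independence[OF _ _ C.is_subgroup] h unfolding Weyl_class_def by force
  qed
qed

text \<open>A prime \<open>p\<close> dividing the order yields a nontrivial element whose order
  divides both \<open>p\<close> and 2. This is what gives a value to \<open>rk\<close>, a definite
  description.\<close>

lemma card_exponent_2:
  assumes fin: "finite (carrier G)" and sq: "\<And>x. x \<in> carrier G \<Longrightarrow> x \<otimes> x = \<one>"
  shows "\<exists>k. card (carrier G) = 2 ^ k"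
proof -
  have "p = 2" if p: "prime p" "p dvd order G" for p
  proof -
    \<comment> \<open>Sylow's theorem is applied with exponent 1, that is, as Cauchy's theorem, to
      get a subgroup of prime order.\<close>
    obtain m where "order G = p ^ 1 * m" using p(2) by (auto elim: dvdE)
    from sylow_thm[OF p(1) is_group this fin] obtain H where H: "subgroup H G" "card H = p" by auto
    have "H \<noteq> {\<one>}" using H(2) p(1) by auto
    then obtain h where h: "h \<in> H" "h \<noteq> \<one>" using subgroup.one_closed[OF H(1)] by blast
    have hc: "h \<in> carrier G" using h H subgroup.subset by blast
    interpret H: group "G\<lparr>carrier := H\<rparr>" using H(1) subgroup_imp_group by blast
    have "h [^]\<^bsub>G\<lparr>carrier := H\<rparr>\<^esub> order (G\<lparr>carrier := H\<rparr>) = \<one>"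
      using H.pow_order_eq_1 h by simp
    then have "h [^] p = \<one>" using H(2) nat_pow_consistent[of h p H] by (simp add: order_def)
    then have "ord h dvd p" using pow_eq_id hc by blast
    moreover have "h [^] (2::nat) = \<one>" using sq hc by (simp add: numeral_2_eq_2)
    then have "ord h dvd 2" using pow_eq_id hc by blast
    moreover have "ord h \<noteq> 1" using ord_eq_1 hc h by blast
    ultimately show ?thesis using p(1) by (metis two_is_prime_nat prime_nat_iff)
  qed
  then have "prime_factors (order G) \<subseteq> {2}" by auto
  then have "prime_factors (order G) = {} \<or> prime_factors (order G) = {2}"
    by (rule subset_singletonD)
  moreover have "order G = (\<Prod>p\<in>prime_factors (order G). p ^ multiplicity p (order G))"
    using prime_factorization_nat[of "order G"] order_gt_0_iff_finite fin by simp
  ultimately have "order G = 2 ^ 0 \<or> order G = 2 ^ multiplicity 2 (order G)"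
    by (elim disjE) simp_all
  then show ?thesis unfolding order_def by metis
qed

end

text \<open>Both targets are isomorphic to the quotient by the common kernel, so no map between
  \<open>H\<close> and \<open>H'\<close> has to be written down. In \<open>levi_iso\<close> this
  avoids choosing representatives of Weyl classes.\<close>

lemma (in group) iso_of_same_kernel:
  assumes H: "group H" and H': "group H'"
    and f: "f \<in> hom G H" "f ` carrier G = carrier H"
    and f': "f' \<in> hom G H'" "f' ` carrier G = carrier H'"
    and ker: "\<And>x. x \<in> carrier G \<Longrightarrow> f x = \<one>\<^bsub>H\<^esub> \<longleftrightarrow> f' x = \<one>\<^bsub>H'\<^esub>"
  shows "H \<cong> H'"
proof -
  interpret f: group_hom G H f using H f by (simp add: group_hom_def group_hom_axioms_def is_group)
  interpret f': group_hom G H' f' using H' f' by (simp add: group_hom_def group_hom_axioms_def is_group)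
  have k: "kernel G H f = kernel G H' f'" using ker by (auto simp: kernel_def)
  interpret Q: group "G Mod kernel G H f" by (rule normal.factorgroup_is_group[OF f.normal_kernel])
  have "G Mod kernel G H f \<cong> H" "G Mod kernel G H f \<cong> H'"
    using f.FactGroup_iso[OF f(2)] f'.FactGroup_iso[OF f'(2)] k by auto
  then show ?thesis using Q.iso_sym iso_trans by blast
qed

text \<open>The elements on which two conjugations agree form a subgroup.\<close>

lemma (in group) conj_by_eq_on_generate:
  assumes "S \<subseteq> carrier G" "g \<in> carrier G" "h \<in> carrier G"
    and "\<And>s. s \<in> S \<Longrightarrow> conj_by G g s = conj_by G h s" and "y \<in> generate G S"
  shows "conj_by G g y = conj_by G h y"
proof -
  have "subgroup {y \<in> carrier G. conj_by G g y = conj_by G h y} G"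
    using assms(2,3) by (intro subgroupI) (auto simp: conj_by_mult conj_by_inv)
  moreover have "S \<subseteq> {y \<in> carrier G. conj_by G g y = conj_by G h y}"
    using assms(1,4) by auto
  ultimately have "y \<in> {y \<in> carrier G. conj_by G g y = conj_by G h y}"
    using generate_subgroup_incl assms(5) by blast
  then show ?thesis by blast
qed

subsection \<open>Splitting of the Weyl group of a product of subgroups\<close>

text \<open>In the application \<open>L\<close> is GL_r(2), \<open>M\<close> is PGL_m,
  \<open>A\<close> is \<open>D_r\<close>, \<open>\<iota>\<close> sends a matrix to a permutation of
  coordinates and \<open>\<kappa>\<close> is the Kronecker product with an identity.
  \<open>realize_aut\<close> fills the diagonal block of \<open>A\<close>,
  \<open>realize_block\<close> that of \<open>B\<close>, and \<open>twist\<close> the block between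
  them. Connectedness of the centralizer enters through \<open>normalizes_B\<close>, torality
  through \<open>twist\<close>.\<close>

locale weyl_extension = G: group G + L: group L + M: group M
  for G :: "('g, 'x) monoid_scheme" (structure)
    and L :: "('l, 'y) monoid_scheme" and M :: "('m, 'z) monoid_scheme" +
  fixes A B :: "'g set" and x :: "nat \<Rightarrow> 'g" and r :: nat and U :: "'m set"
    and \<iota> :: "'l \<Rightarrow> 'g" and \<kappa> :: "'m \<Rightarrow> 'g"
  assumes A_gen: "A = generate G (x ` {..<r})" and x_carrier: "x ` {..<r} \<subseteq> carrier G"
    and finite_A: "finite A"
    and B_sub: "subgroup B G" and finite_B: "finite B"
    and comm: "\<And>y z. y \<in> A \<union> B \<Longrightarrow> z \<in> A \<union> B \<Longrightarrow> y \<otimes> z = z \<otimes> y"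
    and B_square: "\<And>b. b \<in> B \<Longrightarrow> b \<otimes> b = \<one>"
    and A_Int_B: "A \<inter> B = {\<one>}"
    and U_sub: "subgroup U M"
    and \<iota>_hom: "\<iota> \<in> hom L G" and \<kappa>_hom: "\<kappa> \<in> hom M G"
    and \<kappa>_inj: "inj_on \<kappa> (carrier M)" and \<kappa>_U: "\<kappa> ` U = B"
    and \<iota>_A: "\<And>l a. l \<in> carrier L \<Longrightarrow> a \<in> A \<Longrightarrow> conj_by G (\<iota> l) a \<in> A"
    and \<iota>_faithful: "\<And>l. l \<in> carrier L \<Longrightarrow> \<forall>a\<in>A. conj_by G (\<iota> l) a = a \<Longrightarrow> l = \<one>\<^bsub>L\<^esub>"
    and \<iota>_\<kappa>: "\<And>l z. l \<in> carrier L \<Longrightarrow> z \<in> carrier M \<Longrightarrow> \<iota> l \<otimes> \<kappa> z = \<kappa> z \<otimes> \<iota> l"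
    and \<kappa>_A: "\<And>z a. z \<in> carrier M \<Longrightarrow> a \<in> A \<Longrightarrow> conj_by G (\<kappa> z) a = a"
    and normalizes_B: "\<And>g b. g \<in> normalizer G (A <#> B) \<Longrightarrow> b \<in> B \<Longrightarrow> conj_by G g b \<in> B"
    and twist: "\<And>f. f \<in> {..<r} \<rightarrow> B \<Longrightarrow>
      \<exists>g\<in>carrier G. (\<forall>b\<in>B. conj_by G g b = b) \<and> (\<forall>i<r. conj_by G g (x i) = x i \<otimes> f i)"
    and realize_aut: "\<And>\<beta>. \<beta> \<in> hom (G\<lparr>carrier := A\<rparr>) (G\<lparr>carrier := A\<rparr>) \<Longrightarrow> inj_on \<beta> A \<Longrightarrow>
      \<exists>l\<in>carrier L. \<forall>a\<in>A. conj_by G (\<iota> l) a = \<beta> a"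
    and realize_block: "\<And>g. g \<in> carrier G \<Longrightarrow> \<forall>a\<in>A. conj_by G g a = a \<Longrightarrow>
      \<forall>b\<in>B. conj_by G g b \<in> B \<Longrightarrow> \<exists>z\<in>carrier M. \<forall>b\<in>B. conj_by G g b = conj_by G (\<kappa> z) b"
begin

section \<open>The group \<open>D\<close> as a direct product, and its normalizer\<close>

abbreviation "D \<equiv> A <#> B"
abbreviation "N \<equiv> normalizer G D"
abbreviation "W \<equiv> Weyl G D"
abbreviation "q \<equiv> Weyl_class G D"

lemma A_sub: "subgroup A G"
  unfolding A_gen by (rule G.generate_is_subgroup[OF x_carrier])

lemma A_carrier: "a \<in> A \<Longrightarrow> a \<in> carrier G" and B_carrier: "b \<in> B \<Longrightarrow> b \<in> carrier G"
  using subgroup.mem_carrier[OF A_sub] subgroup.mem_carrier[OF B_sub] by auto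

lemma \<iota>_carrier: "l \<in> carrier L \<Longrightarrow> \<iota> l \<in> carrier G"
  and \<kappa>_carrier: "z \<in> carrier M \<Longrightarrow> \<kappa> z \<in> carrier G"
  using \<iota>_hom \<kappa>_hom by (auto simp: hom_def)

lemma x_in_A: "i < r \<Longrightarrow> x i \<in> A"
  unfolding A_gen by (simp add: generate.incl)

lemma D_memI: "a \<in> A \<Longrightarrow> b \<in> B \<Longrightarrow> a \<otimes> b \<in> D"
  by (auto simp: set_mult_def)

lemma D_memE:
  assumes "y \<in> D" obtains a b where "a \<in> A" "b \<in> B" "y = a \<otimes> b"
  using assms by (auto simp: set_mult_def)

lemma D_carrier: "D \<subseteq> carrier G"
  using A_carrier B_carrier by (auto simp: set_mult_def)

lemma finite_D: "finite D"
proof -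
  have "D = (\<lambda>(a, b). a \<otimes> b) ` (A \<times> B)" by (auto simp: set_mult_def)
  then show ?thesis using finite_A finite_B by simp
qed

lemma A_sub_D: "A \<subseteq> D" and B_sub_D: "B \<subseteq> D"
proof -
  show "A \<subseteq> D"
  proof
    fix a assume "a \<in> A"
    then show "a \<in> D"
      using D_memI[OF _ subgroup.one_closed[OF B_sub], of a] A_carrier[of a] by simp
  qed
  show "B \<subseteq> D"
  proof
    fix b assume "b \<in> B"
    then show "b \<in> D"
      using D_memI[OF subgroup.one_closed[OF A_sub], of b] B_carrier[of b] by simp
  qed
qed

lemma subgroup_D: "subgroup D G"
proof (rule G.subgroupI)
  show "D \<subseteq> carrier G" by (rule D_carrier)
  show "D \<noteq> {}" using B_sub_D subgroup.one_closed[OF B_sub] by blast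
  show "inv y \<in> D" if y: "y \<in> D" for y
  proof -
    obtain a b where ab: "a \<in> A" "b \<in> B" "y = a \<otimes> b" using y by (rule D_memE)
    have "y = b \<otimes> a" using ab comm[of a b] by simp
    then have "inv y = inv a \<otimes> inv b" using ab A_carrier B_carrier by (simp add: G.inv_mult_group)
    then show ?thesis
      using D_memI ab subgroup.m_inv_closed[OF A_sub] subgroup.m_inv_closed[OF B_sub] by simp
  qed
  show "y \<otimes> y' \<in> D" if y: "y \<in> D" "y' \<in> D" for y y'
  proof -
    obtain a b where ab: "a \<in> A" "b \<in> B" "y = a \<otimes> b" using y(1) by (rule D_memE)
    obtain a' b' where ab': "a' \<in> A" "b' \<in> B" "y' = a' \<otimes> b'" using y(2) by (rule D_memE)
    have c: "a \<in> carrier G" "a' \<in> carrier G" "b \<in> carrier G" "b' \<in> carrier G"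
      using ab ab' A_carrier B_carrier by auto
    have "y \<otimes> y' = a \<otimes> (b \<otimes> a') \<otimes> b'" using ab ab' c by (simp add: G.m_assoc)
    also have "\<dots> = (a \<otimes> a') \<otimes> (b \<otimes> b')"
      using comm[of b a'] ab ab' c by (simp add: G.m_assoc)
    finally show ?thesis
      using D_memI ab ab' subgroup.m_closed[OF A_sub] subgroup.m_closed[OF B_sub] by simp
  qed
qed

lemma N_iff: "g \<in> N \<longleftrightarrow> g \<in> carrier G \<and> (\<forall>y\<in>D. conj_by G g y \<in> D)"
  by (rule G.mem_normalizer_iff[OF D_carrier finite_D])

lemma subgroup_N: "subgroup N G"
  by (rule G.subgroup_normalizer[OF D_carrier finite_D])

lemma N_carrier: "g \<in> N \<Longrightarrow> g \<in> carrier G"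
  by (simp add: N_iff)

lemma N_inv: "g \<in> N \<Longrightarrow> inv g \<in> N" and N_mult: "g \<in> N \<Longrightarrow> h \<in> N \<Longrightarrow> g \<otimes> h \<in> N"
  using subgroup_N by (auto simp: subgroup.m_inv_closed subgroup.m_closed)

lemma q_eq_iff: "g \<in> N \<Longrightarrow> h \<in> N \<Longrightarrow> q g = q h \<longleftrightarrow> (\<forall>y\<in>D. conj_by G g y = conj_by G h y)"
  by (rule G.Weyl_class_eq_iff[OF D_carrier finite_D])

text \<open>\<open>D\<close> is generated by the \<open>x i\<close> together with \<open>B\<close>,
  so two actions need to be compared there only.\<close>

lemma agree_on_D:
  assumes "g \<in> carrier G" "h \<in> carrier G"
    and "\<And>i. i < r \<Longrightarrow> conj_by G g (x i) = conj_by G h (x i)"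
    and "\<And>b. b \<in> B \<Longrightarrow> conj_by G g b = conj_by G h b"
    and "y \<in> D"
  shows "conj_by G g y = conj_by G h y"
proof -
  obtain a b where ab: "a \<in> A" "b \<in> B" "y = a \<otimes> b" using assms(5) by (rule D_memE)
  have "conj_by G g a = conj_by G h a"
    using G.conj_by_eq_on_generate[OF x_carrier assms(1,2)] assms(3) ab(1) A_gen by auto
  then show ?thesis
    using ab assms(1,2,4) A_carrier B_carrier by (simp add: G.conj_by_mult)
qed

section \<open>The unipotent part: elements acting trivially on \<open>B\<close> and on
  \<open>D\<close> modulo \<open>B\<close>\<close>

definition twists :: "'g set" where
  "twists = {g \<in> carrier G. (\<forall>b\<in>B. conj_by G g b = b) \<and> (\<forall>y\<in>D. \<exists>b\<in>B. conj_by G g y = y \<otimes> b)}"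

lemma twists_carrier: "g \<in> twists \<Longrightarrow> g \<in> carrier G"
  by (simp add: twists_def)

lemma twists_B: "g \<in> twists \<Longrightarrow> b \<in> B \<Longrightarrow> conj_by G g b = b"
  by (simp add: twists_def)

lemma twistsE:
  assumes "g \<in> twists" "y \<in> D" obtains b where "b \<in> B" "conj_by G g y = y \<otimes> b"
  using assms by (auto simp: twists_def)

lemma twists_sub_N: "twists \<subseteq> N"
proof
  fix g assume g: "g \<in> twists"
  have "conj_by G g y \<in> D" if y: "y \<in> D" for y
  proof -
    obtain b where b: "b \<in> B" "conj_by G g y = y \<otimes> b" using g y by (rule twistsE)
    then show ?thesis using subgroup.m_closed[OF subgroup_D y] B_sub_D by auto
  qed
  then show "g \<in> N" using twists_carrier[OF g] by (simp add: N_iff)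
qed

lemma subgroup_twists: "subgroup twists G"
proof (rule G.subgroupI)
  show "twists \<subseteq> carrier G" by (auto simp: twists_def)
  have "\<one> \<in> twists"
  proof -
    have "\<exists>b\<in>B. conj_by G \<one> y = y \<otimes> b" if "y \<in> D" for y
      using that D_carrier subgroup.one_closed[OF B_sub] by (intro bexI[of _ \<one>]) auto
    then show ?thesis using B_carrier by (simp add: twists_def)
  qed
  then show "twists \<noteq> {}" by blast
  show "g \<otimes> h \<in> twists" if gh: "g \<in> twists" "h \<in> twists" for g h
  proof -
    have c: "g \<in> carrier G" "h \<in> carrier G" using gh twists_carrier by auto
    have "\<exists>b\<in>B. conj_by G (g \<otimes> h) y = y \<otimes> b" if y: "y \<in> D" for y
    proof -
      obtain b where b: "b \<in> B" "conj_by G h y = y \<otimes> b" using gh(2) y by (rule twistsE)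
      obtain b' where b': "b' \<in> B" "conj_by G g y = y \<otimes> b'" using gh(1) y by (rule twistsE)
      have yc: "y \<in> carrier G" using y D_carrier by blast
      have "conj_by G (g \<otimes> h) y = y \<otimes> (b' \<otimes> b)"
        using c yc b b' B_carrier twists_B[OF gh(1) b(1)]
        by (simp add: G.conj_by_mult_left G.conj_by_mult G.m_assoc)
      then show ?thesis using b b' subgroup.m_closed[OF B_sub] by blast
    qed
    moreover have "conj_by G (g \<otimes> h) b = b" if "b \<in> B" for b
      using that c B_carrier gh twists_B by (simp add: G.conj_by_mult_left)
    ultimately show ?thesis using c by (simp add: twists_def)
  qed
  show "inv g \<in> twists" if g: "g \<in> twists" for g
  proof -
    have c: "g \<in> carrier G" using g twists_carrier by auto
    have B: "conj_by G (inv g) b = b" if "b \<in> B" for b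
      using G.conj_by_cancel(1)[OF c B_carrier[OF that]] twists_B[OF g that] by simp
    have "\<exists>b\<in>B. conj_by G (inv g) y = y \<otimes> b" if y: "y \<in> D" for y
    proof -
      obtain b where b: "b \<in> B" "conj_by G g y = y \<otimes> b" using g y by (rule twistsE)
      have yc: "y \<in> carrier G" and bc: "b \<in> carrier G" using y D_carrier b B_carrier by auto
      have "y = conj_by G (inv g) (y \<otimes> b)"
        using G.conj_by_cancel(1)[OF c yc] b by simp
      also have "\<dots> = conj_by G (inv g) y \<otimes> b"
        using c yc bc B[OF b(1)] by (simp add: G.conj_by_mult)
      finally have "conj_by G (inv g) y = y \<otimes> inv b"
        using c yc bc by (simp add: G.inv_solve_right)
      then show ?thesis using b subgroup.m_inv_closed[OF B_sub] by blast
    qed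
    then show ?thesis using B c by (simp add: twists_def)
  qed
qed

text \<open>If \<open>g\<close> displaces \<open>conj_by G (inv h) y\<close> by \<open>b\<close>,
  then the conjugate of \<open>g\<close> by \<open>h\<close> displaces \<open>y\<close> by
  \<open>conj_by G h b\<close>, which lies in \<open>B\<close> because the normalizer preserves
  \<open>B\<close>.\<close>

lemma twists_normal:
  assumes h: "h \<in> N" and g: "g \<in> twists"
  shows "h \<otimes> g \<otimes> inv h \<in> twists"
proof -
  have c: "h \<in> carrier G" "g \<in> carrier G" using h g N_carrier twists_carrier by auto
  have act: "conj_by G (h \<otimes> g \<otimes> inv h) y = conj_by G h (conj_by G g (conj_by G (inv h) y))"
    if "y \<in> carrier G" for y
    using that c by (simp add: G.conj_by_mult_left)
  have "conj_by G (h \<otimes> g \<otimes> inv h) b = b" if "b \<in> B" for b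
    using that c B_carrier normalizes_B[OF N_inv[OF h] that] twists_B[OF g] act by simp
  moreover have "\<exists>b\<in>B. conj_by G (h \<otimes> g \<otimes> inv h) y = y \<otimes> b" if y: "y \<in> D" for y
  proof -
    have yc: "y \<in> carrier G" using y D_carrier by blast
    have "conj_by G (inv h) y \<in> D" using N_inv[OF h] y N_iff by blast
    then obtain b where b: "b \<in> B" "conj_by G g (conj_by G (inv h) y) = conj_by G (inv h) y \<otimes> b"
      using g by (elim twistsE)
    have "conj_by G (h \<otimes> g \<otimes> inv h) y = y \<otimes> conj_by G h b"
      using act[OF yc] b c yc B_carrier by (simp add: G.conj_by_mult)
    then show ?thesis using normalizes_B[OF h b(1)] by blast
  qed
  ultimately show ?thesis using c by (simp add: twists_def)
qed

section \<open>The image of the twists in the Weyl group\<close>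

lemma group_W: "group W"
  by (rule G.group_Weyl[OF D_carrier finite_D])

lemma q_mult: "g \<in> N \<Longrightarrow> h \<in> N \<Longrightarrow> q g \<otimes>\<^bsub>W\<^esub> q h = q (g \<otimes> h)"
  by (rule G.mult_Weyl[OF D_carrier finite_D])

lemma q_inv: "g \<in> N \<Longrightarrow> inv\<^bsub>W\<^esub> (q g) = q (inv g)"
  by (rule G.inv_Weyl[OF D_carrier finite_D])

lemma q_one: "\<one>\<^bsub>W\<^esub> = q \<one>"
  by (rule G.one_Weyl[OF D_carrier finite_D])

lemma carrier_W: "carrier W = q ` N"
  by (rule G.carrier_Weyl)

lemma one_N: "\<one> \<in> N"
  using subgroup.one_closed[OF subgroup_N] .

lemma subgroup_q_image:
  assumes "subgroup H G" "H \<subseteq> N"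
  shows "subgroup (q ` H) W"
proof -
  interpret W: group W by (rule group_W)
  show ?thesis
  proof (rule W.subgroupI)
    show "q ` H \<subseteq> carrier W" using assms(2) carrier_W by auto
    show "q ` H \<noteq> {}" using subgroup.one_closed[OF assms(1)] by blast
    show "inv\<^bsub>W\<^esub> X \<in> q ` H" if X: "X \<in> q ` H" for X
    proof -
      obtain g where g: "g \<in> H" "X = q g" using X by blast
      then have "inv\<^bsub>W\<^esub> X = q (inv g)" using q_inv assms(2) by blast
      then show ?thesis using subgroup.m_inv_closed[OF assms(1) g(1)] by simp
    qed
    show "X \<otimes>\<^bsub>W\<^esub> Y \<in> q ` H" if XY: "X \<in> q ` H" "Y \<in> q ` H" for X Y
    proof -
      obtain g h where g: "g \<in> H" "X = q g" "h \<in> H" "Y = q h" using XY by blast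
      then have "X \<otimes>\<^bsub>W\<^esub> Y = q (g \<otimes> h)" using q_mult assms(2) by blast
      then show ?thesis using subgroup.m_closed[OF assms(1) g(1,3)] by simp
    qed
  qed
qed

lemma twist_classes_normal: "q ` twists \<lhd> W"
proof -
  interpret W: group W by (rule group_W)
  have "X \<otimes>\<^bsub>W\<^esub> Y \<otimes>\<^bsub>W\<^esub> inv\<^bsub>W\<^esub> X \<in> q ` twists" if XY: "X \<in> carrier W" "Y \<in> q ` twists" for X Y
  proof -
    obtain h where h: "h \<in> N" "X = q h" using XY(1) carrier_W by auto
    obtain g where g: "g \<in> twists" "Y = q g" using XY(2) by auto
    have N: "g \<in> N" using g twists_sub_N by auto
    have "X \<otimes>\<^bsub>W\<^esub> Y \<otimes>\<^bsub>W\<^esub> inv\<^bsub>W\<^esub> X = q (h \<otimes> g \<otimes> inv h)"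
      using q_mult[OF h(1) N] q_mult[OF N_mult[OF h(1) N] N_inv[OF h(1)]] q_inv[OF h(1)] h(2) g(2)
      by simp
    then show ?thesis using twists_normal[OF h(1) g(1)] by simp
  qed
  then show ?thesis
    using subgroup_q_image[OF subgroup_twists twists_sub_N] by (subst W.normal_inv_iff) simp
qed

text \<open>The hypothesis \<open>twist\<close> controls the generators only. The elements
  \<open>a\<close> of \<open>A\<close> that stay in their coset modulo \<open>B\<close> form a
  subgroup, because \<open>A\<close> commutes with \<open>B\<close> and \<open>B\<close> is fixed;
  so the condition in \<open>twists\<close> spreads to all of \<open>D\<close>.\<close>

lemma twist_exists:
  assumes "f \<in> {..<r} \<rightarrow> B"
  obtains g where "g \<in> twists" "\<And>i. i < r \<Longrightarrow> conj_by G g (x i) = x i \<otimes> f i"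
proof -
  obtain g where g: "g \<in> carrier G" "\<forall>b\<in>B. conj_by G g b = b"
    and gx: "\<forall>i<r. conj_by G g (x i) = x i \<otimes> f i"
    using twist[OF assms] by blast
  let ?H = "{a \<in> A. \<exists>b\<in>B. conj_by G g a = a \<otimes> b}"
  have "subgroup ?H G"
  proof (rule G.subgroupI)
    show "?H \<subseteq> carrier G" using A_carrier by blast
    have "\<one> \<in> ?H"
      using g(1) subgroup.one_closed[OF A_sub] subgroup.one_closed[OF B_sub] by simp (rule bexI[of _ \<one>], simp_all)
    then show "?H \<noteq> {}" by blast
    show "a \<otimes> a' \<in> ?H" if aa: "a \<in> ?H" "a' \<in> ?H" for a a'
    proof -
      obtain b b' where b: "b \<in> B" "conj_by G g a = a \<otimes> b" "b' \<in> B" "conj_by G g a' = a' \<otimes> b'"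
        using aa by blast
      have c: "a \<in> carrier G" "a' \<in> carrier G" "b \<in> carrier G" "b' \<in> carrier G"
        using aa b A_carrier B_carrier by auto
      have "conj_by G g (a \<otimes> a') = a \<otimes> (b \<otimes> a') \<otimes> b'"
        using c g(1) b by (simp add: G.conj_by_mult G.m_assoc)
      also have "\<dots> = (a \<otimes> a') \<otimes> (b \<otimes> b')"
        using comm[of b a'] b aa c by (simp add: G.m_assoc)
      finally have "conj_by G g (a \<otimes> a') = (a \<otimes> a') \<otimes> (b \<otimes> b')" .
      moreover have "a \<otimes> a' \<in> A" "b \<otimes> b' \<in> B"
        using b aa subgroup.m_closed[OF B_sub] subgroup.m_closed[OF A_sub] by simp_all
      ultimately show ?thesis by blast
    qed
    show "inv a \<in> ?H" if aa: "a \<in> ?H" for a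
    proof -
      obtain b where b: "b \<in> B" "conj_by G g a = a \<otimes> b"
        using aa by blast
      have c: "a \<in> carrier G" "b \<in> carrier G" using aa b A_carrier B_carrier by auto
      have "conj_by G g (inv a) = inv (b \<otimes> a)"
        using c g(1) b comm[of a b] aa by (simp add: G.conj_by_inv)
      then have "conj_by G g (inv a) = inv a \<otimes> inv b"
        using c by (simp add: G.inv_mult_group)
      moreover have "inv a \<in> A" "inv b \<in> B"
        using b aa subgroup.m_inv_closed[OF B_sub] subgroup.m_inv_closed[OF A_sub] by simp_all
      ultimately show ?thesis by blast
    qed
  qed
  moreover have "x ` {..<r} \<subseteq> ?H"
  proof
    fix s assume "s \<in> x ` {..<r}"
    then obtain i where "i < r" "s = x i" by blast
    moreover have "f i \<in> B" using assms \<open>i < r\<close> by auto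
    ultimately show "s \<in> ?H" using gx x_in_A by blast
  qed
  ultimately have "generate G (x ` {..<r}) \<subseteq> ?H"
    by (intro G.generate_subgroup_incl)
  then have "A \<subseteq> ?H" by (simp only: flip: A_gen)
  have "\<exists>b\<in>B. conj_by G g y = y \<otimes> b" if yD: "y \<in> D" for y
  proof -
    obtain a b where ab: "a \<in> A" "b \<in> B" "y = a \<otimes> b" using yD by (rule D_memE)
    obtain b' where b': "b' \<in> B" "conj_by G g a = a \<otimes> b'" using \<open>A \<subseteq> ?H\<close> ab(1) by blast
    have c: "a \<in> carrier G" "b' \<in> carrier G" "b \<in> carrier G" using ab b' A_carrier B_carrier by auto
    have "conj_by G g y = a \<otimes> (b' \<otimes> b)"
      using ab b' c g by (simp add: G.conj_by_mult G.m_assoc)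
    also have "\<dots> = y \<otimes> b'"
      using comm[of b b'] ab b' c by (simp add: G.m_assoc)
    finally show ?thesis using b' by blast
  qed
  then have "g \<in> twists" using g by (simp add: twists_def)
  then show thesis using gx by (intro that[of g]) simp_all
qed

lemma twists_eq_iff:
  assumes "g \<in> twists" "h \<in> twists"
  shows "q g = q h \<longleftrightarrow> (\<forall>i<r. conj_by G g (x i) = conj_by G h (x i))"
proof -
  have "g \<in> N" "h \<in> N" using assms twists_sub_N by auto
  then have *: "q g = q h \<longleftrightarrow> (\<forall>y\<in>D. conj_by G g y = conj_by G h y)" by (rule q_eq_iff)
  show ?thesis
  proof
    assume "q g = q h"
    then show "\<forall>i<r. conj_by G g (x i) = conj_by G h (x i)" using * x_in_A A_sub_D by blast
  next
    assume "\<forall>i<r. conj_by G g (x i) = conj_by G h (x i)"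
    then have "\<forall>y\<in>D. conj_by G g y = conj_by G h y"
      using agree_on_D[OF twists_carrier[OF assms(1)] twists_carrier[OF assms(2)]]
        twists_B[OF assms(1)] twists_B[OF assms(2)] by simp
    then show "q g = q h" using * by blast
  qed
qed

text \<open>Modulo the centralizer a twist is determined by its displacements of the
  \<open>r\<close> generators, and these are free in \<open>B\<close>. Extensional functions turn
  this into a bijection that can be counted.\<close>

lemma card_twist_classes: "finite (q ` twists)" "card (q ` twists) = card B ^ r"
proof -
  \<comment> \<open>The choice of \<open>g\<close> is harmless: its class depends on
    \<open>f\<close> only, by \<open>twists_eq_iff\<close>.\<close>
  define F where "F f = q (SOME g. g \<in> twists \<and> (\<forall>i<r. conj_by G g (x i) = x i \<otimes> f i))" for f
  have F: "\<exists>g. g \<in> twists \<and> (\<forall>i<r. conj_by G g (x i) = x i \<otimes> f i) \<and> F f = q g"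
    if "f \<in> {..<r} \<rightarrow>\<^sub>E B" for f
  proof -
    have "\<exists>g. g \<in> twists \<and> (\<forall>i<r. conj_by G g (x i) = x i \<otimes> f i)"
    proof -
      have "f \<in> {..<r} \<rightarrow> B" using that by auto
      then obtain g where "g \<in> twists" "\<And>i. i < r \<Longrightarrow> conj_by G g (x i) = x i \<otimes> f i"
        using twist_exists[of f] by metis
      then show ?thesis by blast
    qed
    from someI_ex[OF this] show ?thesis unfolding F_def by blast
  qed
  have bij: "bij_betw F ({..<r} \<rightarrow>\<^sub>E B) (q ` twists)"
  proof (rule bij_betw_imageI)
    show "inj_on F ({..<r} \<rightarrow>\<^sub>E B)"
    proof (rule inj_onI)
      fix f f' assume f: "f \<in> {..<r} \<rightarrow>\<^sub>E B" "f' \<in> {..<r} \<rightarrow>\<^sub>E B" and eq: "F f = F f'"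
      obtain g g' where g: "g \<in> twists" "\<forall>i<r. conj_by G g (x i) = x i \<otimes> f i" "F f = q g"
        and g': "g' \<in> twists" "\<forall>i<r. conj_by G g' (x i) = x i \<otimes> f' i" "F f' = q g'"
        using F[OF f(1)] F[OF f(2)] by blast
      have "x i \<otimes> f i = x i \<otimes> f' i" if "i < r" for i
        using that g g' eq twists_eq_iff[OF g(1) g'(1)] by simp
      moreover have "f i \<in> carrier G" "f' i \<in> carrier G" "x i \<in> carrier G" if "i < r" for i
        using that f B_carrier A_carrier x_in_A by auto
      ultimately have "f i = f' i" if "i < r" for i using that G.Units_l_cancel[of "x i" "f i" "f' i"] G.Units_eq by simp
      then show "f = f'" using f by (intro PiE_ext[of f _ _ f']) auto
    qed
    show "F ` ({..<r} \<rightarrow>\<^sub>E B) = q ` twists"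
    proof
      show "F ` ({..<r} \<rightarrow>\<^sub>E B) \<subseteq> q ` twists" using F by blast
      show "q ` twists \<subseteq> F ` ({..<r} \<rightarrow>\<^sub>E B)"
      proof
        fix X assume "X \<in> q ` twists"
        then obtain g where g: "g \<in> twists" "X = q g" by blast
        have "\<forall>i\<in>{..<r}. \<exists>b\<in>B. conj_by G g (x i) = x i \<otimes> b"
          using g(1) x_in_A A_sub_D unfolding twists_def by blast
        then obtain f where f: "\<forall>i\<in>{..<r}. f i \<in> B \<and> conj_by G g (x i) = x i \<otimes> f i"
          using bchoice[of "{..<r}" "\<lambda>i b. b \<in> B \<and> conj_by G g (x i) = x i \<otimes> b"] by blast
        let ?f = "restrict f {..<r}"
        have fE: "?f \<in> {..<r} \<rightarrow>\<^sub>E B" using f by auto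
        obtain g' where g': "g' \<in> twists" "\<forall>i<r. conj_by G g' (x i) = x i \<otimes> ?f i" "F ?f = q g'"
          using F[OF fE] by blast
        have "q g = q g'" using twists_eq_iff[OF g(1) g'(1)] g' f by simp
        then show "X \<in> F ` ({..<r} \<rightarrow>\<^sub>E B)" using g g' fE by blast
      qed
    qed
  qed
  show "finite (q ` twists)"
    using bij_betw_finite[OF bij] finite_B by (simp add: finite_PiE)
  show "card (q ` twists) = card B ^ r"
    using bij_betw_same_card[OF bij] by (simp add: card_PiE)
qed

text \<open>Displacements multiply under composition, so commutativity and exponent 2 are inherited
  from \<open>B\<close>.\<close>

lemma twist_classes_elem_ab: "elem_ab_2 W (q ` twists)"
proof -
  have tw: "conj_by G (g \<otimes> h) y = y \<otimes> (b \<otimes> b')"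
    if "g \<in> twists" "h \<in> twists" "y \<in> D" "b \<in> B" "conj_by G g y = y \<otimes> b"
      "b' \<in> B" "conj_by G h y = y \<otimes> b'" for g h y b b'
  proof -
    have "g \<in> carrier G" "h \<in> carrier G" "y \<in> carrier G" "b \<in> carrier G" "b' \<in> carrier G"
      using that D_carrier B_carrier twists_carrier by auto
    then show ?thesis
      using that twists_B[OF that(1,6)] by (simp add: G.conj_by_mult_left G.conj_by_mult G.m_assoc)
  qed
  have c: "q g \<otimes>\<^bsub>W\<^esub> q h = q h \<otimes>\<^bsub>W\<^esub> q g" if gh: "g \<in> twists" "h \<in> twists" for g h
  proof -
    have N: "g \<in> N" "h \<in> N" using gh twists_sub_N by auto
    have "conj_by G (g \<otimes> h) y = conj_by G (h \<otimes> g) y" if y: "y \<in> D" for y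
    proof -
      obtain b where b: "b \<in> B" "conj_by G g y = y \<otimes> b" using gh(1) y by (rule twistsE)
      obtain b' where b': "b' \<in> B" "conj_by G h y = y \<otimes> b'" using gh(2) y by (rule twistsE)
      show ?thesis using tw[OF gh y b b'] tw[OF gh(2,1) y b' b] comm[of b b'] b b' by simp
    qed
    then show ?thesis using N N_mult by (simp add: q_mult q_eq_iff)
  qed
  have s: "q g \<otimes>\<^bsub>W\<^esub> q g = \<one>\<^bsub>W\<^esub>" if g: "g \<in> twists" for g
  proof -
    have N: "g \<in> N" using g twists_sub_N by auto
    have "conj_by G (g \<otimes> g) y = conj_by G \<one> y" if y: "y \<in> D" for y
    proof -
      obtain b where b: "b \<in> B" "conj_by G g y = y \<otimes> b" using g y by (rule twistsE)
      have "y \<in> carrier G" using y D_carrier by blast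
      then show ?thesis using tw[OF g g y b b] B_square[OF b(1)] by simp
    qed
    then show ?thesis using N N_mult one_N by (simp add: q_mult q_one q_eq_iff)
  qed
  have "\<forall>X\<in>q ` twists. \<forall>Y\<in>q ` twists. X \<otimes>\<^bsub>W\<^esub> Y = Y \<otimes>\<^bsub>W\<^esub> X" using c by blast
  moreover have "\<forall>X\<in>q ` twists. X \<otimes>\<^bsub>W\<^esub> X = \<one>\<^bsub>W\<^esub>" using s by blast
  ultimately show ?thesis
    unfolding elem_ab_2_def
    using subgroup_q_image[OF subgroup_twists twists_sub_N] card_twist_classes(1) by blast
qed

section \<open>The block diagonal part as a complement\<close>

lemma finite_U: "finite U" and U_carrier: "U \<subseteq> carrier M"
proof -
  show "U \<subseteq> carrier M" using U_sub subgroup.subset by blast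
  then have "inj_on \<kappa> U" using \<kappa>_inj inj_on_subset by blast
  then show "finite U" using finite_imageD[of \<kappa> U] \<kappa>_U finite_B by simp
qed

lemma \<iota>_B: "l \<in> carrier L \<Longrightarrow> b \<in> B \<Longrightarrow> conj_by G (\<iota> l) b = b"
proof -
  assume l: "l \<in> carrier L" and b: "b \<in> B"
  then obtain u where "u \<in> U" "b = \<kappa> u" using \<kappa>_U by blast
  then have "\<iota> l \<otimes> b = b \<otimes> \<iota> l" using \<iota>_\<kappa> l U_carrier by blast
  then show ?thesis using l b \<iota>_carrier B_carrier by (simp add: G.conj_by_eq_iff)
qed

lemma \<kappa>_conj:
  assumes "z \<in> carrier M" "u \<in> carrier M"
  shows "conj_by G (\<kappa> z) (\<kappa> u) = \<kappa> (conj_by M z u)"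
proof -
  interpret \<kappa>: group_hom M G \<kappa>
    by (simp add: group_hom_def group_hom_axioms_def \<kappa>_hom)
  show ?thesis using assms by (simp add: conj_by_def)
qed

lemma \<kappa>_normalizes_iff:
  assumes z: "z \<in> carrier M"
  shows "z \<in> normalizer M U \<longleftrightarrow> (\<forall>b\<in>B. conj_by G (\<kappa> z) b \<in> B)"
proof -
  have "\<kappa> (conj_by M z u) \<in> B \<longleftrightarrow> conj_by M z u \<in> U" if "u \<in> U" for u
  proof -
    have "conj_by M z u \<in> carrier M" using that U_carrier z by auto
    then show ?thesis
      using \<kappa>_inj U_carrier \<kappa>_U inj_on_image_mem_iff[of \<kappa> "carrier M"] by blast
  qed
  moreover have "conj_by G (\<kappa> z) (\<kappa> u) = \<kappa> (conj_by M z u)" if "u \<in> U" for u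
    using that U_carrier z \<kappa>_conj by blast
  ultimately have "(\<forall>u\<in>U. conj_by M z u \<in> U) \<longleftrightarrow> (\<forall>u\<in>U. conj_by G (\<kappa> z) (\<kappa> u) \<in> B)" by simp
  also have "\<dots> \<longleftrightarrow> (\<forall>b\<in>B. conj_by G (\<kappa> z) b \<in> B)" using \<kappa>_U by blast
  finally show ?thesis using z by (simp add: M.mem_normalizer_iff[OF U_carrier finite_U])
qed

lemma \<kappa>_centralizes_iff:
  assumes z: "z \<in> carrier M"
  shows "(\<forall>u\<in>U. conj_by M z u = u) \<longleftrightarrow> (\<forall>b\<in>B. conj_by G (\<kappa> z) b = b)"
proof -
  have "\<kappa> (conj_by M z u) = \<kappa> u \<longleftrightarrow> conj_by M z u = u" if "u \<in> U" for u
  proof -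
    have "conj_by M z u \<in> carrier M" "u \<in> carrier M" using that U_carrier z by auto
    then show ?thesis using \<kappa>_inj inj_on_eq_iff by metis
  qed
  moreover have "conj_by G (\<kappa> z) (\<kappa> u) = \<kappa> (conj_by M z u)" if "u \<in> U" for u
    using that U_carrier z \<kappa>_conj by blast
  ultimately have "(\<forall>u\<in>U. conj_by M z u = u) \<longleftrightarrow> (\<forall>u\<in>U. conj_by G (\<kappa> z) (\<kappa> u) = \<kappa> u)" by simp
  also have "\<dots> \<longleftrightarrow> (\<forall>b\<in>B. conj_by G (\<kappa> z) b = b)" using \<kappa>_U by blast
  finally show ?thesis .
qed

lemma NM_carrier: "z \<in> normalizer M U \<Longrightarrow> z \<in> carrier M"
  by (simp add: M.mem_normalizer_iff[OF U_carrier finite_U])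

lemma levi_carrier: "l \<in> carrier L \<Longrightarrow> z \<in> carrier M \<Longrightarrow> \<iota> l \<otimes> \<kappa> z \<in> carrier G"
  using \<iota>_carrier \<kappa>_carrier by simp

lemma levi_A:
  assumes "l \<in> carrier L" "z \<in> carrier M" "a \<in> A"
  shows "conj_by G (\<iota> l \<otimes> \<kappa> z) a = conj_by G (\<iota> l) a"
  using assms \<iota>_carrier \<kappa>_carrier A_carrier \<kappa>_A by (simp add: G.conj_by_mult_left)

lemma levi_B:
  assumes "l \<in> carrier L" "z \<in> normalizer M U" "b \<in> B"
  shows "conj_by G (\<iota> l \<otimes> \<kappa> z) b = conj_by G (\<kappa> z) b"
proof -
  have z: "z \<in> carrier M" using assms(2) NM_carrier by simp
  have "conj_by G (\<kappa> z) b \<in> B" using assms \<kappa>_normalizes_iff[OF z] by blast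
  then show ?thesis
    using assms z \<iota>_carrier \<kappa>_carrier B_carrier \<iota>_B by (simp add: G.conj_by_mult_left)
qed

lemma levi_N:
  assumes l: "l \<in> carrier L" and z: "z \<in> normalizer M U"
  shows "\<iota> l \<otimes> \<kappa> z \<in> N"
proof -
  have zc: "z \<in> carrier M" using z NM_carrier by simp
  have "conj_by G (\<iota> l \<otimes> \<kappa> z) y \<in> D" if yD: "y \<in> D" for y
  proof -
    obtain a b where ab: "a \<in> A" "b \<in> B" "y = a \<otimes> b" using yD by (rule D_memE)
    have "conj_by G (\<iota> l \<otimes> \<kappa> z) y = conj_by G (\<iota> l) a \<otimes> conj_by G (\<kappa> z) b"
      using ab levi_A[OF l zc ab(1)] levi_B[OF l z ab(2)] levi_carrier[OF l zc] A_carrier B_carrier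
      by (simp add: G.conj_by_mult)
    moreover have "conj_by G (\<kappa> z) b \<in> B" using z ab \<kappa>_normalizes_iff[OF zc] by blast
    ultimately show ?thesis using D_memI \<iota>_A[OF l ab(1)] by simp
  qed
  then show ?thesis using levi_carrier[OF l zc] by (simp add: N_iff)
qed

text \<open>The second argument ranges over the normalizer of \<open>U\<close> and not over its Weyl
  group, since \<open>\<kappa>\<close> is defined on elements and not on cosets. The price is a
  kernel, the centralizer of \<open>U\<close> in the second factor.\<close>

definition levi :: "'l \<times> 'm \<Rightarrow> 'g set" where
  "levi p = q (\<iota> (fst p) \<otimes> \<kappa> (snd p))"

abbreviation "P \<equiv> L \<times>\<times> M\<lparr>carrier := normalizer M U\<rparr>"

lemma group_P: "group P"
  using L.is_group M.subgroup_imp_group[OF M.subgroup_normalizer[OF U_carrier finite_U]]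
  by (rule DirProd_group)

lemma levi_hom: "levi \<in> hom P W"
proof (rule homI)
  fix p assume "p \<in> carrier P"
  then show "levi p \<in> carrier W" using levi_N carrier_W by (auto simp: levi_def)
next
  fix p p' assume p: "p \<in> carrier P" "p' \<in> carrier P"
  obtain l z l' z' where e: "p = (l, z)" "p' = (l', z')" by fastforce
  have c: "l \<in> carrier L" "z \<in> normalizer M U" "l' \<in> carrier L" "z' \<in> normalizer M U"
    using p e by auto
  have cM: "z \<in> carrier M" "z' \<in> carrier M" using c NM_carrier by auto
  have cG: "\<iota> l \<in> carrier G" "\<iota> l' \<in> carrier G" "\<kappa> z \<in> carrier G" "\<kappa> z' \<in> carrier G"
    using c cM \<iota>_carrier \<kappa>_carrier by auto
  have "\<iota> (l \<otimes>\<^bsub>L\<^esub> l') \<otimes> \<kappa> (z \<otimes>\<^bsub>M\<^esub> z') = \<iota> l \<otimes> (\<iota> l' \<otimes> \<kappa> z) \<otimes> \<kappa> z'"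
    using hom_mult[OF \<iota>_hom c(1,3)] hom_mult[OF \<kappa>_hom cM] cG by (simp add: G.m_assoc)
  also have "\<dots> = (\<iota> l \<otimes> \<kappa> z) \<otimes> (\<iota> l' \<otimes> \<kappa> z')"
    using \<iota>_\<kappa>[OF c(3) cM(1)] cG by (simp add: G.m_assoc)
  finally show "levi (p \<otimes>\<^bsub>P\<^esub> p') = levi p \<otimes>\<^bsub>W\<^esub> levi p'"
    using q_mult[OF levi_N[OF c(1,2)] levi_N[OF c(3,4)]] e by (simp add: levi_def)
qed

text \<open>\<open>\<kappa>\<close> acts trivially on \<open>A\<close> and \<open>\<iota>\<close> on
  \<open>B\<close>, so the action on \<open>A\<close> sees only \<open>l\<close> and the action on
  \<open>B\<close> sees only \<open>z\<close>.\<close>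

lemma levi_eq_one_iff:
  assumes l: "l \<in> carrier L" and z: "z \<in> normalizer M U"
  shows "levi (l, z) = \<one>\<^bsub>W\<^esub> \<longleftrightarrow> l = \<one>\<^bsub>L\<^esub> \<and> (\<forall>u\<in>U. conj_by M z u = u)"
proof -
  have zc: "z \<in> carrier M" using z NM_carrier by simp
  have *: "levi (l, z) = \<one>\<^bsub>W\<^esub> \<longleftrightarrow> (\<forall>y\<in>D. conj_by G (\<iota> l \<otimes> \<kappa> z) y = conj_by G \<one> y)"
    using q_eq_iff[OF levi_N[OF l z] one_N] by (simp add: levi_def q_one)
  show ?thesis
  proof
    assume "levi (l, z) = \<one>\<^bsub>W\<^esub>"
    then have triv: "conj_by G (\<iota> l \<otimes> \<kappa> z) y = y" if "y \<in> D" for y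
      using * that D_carrier by auto
    have "\<forall>a\<in>A. conj_by G (\<iota> l) a = a"
      using triv A_sub_D levi_A[OF l zc] by (metis subsetD)
    moreover have "\<forall>b\<in>B. conj_by G (\<kappa> z) b = b"
      using triv B_sub_D levi_B[OF l z] by (metis subsetD)
    ultimately show "l = \<one>\<^bsub>L\<^esub> \<and> (\<forall>u\<in>U. conj_by M z u = u)"
      using \<iota>_faithful[OF l] \<kappa>_centralizes_iff[OF zc] by blast
  next
    assume r: "l = \<one>\<^bsub>L\<^esub> \<and> (\<forall>u\<in>U. conj_by M z u = u)"
    have i1: "\<iota> l = \<one>" using r hom_one[OF \<iota>_hom L.is_group G.is_group] by simp
    have "conj_by G (\<iota> l \<otimes> \<kappa> z) b = conj_by G \<one> b" if "b \<in> B" for b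
      using that r \<kappa>_centralizes_iff[OF zc] levi_B[OF l z that] B_carrier by simp
    moreover have "conj_by G (\<iota> l \<otimes> \<kappa> z) (x i) = conj_by G \<one> (x i)" if "i < r" for i
      using levi_A[OF l zc x_in_A[OF that]] i1 by simp
    ultimately show "levi (l, z) = \<one>\<^bsub>W\<^esub>"
      unfolding * using agree_on_D[OF levi_carrier[OF l zc] G.one_closed] by blast
  qed
qed

lemma levi_iso: "W\<lparr>carrier := levi ` carrier P\<rparr> \<cong> L \<times>\<times> Weyl M U" and subgroup_levi: "subgroup (levi ` carrier P) W"
proof -
  interpret W: group W by (rule group_W)
  interpret P: group P by (rule group_P)
  interpret levi: group_hom P W levi
    using levi_hom by (simp add: group_hom_def group_hom_axioms_def P.is_group W.is_group)
  show sub: "subgroup (levi ` carrier P) W" by (rule levi.img_is_subgroup)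
  \<comment> \<open>The natural projection of \<open>P\<close>, which has the same kernel as
    \<open>levi\<close>.\<close>
  define \<pi> where "\<pi> = (\<lambda>(l, z). (l, Weyl_class M U z) :: 'l \<times> 'm set)"
  show "W\<lparr>carrier := levi ` carrier P\<rparr> \<cong> L \<times>\<times> Weyl M U"
  proof (rule P.iso_of_same_kernel[of _ _ levi \<pi>])
    show "group (W\<lparr>carrier := levi ` carrier P\<rparr>)" using sub W.subgroup_imp_group by blast
    show "group (L \<times>\<times> Weyl M U)"
      using L.is_group M.group_Weyl[OF U_carrier finite_U] by (rule DirProd_group)
    show "levi \<in> hom P (W\<lparr>carrier := levi ` carrier P\<rparr>)" using levi_hom by (auto simp: hom_def)
    show "levi ` carrier P = carrier (W\<lparr>carrier := levi ` carrier P\<rparr>)" by simp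
    show "\<pi> \<in> hom P (L \<times>\<times> Weyl M U)"
      using M.mult_Weyl[OF U_carrier finite_U] M.carrier_Weyl[of U] by (auto simp: hom_def \<pi>_def)
    show "\<pi> ` carrier P = carrier (L \<times>\<times> Weyl M U)"
      using M.carrier_Weyl[of U] by (auto simp: \<pi>_def image_iff)
    fix p assume "p \<in> carrier P"
    then obtain l z where p: "p = (l, z)" "l \<in> carrier L" "z \<in> normalizer M U" by auto
    have "Weyl_class M U z = \<one>\<^bsub>Weyl M U\<^esub> \<longleftrightarrow> (\<forall>u\<in>U. conj_by M z u = conj_by M \<one>\<^bsub>M\<^esub> u)"
      unfolding M.one_Weyl[OF U_carrier finite_U]
      by (rule M.Weyl_class_eq_iff[OF U_carrier finite_U p(3)])
        (rule subgroup.one_closed[OF M.subgroup_normalizer[OF U_carrier finite_U]])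
    also have "\<dots> \<longleftrightarrow> (\<forall>u\<in>U. conj_by M z u = u)" using U_carrier by auto
    finally show "levi p = \<one>\<^bsub>W\<lparr>carrier := levi ` carrier P\<rparr>\<^esub> \<longleftrightarrow> \<pi> p = \<one>\<^bsub>L \<times>\<times> Weyl M U\<^esub>"
      using levi_eq_one_iff[OF p(2,3)] p(1) by (simp add: \<pi>_def)
  qed
qed

text \<open>An element of both parts preserves \<open>A\<close> and moves each \<open>a\<close>
  within its coset modulo \<open>B\<close>. As \<open>A\<close> and \<open>B\<close> meet trivially,
  it fixes \<open>A\<close>; being a twist, it fixes \<open>B\<close> as well.\<close>

lemma twists_Int_levi: "q ` twists \<inter> levi ` carrier P = {\<one>\<^bsub>W\<^esub>}"
proof -
  interpret W: group W by (rule group_W)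
  have "X = \<one>\<^bsub>W\<^esub>" if X: "X \<in> q ` twists" "X \<in> levi ` carrier P" for X
  proof -
    obtain g where g: "g \<in> twists" "X = q g" using X(1) by blast
    obtain l z where lz: "l \<in> carrier L" "z \<in> normalizer M U" "X = levi (l, z)" using X(2) by auto
    have zc: "z \<in> carrier M" using lz NM_carrier by simp
    have "q g = q (\<iota> l \<otimes> \<kappa> z)" using g lz by (simp add: levi_def)
    then have eq: "conj_by G g y = conj_by G (\<iota> l \<otimes> \<kappa> z) y" if "y \<in> D" for y
      using q_eq_iff[OF _ levi_N[OF lz(1,2)], of g] g twists_sub_N that by blast
    have "conj_by G (\<iota> l) a = a" if a: "a \<in> A" for a
    proof -
      have aD: "a \<in> D" using a A_sub_D by blast
      obtain b where b: "b \<in> B" "conj_by G g a = a \<otimes> b" using g(1) aD by (rule twistsE)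
      have c: "a \<in> carrier G" "b \<in> carrier G" using a b A_carrier B_carrier by auto
      have ab: "a \<otimes> b = conj_by G (\<iota> l) a"
        using eq[OF aD] b levi_A[OF lz(1) zc a] by simp
      then have "a \<otimes> b \<in> A" using \<iota>_A[OF lz(1) a] by simp
      then have "inv a \<otimes> (a \<otimes> b) \<in> A"
        using subgroup.m_closed[OF A_sub] subgroup.m_inv_closed[OF A_sub a] by blast
      then have "b \<in> A" using c by (simp flip: G.m_assoc)
      then have "b = \<one>" using A_Int_B b by blast
      then show ?thesis using ab c by simp
    qed
    then have "l = \<one>\<^bsub>L\<^esub>" using \<iota>_faithful[OF lz(1)] by blast
    moreover have "conj_by G (\<kappa> z) b = b" if b: "b \<in> B" for b
      using eq[of b] B_sub_D b twists_B[OF g(1) b] levi_B[OF lz(1,2) b] by auto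
    then have "\<forall>u\<in>U. conj_by M z u = u" using \<kappa>_centralizes_iff[OF zc] by blast
    ultimately show ?thesis using levi_eq_one_iff[OF lz(1,2)] lz(3) by simp
  qed
  moreover have "\<one>\<^bsub>W\<^esub> \<in> q ` twists"
    using subgroup.one_closed[OF subgroup_twists] q_one by blast
  moreover have "\<one>\<^bsub>W\<^esub> \<in> levi ` carrier P"
    by (rule subgroup.one_closed[OF subgroup_levi])
  ultimately show ?thesis by blast
qed

text \<open>An element of the normaliser is corrected on \<open>A\<close> modulo \<open>B\<close> by \<open>\<iota>\<close>, then on \<open>A\<close> by a twist,
  and what remains centralises \<open>A\<close>, so that it acts on \<open>B\<close> through \<open>\<kappa>\<close>.\<close>

lemma N_decompose:
  assumes g: "g \<in> N"
  obtains e l z where "e \<in> twists" "l \<in> carrier L" "z \<in> normalizer M U"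
    "\<And>y. y \<in> D \<Longrightarrow> conj_by G g y = conj_by G (e \<otimes> (\<iota> l \<otimes> \<kappa> z)) y"
proof -
  have gc: "g \<in> carrier G" using g N_carrier by simp
  have ex: "\<exists>a'. a' \<in> A \<and> (\<exists>b\<in>B. conj_by G g a = a' \<otimes> b)" if a: "a \<in> A" for a
  proof -
    have "conj_by G g a \<in> D" using g a A_sub_D N_iff by blast
    then obtain a' b where "a' \<in> A" "b \<in> B" "conj_by G g a = a' \<otimes> b" by (rule D_memE)
    then show ?thesis by blast
  qed
  \<comment> \<open>\<open>\<beta>\<close> is the action of \<open>g\<close> on \<open>D\<close>
    modulo \<open>B\<close>, transported to \<open>A\<close>. Uniqueness of the
    \<open>A\<close>-component, proved in \<open>uniq\<close>, makes it a homomorphism.\<close>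
  define \<beta> where "\<beta> a = (SOME a'. a' \<in> A \<and> (\<exists>b\<in>B. conj_by G g a = a' \<otimes> b))" for a
  have \<beta>: "\<beta> a \<in> A" "\<exists>b\<in>B. conj_by G g a = \<beta> a \<otimes> b" if "a \<in> A" for a
    using someI_ex[OF ex[OF that]] by (auto simp: \<beta>_def)
  have uniq: "a = a'" if "a \<in> A" "a' \<in> A" "b \<in> B" "b' \<in> B" "a \<otimes> b = a' \<otimes> b'" for a a' b b'
  proof -
    have c: "a \<in> carrier G" "a' \<in> carrier G" "b \<in> carrier G" "b' \<in> carrier G"
      using that A_carrier B_carrier by auto
    have "inv a' \<otimes> a = b' \<otimes> inv b"
    proof -
      have "a = a' \<otimes> b' \<otimes> inv b" using that(5) c by (simp add: G.inv_solve_right)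
      then have "inv a' \<otimes> a = inv a' \<otimes> (a' \<otimes> (b' \<otimes> inv b))" using c by (simp add: G.m_assoc)
      also have "\<dots> = b' \<otimes> inv b" using c by (simp flip: G.m_assoc)
      finally show ?thesis .
    qed
    moreover have "inv a' \<otimes> a \<in> A"
      using that subgroup.m_closed[OF A_sub] subgroup.m_inv_closed[OF A_sub] by simp
    moreover have "b' \<otimes> inv b \<in> B"
      using that subgroup.m_closed[OF B_sub] subgroup.m_inv_closed[OF B_sub] by simp
    ultimately have "inv a' \<otimes> a = \<one>" using A_Int_B by auto
    then show ?thesis using c by (metis G.inv_equality G.inv_inv G.inv_closed)
  qed
  have "\<beta> \<in> hom (G\<lparr>carrier := A\<rparr>) (G\<lparr>carrier := A\<rparr>)"
  proof (rule homI)
    fix a assume "a \<in> carrier (G\<lparr>carrier := A\<rparr>)"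
    then show "\<beta> a \<in> carrier (G\<lparr>carrier := A\<rparr>)" using \<beta> by simp
  next
    fix a a' assume "a \<in> carrier (G\<lparr>carrier := A\<rparr>)" "a' \<in> carrier (G\<lparr>carrier := A\<rparr>)"
    then have a: "a \<in> A" "a' \<in> A" by auto
    obtain b b' where b: "b \<in> B" "conj_by G g a = \<beta> a \<otimes> b" "b' \<in> B" "conj_by G g a' = \<beta> a' \<otimes> b'"
      using \<beta>(2)[OF a(1)] \<beta>(2)[OF a(2)] by blast
    have c: "a \<in> carrier G" "a' \<in> carrier G" "b \<in> carrier G" "b' \<in> carrier G"
      "\<beta> a \<in> carrier G" "\<beta> a' \<in> carrier G"
      using a b \<beta> A_carrier B_carrier by auto
    have aa: "a \<otimes> a' \<in> A" using a subgroup.m_closed[OF A_sub] by blast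
    obtain b'' where b'': "b'' \<in> B" "conj_by G g (a \<otimes> a') = \<beta> (a \<otimes> a') \<otimes> b''"
      using \<beta>(2)[OF aa] by blast
    have "conj_by G g (a \<otimes> a') = \<beta> a \<otimes> (b \<otimes> \<beta> a') \<otimes> b'"
      using b c gc by (simp add: G.conj_by_mult G.m_assoc)
    also have "\<dots> = (\<beta> a \<otimes> \<beta> a') \<otimes> (b \<otimes> b')"
      using comm[of b "\<beta> a'"] b \<beta>(1)[OF a(2)] c by (simp add: G.m_assoc)
    finally have "\<beta> (a \<otimes> a') \<otimes> b'' = (\<beta> a \<otimes> \<beta> a') \<otimes> (b \<otimes> b')" using b'' by simp
    then have "\<beta> (a \<otimes> a') = \<beta> a \<otimes> \<beta> a'"
      by (rule uniq[rotated 4])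
        (use \<beta> a aa b b'' subgroup.m_closed[OF A_sub] subgroup.m_closed[OF B_sub] in auto)
    then show "\<beta> (a \<otimes>\<^bsub>G\<lparr>carrier := A\<rparr>\<^esub> a') = \<beta> a \<otimes>\<^bsub>G\<lparr>carrier := A\<rparr>\<^esub> \<beta> a'" by simp
  qed
  moreover have inj: "inj_on \<beta> A"
  proof (rule inj_onI)
    fix a a' assume a: "a \<in> A" "a' \<in> A" "\<beta> a = \<beta> a'"
    obtain b b' where b: "b \<in> B" "conj_by G g a = \<beta> a \<otimes> b" "b' \<in> B" "conj_by G g a' = \<beta> a' \<otimes> b'"
      using \<beta>(2)[OF a(1)] \<beta>(2)[OF a(2)] by blast
    have c: "a \<in> carrier G" "a' \<in> carrier G" "b \<in> carrier G" "b' \<in> carrier G"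
      "\<beta> a \<in> carrier G" "\<beta> a' \<in> carrier G"
      using a b \<beta> A_carrier B_carrier by auto
    \<comment> \<open>If \<open>\<beta>\<close> identifies \<open>a\<close> and \<open>a'\<close>,
      their images under \<open>g\<close> differ by an element of \<open>B\<close>. The inverse of
      \<open>g\<close> preserves \<open>B\<close> too, so \<open>a\<close> and \<open>a'\<close>
      already agree modulo \<open>B\<close>.\<close>
    have bb: "inv b \<otimes> b' \<in> B"
      using b subgroup.m_closed[OF B_sub] subgroup.m_inv_closed[OF B_sub] by simp
    have "conj_by G g a' = conj_by G g a \<otimes> (inv b \<otimes> b')"
    proof -
      have "conj_by G g a \<otimes> (inv b \<otimes> b') = \<beta> a \<otimes> (b \<otimes> inv b) \<otimes> b'"
        using b c by (simp only: G.m_assoc G.m_closed G.inv_closed)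
      then show ?thesis using c b a(3) by simp
    qed
    then have "a' = a \<otimes> conj_by G (inv g) (inv b \<otimes> b')"
      using G.conj_by_cancel(1)[OF gc c(2)] G.conj_by_cancel(1)[OF gc c(1)]
        G.conj_by_mult[OF G.inv_closed[OF gc] G.conj_by_closed[OF gc c(1)], of "inv b \<otimes> b'"] c by simp
    moreover have "conj_by G (inv g) (inv b \<otimes> b') \<in> B"
      using normalizes_B[OF N_inv[OF g] bb] .
    ultimately have "a' \<otimes> \<one> = a \<otimes> conj_by G (inv g) (inv b \<otimes> b')" using c by simp
    then show "a = a'"
      using uniq[OF a(2,1) subgroup.one_closed[OF B_sub] \<open>conj_by G (inv g) (inv b \<otimes> b') \<in> B\<close>] by simp
  qed
  ultimately obtain l where l: "l \<in> carrier L" "\<forall>a\<in>A. conj_by G (\<iota> l) a = \<beta> a"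
    using realize_aut by blast
  have surj: "\<beta> ` A = A" using finite_A inj \<beta>(1) by (intro endo_inj_surj) auto
  \<comment> \<open>\<open>g1\<close> acts trivially on \<open>D\<close> modulo \<open>B\<close>;
    its displacements of the generators are then imitated by the twist \<open>e\<close>.\<close>
  define g1 where "g1 = g \<otimes> inv (\<iota> l)"
  have lc: "\<iota> l \<in> carrier G" using l \<iota>_carrier by simp
  have g1c: "g1 \<in> carrier G" using gc lc by (simp add: g1_def)
  \<comment> \<open>\<open>levi_N\<close> is used with the identity of \<open>M\<close> as second
    component.\<close>
  have lN: "\<iota> l \<in> N"
  proof -
    have "\<iota> l \<otimes> \<kappa> \<one>\<^bsub>M\<^esub> \<in> N"
      using levi_N[OF l(1)] subgroup.one_closed[OF M.subgroup_normalizer[OF U_carrier finite_U]] by blast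
    then show ?thesis using hom_one[OF \<kappa>_hom M.is_group G.is_group] lc by simp
  qed
  have g1N: "g1 \<in> N" using g lN N_inv N_mult by (simp add: g1_def)
  have g1A: "\<exists>b\<in>B. conj_by G g1 a = a \<otimes> b" if a: "a \<in> A" for a
  proof -
    obtain a' where a': "a' \<in> A" "a = \<beta> a'" using surj a by blast
    obtain b where b: "b \<in> B" "conj_by G g a' = \<beta> a' \<otimes> b" using \<beta>(2)[OF a'(1)] by blast
    have a'c: "a' \<in> carrier G" using a' A_carrier by simp
    have "conj_by G g1 a = conj_by G g (conj_by G (inv (\<iota> l)) (conj_by G (\<iota> l) a'))"
      using gc lc l(2) a' a'c A_carrier[OF a] by (simp add: g1_def G.conj_by_mult_left)
    also have "\<dots> = a \<otimes> b" using lc a'c b a' by simp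
    finally show ?thesis using b by blast
  qed
  then have "\<forall>i\<in>{..<r}. \<exists>b. b \<in> B \<and> conj_by G g1 (x i) = x i \<otimes> b" using x_in_A by blast
  then obtain f where f: "\<forall>i\<in>{..<r}. f i \<in> B \<and> conj_by G g1 (x i) = x i \<otimes> f i"
    using bchoice[of "{..<r}" "\<lambda>i b. b \<in> B \<and> conj_by G g1 (x i) = x i \<otimes> b"] by blast
  have "f \<in> {..<r} \<rightarrow> B" using f by auto
  then obtain e where e: "e \<in> twists" "\<And>i. i < r \<Longrightarrow> conj_by G e (x i) = x i \<otimes> f i"
    using twist_exists[of f] by metis
  have ec: "e \<in> carrier G" using e twists_carrier by simp
  \<comment> \<open>After removal of the twist the generators of \<open>A\<close> are fixed and only
    the action on \<open>B\<close> is left.\<close>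
  define g2 where "g2 = inv e \<otimes> g1"
  have g2c: "g2 \<in> carrier G" using ec g1c by (simp add: g2_def)
  have eN: "e \<in> N" using e twists_sub_N by blast
  have g2N: "g2 \<in> N" using g1N N_inv[OF eN] N_mult by (simp add: g2_def)
  have g2x: "conj_by G g2 (x i) = conj_by G \<one> (x i)" if i: "i < r" for i
  proof -
    have xc: "x i \<in> carrier G" using x_in_A[OF i] A_carrier by simp
    have "conj_by G g2 (x i) = conj_by G (inv e) (conj_by G e (x i))"
      using ec g1c xc f e(2)[OF i] i by (simp add: g2_def G.conj_by_mult_left)
    then show ?thesis using ec xc by simp
  qed
  have "\<forall>a\<in>A. conj_by G g2 a = a"
  proof
    fix a assume a: "a \<in> A"
    have "conj_by G g2 a = conj_by G \<one> a"
      by (rule G.conj_by_eq_on_generate[OF x_carrier g2c G.one_closed]) (use g2x a A_gen in auto)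
    then show "conj_by G g2 a = a" using A_carrier[OF a] by simp
  qed
  moreover have "\<forall>b\<in>B. conj_by G g2 b \<in> B" using normalizes_B[OF g2N] by blast
  ultimately obtain z where z: "z \<in> carrier M" "\<forall>b\<in>B. conj_by G g2 b = conj_by G (\<kappa> z) b"
    using realize_block[OF g2c] by blast
  have zN: "z \<in> normalizer M U"
    using \<kappa>_normalizes_iff[OF z(1)] z(2) normalizes_B[OF g2N] by simp
  have zc: "\<kappa> z \<in> carrier G" using z \<kappa>_carrier by simp
  have g2z: "conj_by G g2 y = conj_by G (\<kappa> z) y" if "y \<in> D" for y
  proof (rule agree_on_D[OF g2c zc _ _ that])
    show "conj_by G g2 (x i) = conj_by G (\<kappa> z) (x i)" if "i < r" for i
      using g2x[OF that] \<kappa>_A[OF z(1) x_in_A[OF that]] x_in_A[OF that] A_carrier by simp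
  qed (use z in blast)
  have "conj_by G g y = conj_by G (e \<otimes> (\<iota> l \<otimes> \<kappa> z)) y" if y: "y \<in> D" for y
  proof -
    have yc: "y \<in> carrier G" using y D_carrier by blast
    have lyD: "conj_by G (\<iota> l) y \<in> D" using lN y N_iff by blast
    have lyc: "conj_by G (\<iota> l) y \<in> carrier G" using lc yc by simp
    have "g = e \<otimes> (g2 \<otimes> \<iota> l)"
    proof -
      have "e \<otimes> (g2 \<otimes> \<iota> l) = (e \<otimes> inv e) \<otimes> g \<otimes> (inv (\<iota> l) \<otimes> \<iota> l)"
        unfolding g2_def g1_def using ec gc lc by (simp only: G.m_assoc G.m_closed G.inv_closed)
      then show ?thesis using ec gc lc by simp
    qed
    then have "conj_by G g y = conj_by G e (conj_by G g2 (conj_by G (\<iota> l) y))"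
      using ec g2c lc yc by (simp add: G.conj_by_mult_left)
    also have "\<dots> = conj_by G e (conj_by G (\<kappa> z \<otimes> \<iota> l) y)"
      using g2z[OF lyD] zc lc yc by (simp add: G.conj_by_mult_left)
    also have "\<dots> = conj_by G (e \<otimes> (\<iota> l \<otimes> \<kappa> z)) y"
      using \<iota>_\<kappa>[OF l(1) z(1)] ec zc lc yc by (simp add: G.conj_by_mult_left)
    finally show ?thesis .
  qed
  then show thesis using e(1) l(1) zN by (intro that[of e l z])
qed

theorem weyl_split:
  "\<exists>E Q. E \<lhd> W \<and> elem_ab_2 W E \<and> card E = card B ^ r \<and> subgroup Q W \<and>
     E \<inter> Q = {\<one>\<^bsub>W\<^esub>} \<and> E <#>\<^bsub>W\<^esub> Q = carrier W \<and> W\<lparr>carrier := Q\<rparr> \<cong> L \<times>\<times> Weyl M U"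
proof -
  interpret W: group W by (rule group_W)
  have "X \<in> q ` twists <#>\<^bsub>W\<^esub> levi ` carrier P" if X: "X \<in> carrier W" for X
  proof -
    obtain g where g: "g \<in> N" "X = q g" using X carrier_W by auto
    obtain e l z where *: "e \<in> twists" "l \<in> carrier L" "z \<in> normalizer M U"
      "\<And>y. y \<in> D \<Longrightarrow> conj_by G g y = conj_by G (e \<otimes> (\<iota> l \<otimes> \<kappa> z)) y"
      using N_decompose[OF g(1)] by metis
    have eN: "e \<in> N" using * twists_sub_N by blast
    note lN = levi_N[OF *(2,3)]
    have "q g = q (e \<otimes> (\<iota> l \<otimes> \<kappa> z))"
      using q_eq_iff[OF g(1) N_mult[OF eN lN]] *(4) by blast
    then have "X = q e \<otimes>\<^bsub>W\<^esub> levi (l, z)" using g(2) q_mult[OF eN lN] by (simp add: levi_def)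
    moreover have "(l, z) \<in> carrier P" using * by simp
    ultimately show ?thesis using *(1) unfolding set_mult_def by blast
  qed
  moreover have "q ` twists <#>\<^bsub>W\<^esub> levi ` carrier P \<subseteq> carrier W"
    using subgroup.subset[OF subgroup_q_image[OF subgroup_twists twists_sub_N]]
      subgroup.subset[OF subgroup_levi] by (rule W.set_mult_closed)
  ultimately have "q ` twists <#>\<^bsub>W\<^esub> levi ` carrier P = carrier W" by blast
  then show ?thesis
    using twist_classes_normal twist_classes_elem_ab card_twist_classes(2) subgroup_levi
      twists_Int_levi levi_iso by blast
qed

end

subsection \<open>General and projective linear groups\<close>

lemma GLm_carrier: "A \<in> GLm n \<Longrightarrow> A \<in> carrier_mat n n"
  by (simp add: GLm_def)

lemma GLm_mult: "A \<in> GLm n \<Longrightarrow> B \<in> GLm n \<Longrightarrow> A * B \<in> GLm n"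
  by (auto simp: GLm_def det_mult)

lemma GLm_one: "1\<^sub>m n \<in> GLm n"
  by (simp add: GLm_def)

lemma GLm_smult: "A \<in> GLm n \<Longrightarrow> c \<noteq> 0 \<Longrightarrow> c \<cdot>\<^sub>m A \<in> GLm n"
  by (auto simp: GLm_def)

lemma GLm_if_right_inverse:
  fixes A :: "'a::field mat"
  assumes "A \<in> carrier_mat n n" "B \<in> carrier_mat n n" "A * B = 1\<^sub>m n"
  shows "A \<in> GLm n" "B \<in> GLm n"
proof -
  have "det A * det B = 1" using det_mult[OF assms(1,2)] assms(3) by simp
  then show "A \<in> GLm n" "B \<in> GLm n" using assms by (auto simp: GLm_def)
qed

lemma GLm_inverse:
  fixes A :: "'a::field mat"
  assumes "A \<in> GLm n"
  obtains B where "B \<in> GLm n" "A * B = 1\<^sub>m n" "B * A = 1\<^sub>m n"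
proof -
  have A: "A \<in> carrier_mat n n" "det A \<noteq> 0" using assms by (auto simp: GLm_def)
  obtain B where B: "B \<in> carrier_mat n n" "B * A = 1\<^sub>m n" "A * B = 1\<^sub>m n"
    using det_non_zero_imp_unit[OF A] by (auto simp: Units_def ring_mat_def)
  then show thesis using GLm_if_right_inverse(2)[OF A(1) B(1,3)] that by blast
qed

lemma group_GL_grp: "group (GL_grp n :: 'a::field mat monoid)"
proof (rule groupI)
  fix A :: "'a mat" assume "A \<in> carrier (GL_grp n)"
  then have "A \<in> GLm n" by (simp add: GL_grp_def)
  then obtain B where "B \<in> GLm n" "B * A = 1\<^sub>m n" by (rule GLm_inverse)
  then show "\<exists>B\<in>carrier (GL_grp n). B \<otimes>\<^bsub>GL_grp n\<^esub> A = \<one>\<^bsub>GL_grp n\<^esub>"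
    by (auto simp: GL_grp_def)
next
  fix A B C :: "'a mat"
  assume "A \<in> carrier (GL_grp n)" "B \<in> carrier (GL_grp n)" "C \<in> carrier (GL_grp n)"
  then show "A \<otimes>\<^bsub>GL_grp n\<^esub> B \<otimes>\<^bsub>GL_grp n\<^esub> C = A \<otimes>\<^bsub>GL_grp n\<^esub> (B \<otimes>\<^bsub>GL_grp n\<^esub> C)"
    using assoc_mult_mat[OF GLm_carrier GLm_carrier GLm_carrier] by (auto simp: GL_grp_def)
next
  fix A :: "'a mat" assume "A \<in> carrier (GL_grp n)"
  then show "\<one>\<^bsub>GL_grp n\<^esub> \<otimes>\<^bsub>GL_grp n\<^esub> A = A"
    using GLm_carrier[of A n] by (simp add: GL_grp_def)
qed (simp_all add: GL_grp_def GLm_mult GLm_one)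

section \<open>Matrices up to nonzero scalars\<close>

lemma cls_self: "A \<in> cls A"
  unfolding cls_def by (rule CollectI, rule exI[of _ 1]) auto

lemma cls_smult: "c \<noteq> 0 \<Longrightarrow> cls (c \<cdot>\<^sub>m A) = cls (A :: 'a::field mat)"
proof -
  assume c: "c \<noteq> 0"
  have "d \<cdot>\<^sub>m A = (d / c) \<cdot>\<^sub>m (c \<cdot>\<^sub>m A)" "d \<cdot>\<^sub>m (c \<cdot>\<^sub>m A) = (d * c) \<cdot>\<^sub>m A" for d
    using c by auto
  then show ?thesis using c unfolding cls_def by (metis (no_types, lifting) divide_eq_0_iff no_zero_divisors)
qed

lemma cls_eq_iff: "cls A = cls B \<longleftrightarrow> (\<exists>c. c \<noteq> 0 \<and> A = c \<cdot>\<^sub>m B)"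
proof
  assume "cls A = cls B"
  then have "A \<in> cls B" using cls_self by metis
  then show "\<exists>c. c \<noteq> 0 \<and> A = c \<cdot>\<^sub>m B" by (auto simp: cls_def)
qed (auto simp: cls_smult)

lemma cls_eq_if_mem: "A \<in> cls B \<Longrightarrow> cls A = cls B"
  unfolding cls_eq_iff by (auto simp: cls_def)

lemma PGL_mult:
  fixes A B :: "'a::field mat"
  assumes "A \<in> carrier_mat n n" "B \<in> carrier_mat n n"
  shows "cls A \<otimes>\<^bsub>PGL n\<^esub> cls B = cls (A * B)"
proof -
  have *: "(c \<cdot>\<^sub>m A) * (d \<cdot>\<^sub>m B) = (c * d) \<cdot>\<^sub>m (A * B)" for c d
    using assms mult_smult_distrib[OF smult_carrier_mat[OF assms(1)] assms(2)]
      mult_smult_assoc_mat[OF assms] by (auto simp: mult.commute)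
  have "\<exists>c d. e = c * d \<and> c \<noteq> 0 \<and> d \<noteq> 0" if "e \<noteq> 0" for e :: 'a
    using that by (intro exI[of _ e] exI[of _ 1]) auto
  then have "{X * Y | X Y. X \<in> cls A \<and> Y \<in> cls B} = cls (A * B)"
    unfolding cls_def by (auto simp: *) (metis *)
  then show ?thesis by (simp add: PGL_def)
qed

lemma cls_in_PGL: "A \<in> GLm n \<Longrightarrow> cls A \<in> carrier (PGL n)"
  by (simp add: PGL_def)

lemma PGL_carrierE:
  assumes "X \<in> carrier (PGL n)" obtains A where "A \<in> GLm n" "X = cls A"
  using assms by (auto simp: PGL_def)

lemma PGL_mem:
  assumes "X \<in> carrier (PGL n)" "A \<in> X" shows "A \<in> GLm n" "X = cls A"
proof -
  obtain B where B: "B \<in> GLm n" "X = cls B" using assms(1) by (rule PGL_carrierE)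
  then show "X = cls A" using cls_eq_if_mem assms(2) by metis
  show "A \<in> GLm n" using B assms(2) GLm_smult by (auto simp: cls_def)
qed

lemma PGL_one: "\<one>\<^bsub>PGL n\<^esub> = cls (1\<^sub>m n)"
  by (simp add: PGL_def)

lemma group_PGL: "group (PGL n :: 'a::field mat set monoid)"
proof (rule groupI)
  fix X Y :: "'a mat set" assume X: "X \<in> carrier (PGL n)" and Y: "Y \<in> carrier (PGL n)"
  obtain A where A: "A \<in> GLm n" "X = cls A" using X by (rule PGL_carrierE)
  obtain B where B: "B \<in> GLm n" "Y = cls B" using Y by (rule PGL_carrierE)
  show "X \<otimes>\<^bsub>PGL n\<^esub> Y \<in> carrier (PGL n)"
    using A B by (simp add: PGL_mult GLm_carrier cls_in_PGL GLm_mult)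
  fix Z :: "'a mat set" assume Z: "Z \<in> carrier (PGL n)"
  obtain C where C: "C \<in> GLm n" "Z = cls C" using Z by (rule PGL_carrierE)
  have "A * B \<in> carrier_mat n n" "B * C \<in> carrier_mat n n" using A B C GLm_mult GLm_carrier by blast+
  then show "X \<otimes>\<^bsub>PGL n\<^esub> Y \<otimes>\<^bsub>PGL n\<^esub> Z = X \<otimes>\<^bsub>PGL n\<^esub> (Y \<otimes>\<^bsub>PGL n\<^esub> Z)"
    using A B C assoc_mult_mat[of A n n B n C n] by (simp add: PGL_mult GLm_carrier)
next
  fix X :: "'a mat set" assume "X \<in> carrier (PGL n)"
  then obtain A where A: "A \<in> GLm n" "X = cls A" by (rule PGL_carrierE)
  have Ac: "A \<in> carrier_mat n n" using A GLm_carrier by blast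
  show "\<one>\<^bsub>PGL n\<^esub> \<otimes>\<^bsub>PGL n\<^esub> X = X"
    using A Ac PGL_mult[of "1\<^sub>m n" n A] by (simp add: PGL_one)
  obtain B where B: "B \<in> GLm n" "B * A = 1\<^sub>m n" using A(1) by (rule GLm_inverse)
  show "\<exists>Y\<in>carrier (PGL n). Y \<otimes>\<^bsub>PGL n\<^esub> X = \<one>\<^bsub>PGL n\<^esub>"
    using A B Ac PGL_mult[of B n A] GLm_carrier[OF B(1)]
    by (intro bexI[of _ "cls B"]) (simp_all add: PGL_one cls_in_PGL)
qed (simp_all add: PGL_one cls_in_PGL GLm_one)

text \<open>Clearing the inverse turns conjugation in PGL into a relation between lifts. The scalar
  \<open>c\<close> is the quantity on which the later arguments turn.\<close>

lemma PGL_conj_iff: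
  fixes A B C :: "'a::field mat"
  assumes "A \<in> GLm n" "B \<in> GLm n" "C \<in> GLm n"
  shows "conj_by (PGL n) (cls A) (cls B) = cls C \<longleftrightarrow> (\<exists>c. c \<noteq> 0 \<and> A * B = c \<cdot>\<^sub>m (C * A))"
proof -
  interpret group "PGL n :: 'a mat set monoid" by (rule group_PGL)
  show ?thesis
    using assms by (simp add: conj_by_eq_iff cls_in_PGL PGL_mult GLm_carrier cls_eq_iff)
qed

lemma PGL_conj_eqI:
  fixes A B C :: "'a::field mat"
  assumes "A \<in> GLm n" "B \<in> GLm n" "C \<in> GLm n" "A * B = C * A"
  shows "conj_by (PGL n) (cls A) (cls B) = cls C"
  unfolding PGL_conj_iff[OF assms(1-3)]
  using assms(4) by (intro exI[of _ 1]) auto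

lemma PGL_inv:
  fixes A B :: "'a::field mat"
  assumes "A \<in> GLm n" "B \<in> GLm n" "B * A = 1\<^sub>m n"
  shows "inv\<^bsub>PGL n\<^esub> (cls A) = cls B"
proof -
  interpret group "PGL n :: 'a mat set monoid" by (rule group_PGL)
  show ?thesis
    using assms by (intro inv_equality) (simp_all add: PGL_mult GLm_carrier PGL_one cls_in_PGL)
qed

subsection \<open>Sign characters, permutation matrices and Kronecker products\<close>

text \<open>\<open>of_nat\<close> into \<open>bit\<close> is reduction modulo 2, so coordinate
  \<open>i\<close> is binary digit \<open>i\<close> of \<open>b\<close>. The \<open>2 ^ r\<close>
  coordinates of a block thus become the vectors over the field with two elements, on which GL_r(2)
  acts; \<open>unbits\<close> goes back.\<close>

definition bits :: "nat \<Rightarrow> nat \<Rightarrow> bit vec" where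
  "bits r b = vec r (\<lambda>i. of_nat (b div 2 ^ i))"

definition unbits :: "nat \<Rightarrow> bit vec \<Rightarrow> nat" where
  "unbits r v = horner_sum of_bool 2 (map (\<lambda>i. v $ i = 1) [0..<r])"

lemma of_nat_bit_eq_1_iff: "of_nat k = (1 :: bit) \<longleftrightarrow> odd k"
  by (induction k) auto

lemma bits_carrier [simp]: "bits r b \<in> carrier_vec r"
  by (simp add: bits_def)

lemma bits_index: "i < r \<Longrightarrow> bits r b $ i = 1 \<longleftrightarrow> bit b i"
  by (simp add: bits_def of_nat_bit_eq_1_iff bit_iff_odd)

lemma bit_eq_iff_one: "(x :: bit) = y \<longleftrightarrow> (x = 1 \<longleftrightarrow> y = 1)"
  by (cases x; cases y) simp_all

lemma unbits_less: "unbits r v < 2 ^ r"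
  using horner_sum_of_bool_2_less[of "map (\<lambda>i. v $ i = 1) [0..<r]"] by (simp add: unbits_def)

lemma bits_unbits: "v \<in> carrier_vec r \<Longrightarrow> bits r (unbits r v) = v"
proof (rule eq_vecI)
  fix i assume v: "v \<in> carrier_vec r" and "i < dim_vec v"
  then have i: "i < r" by simp
  have "bit (unbits r v) i \<longleftrightarrow> v $ i = 1"
    using i by (simp add: unbits_def bit_horner_sum_bit_iff)
  then show "bits r (unbits r v) $ i = v $ i"
    using bits_index[OF i] bit_eq_iff_one by blast
qed (simp add: bits_def)

lemma bits_inj:
  assumes "b < 2 ^ r" "c < 2 ^ r" "bits r b = bits r c"
  shows "b = c"
proof (rule bit_eqI)
  fix i :: nat
  show "bit b i \<longleftrightarrow> bit c i"
  proof (cases "i < r")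
    case True
    then show ?thesis using bits_index[OF True] assms(3) by metis
  next
    case False
    have "b = take_bit r b" "c = take_bit r c" using assms by (simp_all add: take_bit_nat_eq_self)
    then have "\<not> bit b i" "\<not> bit c i" using False by (metis bit_take_bit_iff)+
    then show ?thesis by simp
  qed
qed

lemma bits_0 [simp]: "bits r 0 = 0\<^sub>v r"
  by (auto simp: bits_def)

lemma bit_vec_add_self: "v \<in> carrier_vec r \<Longrightarrow> v + v = 0\<^sub>v r" for v :: "bit vec"
proof (rule eq_vecI)
  fix i assume "v \<in> carrier_vec r" "i < dim_vec (0\<^sub>v r :: bit vec)"
  then show "(v + v) $ i = 0\<^sub>v r $ i" by (cases "v $ i") simp_all
qed simp

lemma bit_vec_add_cancel:
  fixes v w :: "bit vec"
  assumes "v \<in> carrier_vec r" "w \<in> carrier_vec r"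
  shows "(v + w) + w = v"
  using assms assoc_add_vec[of v r w w] bit_vec_add_self[of w r] by simp

text \<open>Over the field with two elements a vector is the sum of the unit vectors of its support.
  This rule replaces span arguments, both for the group generated by the sign matrices and for the
  linearity of additive maps.\<close>

lemma bit_vec_induct [consumes 1, case_names zero add]:
  fixes v :: "bit vec"
  assumes v: "v \<in> carrier_vec r" and z: "P (0\<^sub>v r)"
    and a: "\<And>v k. v \<in> carrier_vec r \<Longrightarrow> k < r \<Longrightarrow> P v \<Longrightarrow> P (v + unit_vec r k)"
  shows "P v"
proof -
  \<comment> \<open>The induction is on a bound \<open>j\<close> for the support.\<close>
  have "P v" if "v \<in> carrier_vec r" "\<forall>i<r. j \<le> i \<longrightarrow> v $ i = 0" "j \<le> r" for j v
    using that
  proof (induction j arbitrary: v)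
    case 0
    then have "v = 0\<^sub>v r" by (intro eq_vecI) auto
    then show ?case using z by simp
  next
    case (Suc j)
    show ?case
    proof (cases "v $ j = 0")
      case True
      then have "\<forall>i<r. j \<le> i \<longrightarrow> v $ i = 0" using Suc.prems(2) by (metis le_antisym not_less_eq_eq)
      then show ?thesis using Suc.IH Suc.prems by simp
    next
      case False
      have j: "j < r" using Suc by simp
      \<comment> \<open>Adding \<open>unit_vec r j\<close> clears coordinate \<open>j\<close>;
        adding it again restores \<open>v\<close>.\<close>
      let ?w = "v + unit_vec r j"
      have w: "?w \<in> carrier_vec r" using Suc by simp
      have "?w $ i = 0" if "i < r" "j \<le> i" for i
        using that Suc.prems False j by (cases "i = j") (auto simp: unit_vec_def)
      then have "P ?w" using Suc w j by simp
      then have "P (?w + unit_vec r j)" using a w j by blast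
      then show ?thesis using bit_vec_add_cancel[of v r "unit_vec r j"] Suc by simp
    qed
  qed
  from this[of v r] show ?thesis using v by simp
qed

section \<open>Signs and characters of bit vectors\<close>

definition sg :: "bit \<Rightarrow> 'a::field" where
  "sg x = (if x = 0 then 1 else - 1)"

lemma sg_simps [simp]: "sg 0 = 1" "sg 1 = - 1" "sg x \<noteq> 0" "sg x * sg x = 1"
  by (simp_all add: sg_def)

lemma sg_add: "sg (x + y) = sg x * sg y"
  by (cases x; cases y) simp_all

lemma sg_of_nat: "sg (of_nat k) = (- 1) ^ k"
proof (induction k)
  case (Suc k)
  then show ?case unfolding of_nat_Suc sg_add by simp
qed simp

lemma sg_eq_1_iff: "(2 :: 'a::field) \<noteq> 0 \<Longrightarrow> (sg x :: 'a) = 1 \<longleftrightarrow> x = 0"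
proof (cases x)
  assume two: "(2 :: 'a) \<noteq> 0" and x: "x = 1"
  have "(- 1 :: 'a) \<noteq> 1"
  proof
    assume "(- 1 :: 'a) = 1"
    then have "(1 :: 'a) + 1 = 0" using neg_eq_iff_add_eq_0 by blast
    then show False using two by simp
  qed
  then show ?thesis using x by simp
qed simp

text \<open>The character attached to \<open>v\<close>, evaluated at coordinate numbers. For unit
  vectors it is the sign pattern of \<open>Abar\<close>, as \<open>chi_unit\<close> records.\<close>

definition chi :: "nat \<Rightarrow> bit vec \<Rightarrow> nat \<Rightarrow> 'a::field" where
  "chi r v b = sg (v \<bullet> bits r b)"

lemma chi_nonzero [simp]: "chi r v b \<noteq> 0"
  by (simp add: chi_def)

lemma chi_0 [simp]: "v \<in> carrier_vec r \<Longrightarrow> chi r v 0 = 1"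
  by (simp add: chi_def)

lemma chi_add:
  "v \<in> carrier_vec r \<Longrightarrow> w \<in> carrier_vec r \<Longrightarrow> chi r (v + w) b = chi r v b * chi r w b"
  by (simp only: chi_def add_scalar_prod_distrib[OF _ _ bits_carrier] sg_add)

lemma chi_zero [simp]: "chi r (0\<^sub>v r) b = 1"
  by (simp add: chi_def)

lemma chi_unit: "i < r \<Longrightarrow> chi r (unit_vec r i) b = (- 1) ^ (b div 2 ^ i)"
  by (simp add: chi_def scalar_prod_left_unit[of _ r] bits_def sg_of_nat)

section \<open>Diagonal and permutation matrices given by functions\<close>

lemma mult_mat_entry:
  assumes "A \<in> carrier_mat n n" "B \<in> carrier_mat n n" "i < n" "j < n"
  shows "(A * B) $$ (i, j) = (\<Sum>k<n. A $$ (i, k) * B $$ (k, j))"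
  using assms by (simp add: scalar_prod_def atLeast0LessThan)

definition diag_fun :: "nat \<Rightarrow> (nat \<Rightarrow> 'a::field) \<Rightarrow> 'a mat" where
  "diag_fun n f = mat n n (\<lambda>(i, j). if i = j then f i else 0)"

lemma diag_fun_carrier [simp]: "diag_fun n f \<in> carrier_mat n n"
  by (simp add: diag_fun_def)

lemma diag_fun_left:
  assumes "X \<in> carrier_mat n n" "i < n" "j < n"
  shows "(diag_fun n f * X) $$ (i, j) = f i * X $$ (i, j)"
proof -
  have "(diag_fun n f * X) $$ (i, j) = (\<Sum>k<n. (if i = k then f i * X $$ (i, j) else 0))"
    unfolding mult_mat_entry[OF diag_fun_carrier assms]
    by (rule sum.cong) (use assms in \<open>auto simp: diag_fun_def\<close>)
  then show ?thesis using assms by simp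
qed

lemma diag_fun_right:
  assumes "X \<in> carrier_mat n n" "i < n" "j < n"
  shows "(X * diag_fun n f) $$ (i, j) = X $$ (i, j) * f j"
proof -
  have "(X * diag_fun n f) $$ (i, j) = (\<Sum>k<n. (if k = j then X $$ (i, j) * f j else 0))"
    unfolding mult_mat_entry[OF assms(1) diag_fun_carrier assms(2,3)]
    by (rule sum.cong) (use assms in \<open>auto simp: diag_fun_def\<close>)
  then show ?thesis using assms by simp
qed

lemma diag_fun_mult: "diag_fun n f * diag_fun n g = diag_fun n (\<lambda>i. f i * g i)"
proof (rule eq_matI)
  fix i j assume "i < dim_row (diag_fun n (\<lambda>i. f i * g i))" "j < dim_col (diag_fun n (\<lambda>i. f i * g i))"
  then have ij: "i < n" "j < n" by (auto simp: diag_fun_def)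
  show "(diag_fun n f * diag_fun n g) $$ (i, j) = diag_fun n (\<lambda>i. f i * g i) $$ (i, j)"
    using ij diag_fun_left[OF diag_fun_carrier ij, of f g] by (simp add: diag_fun_def)
qed (auto simp: diag_fun_def)

lemma diag_fun_one: "diag_fun n (\<lambda>_. 1) = 1\<^sub>m n"
  by (auto simp: diag_fun_def)

lemma diag_fun_cong: "(\<And>i. i < n \<Longrightarrow> f i = g i) \<Longrightarrow> diag_fun n f = diag_fun n g"
  by (auto simp: diag_fun_def)

lemma diag_fun_GLm:
  assumes "\<And>i. i < n \<Longrightarrow> f i \<noteq> 0" shows "diag_fun n f \<in> GLm n"
proof (rule GLm_if_right_inverse(1)[of _ _ "diag_fun n (\<lambda>i. inverse (f i))"])
  have "diag_fun n (\<lambda>i. f i * inverse (f i)) = diag_fun n (\<lambda>_. 1)"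
    using assms by (intro diag_fun_cong) simp
  then show "diag_fun n f * diag_fun n (\<lambda>i. inverse (f i)) = 1\<^sub>m n"
    by (simp add: diag_fun_mult diag_fun_one)
qed simp_all

definition perm_fun :: "nat \<Rightarrow> (nat \<Rightarrow> nat) \<Rightarrow> 'a::field mat" where
  "perm_fun n \<pi> = mat n n (\<lambda>(i, j). if i = \<pi> j then 1 else 0)"

lemma perm_fun_carrier [simp]: "perm_fun n \<pi> \<in> carrier_mat n n"
  by (simp add: perm_fun_def)

lemma perm_fun_right:
  assumes "X \<in> carrier_mat n n" "i < n" "j < n" "\<pi> j < n"
  shows "(X * perm_fun n \<pi>) $$ (i, j) = X $$ (i, \<pi> j)"
proof -
  have "(X * perm_fun n \<pi>) $$ (i, j) = (\<Sum>k<n. (if k = \<pi> j then X $$ (i, \<pi> j) else 0))"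
    unfolding mult_mat_entry[OF assms(1) perm_fun_carrier assms(2,3)]
    by (rule sum.cong) (use assms in \<open>auto simp: perm_fun_def\<close>)
  then show ?thesis using assms by simp
qed

lemma perm_fun_left:
  assumes "X \<in> carrier_mat n n" "i < n" "j < n" "bij_betw \<pi> {..<n} {..<n}"
  shows "(perm_fun n \<pi> * X) $$ (\<pi> i, j) = X $$ (i, j)"
proof -
  have pi: "\<pi> i < n" using assms(2,4) by (auto simp: bij_betw_def)
  have inj: "\<pi> i = \<pi> k \<longleftrightarrow> i = k" if "k < n" for k
    using that assms(2,4) by (auto simp: bij_betw_def inj_on_def)
  have "(perm_fun n \<pi> * X) $$ (\<pi> i, j) = (\<Sum>k<n. (if i = k then X $$ (i, j) else 0))"
    unfolding mult_mat_entry[OF perm_fun_carrier assms(1) pi assms(3)]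
    by (rule sum.cong) (use assms pi inj in \<open>auto simp: perm_fun_def\<close>)
  then show ?thesis using assms by simp
qed

lemma perm_fun_mult:
  assumes "\<And>i. i < n \<Longrightarrow> \<sigma> i < n"
  shows "perm_fun n \<pi> * perm_fun n \<sigma> = perm_fun n (\<pi> \<circ> \<sigma>)"
proof (rule eq_matI)
  fix i j assume "i < dim_row (perm_fun n (\<pi> \<circ> \<sigma>))" "j < dim_col (perm_fun n (\<pi> \<circ> \<sigma>))"
  then have ij: "i < n" "j < n" by (auto simp: perm_fun_def)
  show "(perm_fun n \<pi> * perm_fun n \<sigma>) $$ (i, j) = perm_fun n (\<pi> \<circ> \<sigma>) $$ (i, j)"
    using ij assms perm_fun_right[OF perm_fun_carrier ij, of \<sigma> \<pi>] by (simp add: perm_fun_def)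
qed (auto simp: perm_fun_def)

lemma perm_fun_id: "(\<And>i. i < n \<Longrightarrow> \<pi> i = i) \<Longrightarrow> perm_fun n \<pi> = 1\<^sub>m n"
  by (auto simp: perm_fun_def)

lemma perm_fun_GLm:
  assumes "bij_betw \<pi> {..<n} {..<n}" shows "perm_fun n \<pi> \<in> GLm n"
proof (rule GLm_if_right_inverse(1)[of _ _ "perm_fun n (inv_into {..<n} \<pi>)"])
  have "inv_into {..<n} \<pi> i < n" if "i < n" for i
    using that assms inv_into_into[of i \<pi> "{..<n}"] by (auto simp: bij_betw_def)
  then have "perm_fun n \<pi> * perm_fun n (inv_into {..<n} \<pi>) = perm_fun n (\<pi> \<circ> inv_into {..<n} \<pi>)"
    by (rule perm_fun_mult)
  also have "\<dots> = 1\<^sub>m n"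
    using assms f_inv_into_f[of _ \<pi> "{..<n}"] by (intro perm_fun_id) (auto simp: bij_betw_def)
  finally show "perm_fun n \<pi> * perm_fun n (inv_into {..<n} \<pi>) = 1\<^sub>m n" .
qed simp_all

text \<open>\<open>perm_fun n \<pi>\<close> carries basis vector \<open>j\<close> to basis vector
  \<open>\<pi> j\<close>. Reading \<open>Y\<close> at permuted indices expresses conjugation without
  the inverse permutation.\<close>

lemma perm_fun_intertwines:
  assumes "bij_betw \<pi> {..<n} {..<n}" "X \<in> carrier_mat n n" "Y \<in> carrier_mat n n"
    and "\<And>i j. i < n \<Longrightarrow> j < n \<Longrightarrow> Y $$ (\<pi> i, \<pi> j) = X $$ (i, j)"
  shows "perm_fun n \<pi> * X = Y * perm_fun n \<pi>"
proof (rule eq_matI)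
  fix i' j assume "i' < dim_row (Y * perm_fun n \<pi>)" "j < dim_col (Y * perm_fun n \<pi>)"
  then have i': "i' < n" and j: "j < n" using assms by (auto simp: perm_fun_def)
  obtain i where i: "i < n" "i' = \<pi> i" using i' assms(1) by (auto simp: bij_betw_def)
  have "\<pi> j < n" using j assms(1) by (auto simp: bij_betw_def)
  then show "(perm_fun n \<pi> * X) $$ (i', j) = (Y * perm_fun n \<pi>) $$ (i', j)"
    using i i' j assms perm_fun_left[OF assms(2) i(1) j assms(1)] perm_fun_right[OF assms(3) i' j, of \<pi>]
    by simp
qed (use assms in \<open>auto simp: perm_fun_def\<close>)

section \<open>Kronecker products with an identity matrix\<close>

lemma block_index_less: "a < m \<Longrightarrow> w < K \<Longrightarrow> a * K + w < m * (K::nat)"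
proof -
  assume "a < m" "w < K"
  then have "a * K + w < (a + 1) * K" by simp
  also have "\<dots> \<le> m * K" using \<open>a < m\<close> by (intro mult_le_mono1) simp
  finally show ?thesis .
qed

text \<open>An index is split as \<open>a * K + w\<close> into a block \<open>a\<close> and a
  residue \<open>w\<close>. The sums that occur below are supported on one residue and shrink to
  sums over blocks.\<close>

lemma sum_residue_class:
  fixes h :: "nat \<Rightarrow> 'b::comm_monoid_add"
  assumes "w < K" "\<And>q. q < m * K \<Longrightarrow> q mod K \<noteq> w \<Longrightarrow> h q = 0"
  shows "(\<Sum>q<m * K. h q) = (\<Sum>a<m. h (a * K + w))"
proof -
  have inj: "inj_on (\<lambda>a. a * K + w) {..<m}" using assms(1) by (auto simp: inj_on_def)
  have im: "(\<lambda>a. a * K + w) ` {..<m} = {q. q < m * K \<and> q mod K = w}"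
  proof
    show "(\<lambda>a. a * K + w) ` {..<m} \<subseteq> {q. q < m * K \<and> q mod K = w}"
      using assms(1) block_index_less by auto
    show "{q. q < m * K \<and> q mod K = w} \<subseteq> (\<lambda>a. a * K + w) ` {..<m}"
    proof
      fix q assume q: "q \<in> {q. q < m * K \<and> q mod K = w}"
      then have "q div K < m" by (simp add: less_mult_imp_div_less)
      moreover have "q = q div K * K + w" using q div_mult_mod_eq[of q K] by simp
      ultimately show "q \<in> (\<lambda>a. a * K + w) ` {..<m}" by blast
    qed
  qed
  have "(\<Sum>q<m * K. h q) = (\<Sum>q\<in>{q. q < m * K \<and> q mod K = w}. h q)"
    using assms(2) by (intro sum.mono_neutral_right) auto
  also have "\<dots> = (\<Sum>a<m. h (a * K + w))"
    unfolding im[symmetric] by (simp add: sum.reindex[OF inj])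
  finally show ?thesis .
qed

lemma kron_I_carrier: "u \<in> carrier_mat m m \<Longrightarrow> kron_I u K \<in> carrier_mat (m * K) (m * K)"
  by (auto simp: kron_I_def)

lemma kron_I_entry:
  assumes "u \<in> carrier_mat m m" "p < m * K" "q < m * K"
  shows "kron_I u K $$ (p, q) = (if p mod K = q mod K then u $$ (p div K, q div K) else 0)"
  using assms by (auto simp: kron_I_def)

lemma kron_I_mult:
  assumes "u \<in> carrier_mat m m" "v \<in> carrier_mat m m"
  shows "kron_I u K * kron_I v K = kron_I (u * v) K"
proof (rule eq_matI)
  fix p q assume "p < dim_row (kron_I (u * v) K)" "q < dim_col (kron_I (u * v) K)"
  then have pq: "p < m * K" "q < m * K" using assms by (auto simp: kron_I_def)
  have K: "K > 0" using pq by (cases K) auto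
  have d: "p div K < m" "q div K < m" using pq by (simp_all add: less_mult_imp_div_less)
  let ?h = "\<lambda>k. kron_I u K $$ (p, k) * kron_I v K $$ (k, q)"
  have "(kron_I u K * kron_I v K) $$ (p, q) = (\<Sum>k<m * K. ?h k)"
    using pq kron_I_carrier[OF assms(1)] kron_I_carrier[OF assms(2)] by (rule mult_mat_entry[rotated 2])
  \<comment> \<open>The entry of \<open>kron_I u K\<close> at \<open>(p, k)\<close> vanishes unless
    \<open>k\<close> is congruent to \<open>p\<close> modulo \<open>K\<close>.\<close>
  also have "\<dots> = (\<Sum>a<m. ?h (a * K + p mod K))"
    using K pq assms by (intro sum_residue_class) (auto simp: kron_I_entry)
  also have "\<dots> = (\<Sum>a<m. u $$ (p div K, a) * (if p mod K = q mod K then v $$ (a, q div K) else 0))"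
    using K pq assms block_index_less[of _ m "p mod K" K] by (intro sum.cong) (auto simp: kron_I_entry)
  also have "\<dots> = (if p mod K = q mod K then (u * v) $$ (p div K, q div K) else 0)"
    using mult_mat_entry[OF assms d] by simp
  also have "\<dots> = kron_I (u * v) K $$ (p, q)"
    using kron_I_entry[OF mult_carrier_mat[OF assms] pq] by simp
  finally show "(kron_I u K * kron_I v K) $$ (p, q) = kron_I (u * v) K $$ (p, q)" .
qed (use assms in \<open>auto simp: kron_I_def\<close>)

lemma kron_I_diag_fun: "kron_I (diag_fun m f) K = diag_fun (m * K) (\<lambda>p. f (p div K))"
proof (rule eq_matI)
  fix p q assume "p < dim_row (diag_fun (m * K) (\<lambda>p. f (p div K)))" "q < dim_col (diag_fun (m * K) (\<lambda>p. f (p div K)))"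
  then have pq: "p < m * K" "q < m * K" by (auto simp: diag_fun_def)
  have d: "p div K < m" "q div K < m" using pq by (simp_all add: less_mult_imp_div_less)
  have "p = q \<longleftrightarrow> p mod K = q mod K \<and> p div K = q div K" by (metis div_mult_mod_eq)
  then show "kron_I (diag_fun m f) K $$ (p, q) = diag_fun (m * K) (\<lambda>p. f (p div K)) $$ (p, q)"
    using pq d kron_I_entry[OF diag_fun_carrier pq, of f] by (auto simp: diag_fun_def)
qed (auto simp: diag_fun_def kron_I_def)

lemma kron_I_one: "kron_I (1\<^sub>m m) K = 1\<^sub>m (m * K)"
  using kron_I_diag_fun[of m "\<lambda>_. 1" K] by (simp add: diag_fun_one)

lemma kron_I_smult: "kron_I (c \<cdot>\<^sub>m u) K = c \<cdot>\<^sub>m kron_I u K"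
  by (rule eq_matI) (auto simp: kron_I_def less_mult_imp_div_less)

lemma kron_I_GLm: "u \<in> GLm m \<Longrightarrow> kron_I u K \<in> GLm (m * K)"
proof -
  assume u: "u \<in> GLm m"
  obtain v where v: "v \<in> GLm m" "u * v = 1\<^sub>m m" using u by (rule GLm_inverse)
  show ?thesis
    by (rule GLm_if_right_inverse(1)[of _ _ "kron_I v K"])
      (use u v kron_I_mult[OF GLm_carrier[OF u] GLm_carrier[OF v(1)], of K]
        in \<open>simp_all add: GLm_carrier kron_I_carrier kron_I_one\<close>)
qed

text \<open>The entries at residue 0 of the blocks recover the small matrix.\<close>

lemma kron_I_inj:
  assumes "u \<in> carrier_mat m m" "v \<in> carrier_mat m m" "K > 0" "kron_I u K = kron_I v K"
  shows "u = v"
proof (rule eq_matI)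
  fix i j assume "i < dim_row v" "j < dim_col v"
  then have ij: "i < m" "j < m" using assms by auto
  have "kron_I u K $$ (i * K + 0, j * K + 0) = kron_I v K $$ (i * K + 0, j * K + 0)" using assms(4) by simp
  then show "u $$ (i, j) = v $$ (i, j)"
    using kron_I_entry[OF assms(1), of "i * K + 0" K "j * K + 0"]
      kron_I_entry[OF assms(2), of "i * K + 0" K "j * K + 0"] assms(3)
      block_index_less[OF ij(1) assms(3)] block_index_less[OF ij(2) assms(3)] by simp
qed (use assms in auto)

text \<open>Blocks are preserved, and the bit vectors within block \<open>a\<close> are moved by
  \<open>F a\<close>. Constant families give GL_r(2) and the translations that detect
  \<open>D_r\<close>; families varying with \<open>a\<close> give the twists.\<close>

definition block_perm :: "nat \<Rightarrow> (nat \<Rightarrow> bit vec \<Rightarrow> bit vec) \<Rightarrow> nat \<Rightarrow> nat" where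
  "block_perm r F p = p div 2 ^ r * 2 ^ r + unbits r (F (p div 2 ^ r) (bits r (p mod 2 ^ r)))"

lemma block_perm_div [simp]: "block_perm r F p div 2 ^ r = p div 2 ^ r"
  using unbits_less[of r] by (simp add: block_perm_def)

lemma block_perm_mod [simp]: "block_perm r F p mod 2 ^ r = unbits r (F (p div 2 ^ r) (bits r (p mod 2 ^ r)))"
  using unbits_less[of r] by (simp add: block_perm_def)

lemma block_perm_less: "p < m * 2 ^ r \<Longrightarrow> block_perm r F p < m * 2 ^ r"
  unfolding block_perm_def by (intro block_index_less unbits_less) (simp add: less_mult_imp_div_less)

lemma block_perm_bij:
  assumes "\<And>a. a < m \<Longrightarrow> F a \<in> carrier_vec r \<rightarrow> carrier_vec r" "\<And>a. a < m \<Longrightarrow> inj_on (F a) (carrier_vec r)"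
  shows "bij_betw (block_perm r F) {..<m * 2 ^ r} {..<m * 2 ^ r}"
proof -
  have "inj_on (block_perm r F) {..<m * 2 ^ r}"
  proof (rule inj_onI)
    fix p q assume pq: "p \<in> {..<m * 2 ^ r}" "q \<in> {..<m * 2 ^ r}" and eq: "block_perm r F p = block_perm r F q"
    have d: "p div 2 ^ r = q div 2 ^ r" using eq block_perm_div by metis
    let ?a = "q div 2 ^ r"
    have a: "?a < m" using pq by (simp add: less_mult_imp_div_less)
    have "unbits r (F ?a (bits r (p mod 2 ^ r))) = unbits r (F ?a (bits r (q mod 2 ^ r)))"
      using eq block_perm_mod[of r F p] block_perm_mod[of r F q] d by simp
    then have "F ?a (bits r (p mod 2 ^ r)) = F ?a (bits r (q mod 2 ^ r))"
      using bits_unbits[OF funcset_mem[OF assms(1)[OF a] bits_carrier]] by metis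
    then have "bits r (p mod 2 ^ r) = bits r (q mod 2 ^ r)"
      using assms(2)[OF a] by (simp add: inj_on_eq_iff)
    then have "p mod 2 ^ r = q mod 2 ^ r" by (intro bits_inj[of _ r]) simp_all
    then show "p = q" using d by (metis div_mult_mod_eq)
  qed
  moreover have "block_perm r F ` {..<m * 2 ^ r} = {..<m * 2 ^ r}"
    by (rule endo_inj_surj) (use calculation block_perm_less in auto)
  ultimately show ?thesis by (simp add: bij_betw_def)
qed

lemma bits_block_perm:
  "F (p div 2 ^ r) \<in> carrier_vec r \<rightarrow> carrier_vec r \<Longrightarrow>
    bits r (block_perm r F p mod 2 ^ r) = F (p div 2 ^ r) (bits r (p mod 2 ^ r))"
  using bits_unbits[OF funcset_mem[OF _ bits_carrier]] by simp

lemma perm_fun_diag_fun: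
  assumes "bij_betw \<pi> {..<n} {..<n}" "\<And>i. i < n \<Longrightarrow> g (\<pi> i) = f i"
  shows "perm_fun n \<pi> * diag_fun n f = diag_fun n g * perm_fun n \<pi>"
proof (rule perm_fun_intertwines[OF assms(1)])
  fix i j assume ij: "i < n" "j < n"
  have "\<pi> i < n" "\<pi> j < n" "\<pi> i = \<pi> j \<longleftrightarrow> i = j"
    using ij assms(1) by (auto simp: bij_betw_def inj_on_def)
  then show "diag_fun n g $$ (\<pi> i, \<pi> j) = diag_fun n f $$ (i, j)"
    using ij assms(2) by (simp add: diag_fun_def)
qed simp_all

text \<open>With the same map in all blocks, the permutation matrix is an identity of size
  \<open>m\<close> tensored with a permutation matrix of size \<open>2 ^ r\<close>, whereas
  \<open>kron_I\<close> acts on the other tensor factor.\<close>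

lemma perm_fun_kron_I:
  assumes "u \<in> carrier_mat m m" "F \<in> carrier_vec r \<rightarrow> carrier_vec r" "inj_on F (carrier_vec r)"
  shows "perm_fun (m * 2 ^ r) (block_perm r (\<lambda>_. F)) * kron_I u (2 ^ r)
    = kron_I u (2 ^ r) * perm_fun (m * 2 ^ r) (block_perm r (\<lambda>_. F))"
proof (rule perm_fun_intertwines[OF block_perm_bij])
  fix p q :: nat assume pq: "p < m * 2 ^ r" "q < m * 2 ^ r"
  let ?b = "block_perm r (\<lambda>_. F)"
  have "?b p mod 2 ^ r = ?b q mod 2 ^ r \<longleftrightarrow> p mod 2 ^ r = q mod 2 ^ r"
  proof
    assume "?b p mod 2 ^ r = ?b q mod 2 ^ r"
    then have "F (bits r (p mod 2 ^ r)) = F (bits r (q mod 2 ^ r))"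
      using bits_block_perm[of "\<lambda>_. F" p r] bits_block_perm[of "\<lambda>_. F" q r] assms(2) by simp
    then have "bits r (p mod 2 ^ r) = bits r (q mod 2 ^ r)"
      using assms(3) by (simp add: inj_on_eq_iff)
    then show "p mod 2 ^ r = q mod 2 ^ r" by (intro bits_inj[of _ r]) simp_all
  qed simp
  then show "kron_I u (2 ^ r) $$ (?b p, ?b q) = kron_I u (2 ^ r) $$ (p, q)"
    using pq block_perm_less assms(1) by (simp add: kron_I_entry)
qed (use assms in \<open>simp_all add: kron_I_carrier\<close>)

lemma GLm_nonzero_entry:
  fixes X :: "'a::field mat"
  assumes "X \<in> GLm n" "i < n"
  obtains j where "j < n" "X $$ (i, j) \<noteq> 0"
proof -
  obtain B where B: "B \<in> GLm n" "X * B = 1\<^sub>m n" using assms(1) by (rule GLm_inverse)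
  have "(\<Sum>k<n. X $$ (i, k) * B $$ (k, i)) = 1"
    using mult_mat_entry[OF GLm_carrier[OF assms(1)] GLm_carrier[OF B(1)] assms(2,2)] B(2) assms(2) by simp
  then have "\<exists>k\<in>{..<n}. X $$ (i, k) * B $$ (k, i) \<noteq> 0"
    using sum.neutral[of "{..<n}" "\<lambda>k. X $$ (i, k) * B $$ (k, i)"] by fastforce
  then show thesis using that by auto
qed

text \<open>Row 0 of an invertible matrix has a nonzero entry, where the scalar is visible. This is
  how undetermined scalars are pinned down later.\<close>

lemma GLm_smult_eq_self:
  fixes X :: "'a::field mat"
  assumes "X \<in> GLm n" "0 < n" "c \<cdot>\<^sub>m X = X"
  shows "c = 1"
proof -
  obtain j where j: "j < n" "X $$ (0, j) \<noteq> 0" using assms(1,2) by (rule GLm_nonzero_entry)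
  have "c * X $$ (0, j) = X $$ (0, j)"
    using arg_cong[OF assms(3), of "\<lambda>Y. Y $$ (0, j)"] j assms(2) GLm_carrier[OF assms(1)] by simp
  then show ?thesis using j by simp
qed

text \<open>Meant for a change of basis \<open>R\<close>, a permutation \<open>Q\<close> and the
  change back \<open>S\<close>; the relation is pushed through one factor at a time.\<close>

lemma sandwich_intertwines:
  fixes R :: "'a::field mat"
  assumes c: "R \<in> carrier_mat n n" "Q \<in> carrier_mat n n" "S \<in> carrier_mat n n"
      "X \<in> carrier_mat n n" "X' \<in> carrier_mat n n" "Y \<in> carrier_mat n n" "Y' \<in> carrier_mat n n"
    and e: "R * X' = X * R" "Q * X = Y * Q" "S * Y = Y' * S"
  shows "(S * Q * R) * X' = Y' * (S * Q * R)"
proof -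
  note a = assoc_mult_mat[of _ n n _ n _ n]
  have "(S * Q * R) * X' = S * (Q * (R * X'))" using c by (simp add: a)
  also have "\<dots> = S * (Q * X * R)" unfolding e(1) using c by (simp add: a)
  also have "\<dots> = S * Y * (Q * R)" unfolding e(2) using c by (simp add: a)
  also have "\<dots> = Y' * (S * Q * R)" unfolding e(3) using c by (simp add: a)
  finally show ?thesis .
qed

section \<open>The lifts of \<open>D_r\<close>\<close>

definition sign_diag :: "nat \<Rightarrow> nat \<Rightarrow> bit vec \<Rightarrow> 'a::field mat" where
  "sign_diag m r v = diag_fun (m * 2 ^ r) (\<lambda>p. chi r v (p mod 2 ^ r))"

lemma sign_diag_carrier [simp]: "sign_diag m r v \<in> carrier_mat (m * 2 ^ r) (m * 2 ^ r)"
  by (simp add: sign_diag_def)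

lemma sign_diag_GLm: "sign_diag m r v \<in> GLm (m * 2 ^ r)"
  unfolding sign_diag_def by (rule diag_fun_GLm) simp

lemma sign_diag_mult:
  "v \<in> carrier_vec r \<Longrightarrow> w \<in> carrier_vec r \<Longrightarrow> sign_diag m r v * sign_diag m r w = sign_diag m r (v + w)"
  unfolding sign_diag_def diag_fun_mult by (rule diag_fun_cong) (simp add: chi_add)

lemma sign_diag_zero: "sign_diag m r (0\<^sub>v r) = 1\<^sub>m (m * 2 ^ r)"
  by (simp add: sign_diag_def diag_fun_one)

lemma Abar_eq: "i < r \<Longrightarrow> Abar (m * 2 ^ r) r i = cls (sign_diag m r (unit_vec r i))"
  by (simp add: Abar_def sign_diag_def diag_fun_def chi_unit cong: if_cong)

lemma sign_diag_kron_I: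
  assumes "u \<in> carrier_mat m m"
  shows "sign_diag m r v * kron_I u (2 ^ r) = kron_I u (2 ^ r) * sign_diag m r v"
proof (rule eq_matI)
  note k = kron_I_carrier[OF assms, of "2 ^ r"]
  fix p q
  assume "p < dim_row (kron_I u (2 ^ r) * sign_diag m r v)" "q < dim_col (kron_I u (2 ^ r) * sign_diag m r v)"
  then have pq: "p < m * 2 ^ r" "q < m * 2 ^ r" using k by (auto simp: sign_diag_def diag_fun_def)
  show "(sign_diag m r v * kron_I u (2 ^ r)) $$ (p, q) = (kron_I u (2 ^ r) * sign_diag m r v) $$ (p, q)"
    unfolding sign_diag_def diag_fun_left[OF k pq] diag_fun_right[OF k pq]
    using pq assms by (simp add: kron_I_entry)
qed (use kron_I_carrier[OF assms, of "2 ^ r"] in \<open>auto simp: sign_diag_def diag_fun_def\<close>)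

text \<open>The unit vector at a nonzero coordinate of \<open>v\<close> works. The resulting
  \<open>w\<close> serves below both as a point where the character of \<open>v\<close> is -1 and as
  a translation vector.\<close>

lemma sg_character_separates:
  assumes v: "v \<in> carrier_vec r" "v \<noteq> 0\<^sub>v r"
  obtains w where "w \<in> carrier_vec r" "(sg (v \<bullet> w) :: 'a::field) = - 1"
proof -
  obtain i where i: "i < r" "v $ i \<noteq> 0"
  proof -
    have "\<not> (\<forall>i<r. v $ i = 0)"
      using v eq_vecI[of v "0\<^sub>v r"] by auto
    then show ?thesis using that by blast
  qed
  have "v \<bullet> unit_vec r i = v $ i" using v i by (simp add: scalar_prod_right_unit[of _ r])
  then have "(sg (v \<bullet> unit_vec r i) :: 'a) = - 1" using i by (simp add: sg_def)
  then show thesis using that[of "unit_vec r i"] by simp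
qed

text \<open>Along the diagonal of block 0 a Kronecker lift is constant, whereas
  \<open>sign_diag m r v\<close> runs through all values of a character. This is the reason why
  \<open>D_r\<close> and \<open>Ubar\<close> meet trivially.\<close>

lemma sign_diag_eq_kron_I:
  assumes two: "(2 :: 'a::field) \<noteq> 0" and v: "v \<in> carrier_vec r" and m: "0 < m"
    and u: "u \<in> carrier_mat m m" and eq: "cls (sign_diag m r v) = cls (kron_I u (2 ^ r) :: 'a mat)"
  shows "v = 0\<^sub>v r"
proof (rule ccontr)
  assume "v \<noteq> 0\<^sub>v r"
  then obtain w where w: "w \<in> carrier_vec r" "(sg (v \<bullet> w) :: 'a) = - 1"
    using sg_character_separates[OF v] by blast
  obtain c where c: "sign_diag m r v = c \<cdot>\<^sub>m (kron_I u (2 ^ r) :: 'a mat)"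
    using eq unfolding cls_eq_iff by blast
  have e: "(chi r v b :: 'a) = c * u $$ (0, 0)" if b: "b < 2 ^ r" for b
  proof -
    have bn: "b < m * 2 ^ r" using b block_index_less[OF m b] by simp
    have "sign_diag m r v $$ (b, b) = (chi r v b :: 'a)" using b bn by (simp add: sign_diag_def diag_fun_def)
    moreover have "(c \<cdot>\<^sub>m kron_I u (2 ^ r)) $$ (b, b) = c * u $$ (0, 0)"
      using b bn kron_I_entry[OF u bn bn] kron_I_carrier[OF u, of "2 ^ r"] by simp
    ultimately show ?thesis using arg_cong[OF c, of "\<lambda>Y. Y $$ (b, b)"] by simp
  qed
  \<comment> \<open>Two positions of block 0 are compared: the one that encodes \<open>w\<close>,
    with sign -1, and position 0, with sign 1.\<close>
  have "(chi r v (unbits r w) :: 'a) = chi r v 0"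
    using e[OF unbits_less, of w] e[of 0] by simp
  then have "(- 1 :: 'a) = 1" using w v by (simp add: chi_def bits_unbits)
  then show False using sg_eq_1_iff[OF two, of 1] by simp
qed

text \<open>The product of two proportional sign matrices is scalar and belongs to
  \<open>v + w\<close>. A scalar matrix is proportional to a Kronecker lift, so \<open>v + w\<close>
  vanishes.\<close>

lemma sign_diag_cls_inj:
  assumes two: "(2 :: 'a::field) \<noteq> 0" and m: "0 < m" and v: "v \<in> carrier_vec r" "w \<in> carrier_vec r"
    and eq: "cls (sign_diag m r v) = (cls (sign_diag m r w) :: 'a mat set)"
  shows "v = w"
proof -
  let ?s = "\<lambda>v. sign_diag m r v :: 'a mat"
  have "cls (?s (v + w)) = cls (?s v) \<otimes>\<^bsub>PGL (m * 2 ^ r)\<^esub> cls (?s w)"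
    using v by (simp add: PGL_mult sign_diag_mult)
  also have "\<dots> = cls (?s (w + w))"
    using v eq by (simp add: PGL_mult sign_diag_mult)
  also have "\<dots> = cls (kron_I (1\<^sub>m m) (2 ^ r))"
    using v by (simp add: bit_vec_add_self sign_diag_zero kron_I_one)
  finally have "v + w = 0\<^sub>v r"
    by (rule sign_diag_eq_kron_I[OF two _ m one_carrier_mat, rotated]) (use v in simp)
  then have "v = 0\<^sub>v r + w" using bit_vec_add_cancel[OF v] by simp
  then show ?thesis using v by simp
qed

text \<open>Multiplying sign matrices adds bit vectors, so the classes form a subgroup, and
  \<open>bit_vec_induct\<close> reaches each of them from the generators.\<close>

lemma D_r_eq: "D_r (m * 2 ^ r) r = (\<lambda>v. cls (sign_diag m r v) :: 'a::field mat set) ` carrier_vec r"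
proof -
  let ?G = "PGL (m * 2 ^ r) :: 'a mat set monoid"
  let ?d = "\<lambda>v. cls (sign_diag m r v) :: 'a mat set"
  let ?S = "{Abar (m * 2 ^ r) r i | i. i < r} :: 'a mat set set"
  interpret group ?G by (rule group_PGL)
  have mult: "?d v \<otimes>\<^bsub>?G\<^esub> ?d w = ?d (v + w)" if "v \<in> carrier_vec r" "w \<in> carrier_vec r" for v w
    using that by (simp add: PGL_mult sign_diag_mult)
  have one: "\<one>\<^bsub>?G\<^esub> = ?d (0\<^sub>v r)" by (simp add: PGL_one sign_diag_zero)
  have S: "?S = ?d ` unit_vec r ` {..<r}" 
  proof -
    have "?S = Abar (m * 2 ^ r) r ` {..<r}" by auto
    also have "\<dots> = (\<lambda>i. ?d (unit_vec r i)) ` {..<r}" using Abar_eq by (intro image_cong) auto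
    finally show ?thesis by (simp only: image_image)
  qed
  have inv: "inv\<^bsub>?G\<^esub> (?d v) = ?d v" if "v \<in> carrier_vec r" for v
    using that mult[OF that that] one bit_vec_add_self[OF that]
    by (intro inv_equality) (simp_all add: cls_in_PGL sign_diag_GLm)
  have sub: "subgroup (?d ` carrier_vec r) ?G"
  proof (rule subgroupI)
    show "X \<otimes>\<^bsub>?G\<^esub> Y \<in> ?d ` carrier_vec r" if "X \<in> ?d ` carrier_vec r" "Y \<in> ?d ` carrier_vec r" for X Y
      using that mult by (auto intro!: imageI)
    show "inv\<^bsub>?G\<^esub> X \<in> ?d ` carrier_vec r" if "X \<in> ?d ` carrier_vec r" for X
      using that inv by auto
    show "?d ` carrier_vec r \<noteq> {}" using zero_carrier_vec by blast
    show "?d ` carrier_vec r \<subseteq> carrier ?G" by (auto simp: cls_in_PGL sign_diag_GLm)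
  qed
  show ?thesis
  proof
    have "?S \<subseteq> ?d ` carrier_vec r" unfolding S by auto
    then show "D_r (m * 2 ^ r) r \<subseteq> ?d ` carrier_vec r"
      unfolding D_r_def using generate_subgroup_incl[OF _ sub] by blast
    show "?d ` carrier_vec r \<subseteq> D_r (m * 2 ^ r) r"
    proof
      fix X assume "X \<in> ?d ` carrier_vec r"
      then obtain v where v: "v \<in> carrier_vec r" "X = ?d v" by blast
      have "?d v \<in> generate ?G ?S" using v(1)
      proof (induction rule: bit_vec_induct)
        case zero
        then show ?case using generate.one[of ?G ?S] one by simp
      next
        case (add v k)
        have "?d (unit_vec r k) \<in> ?S" unfolding S using add by blast
        then have "?d v \<otimes>\<^bsub>?G\<^esub> ?d (unit_vec r k) \<in> generate ?G ?S"
          using generate.eng[OF add(3) generate.incl] by blast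
        then show ?case using mult add by simp
      qed
      then show "X \<in> D_r (m * 2 ^ r) r" using v by (simp add: D_r_def)
    qed
  qed
qed

text \<open>Commuting with \<open>D_r\<close> up to scalars forces all nonzero entries in the rows
  of residue 0 into the columns of a single residue \<open>w\<close>. The submatrix \<open>z\<close>
  on these rows and columns is then invertible and inherits every intertwining relation between
  Kronecker lifts. It replaces a question in PGL_n by one in PGL_m.\<close>

lemma block_compression:
  fixes A :: "'a::field mat"
  assumes two: "(2 :: 'a) \<noteq> 0" and m: "0 < m" and A: "A \<in> GLm (m * 2 ^ r)"
    and comm: "\<And>i. i < r \<Longrightarrow> \<exists>c. c \<noteq> 0 \<and>
      A * sign_diag m r (unit_vec r i) = c \<cdot>\<^sub>m (sign_diag m r (unit_vec r i) * A)"
  shows "\<exists>z\<in>GLm m. \<forall>u\<in>carrier_mat m m. \<forall>u'\<in>carrier_mat m m.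
      A * kron_I u (2 ^ r) = kron_I u' (2 ^ r) * A \<longrightarrow> z * u = u' * z"
proof -
  define K where "K = (2 :: nat) ^ r"
  define n where "n = m * K"
  have K: "0 < K" by (simp add: K_def)
  have n: "0 < n" using K m by (simp add: n_def)
  have A: "A \<in> GLm n" using assms(3) by (simp add: n_def K_def)
  have Ac: "A \<in> carrier_mat n n" using A by (rule GLm_carrier)
  have entry: "\<exists>c. c \<noteq> 0 \<and> (\<forall>p<n. \<forall>q<n. A $$ (p, q) * (- 1) ^ (q mod K div 2 ^ i)
      = c * ((- 1) ^ (p mod K div 2 ^ i) * A $$ (p, q)))" if i: "i < r" for i
  proof -
    obtain c where c: "c \<noteq> 0"
      "A * sign_diag m r (unit_vec r i) = c \<cdot>\<^sub>m (sign_diag m r (unit_vec r i) * A)"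
      using comm[OF i] by blast
    let ?f = "\<lambda>p. (- 1) ^ (p mod K div 2 ^ i) :: 'a"
    have s: "sign_diag m r (unit_vec r i) = diag_fun n ?f"
      unfolding sign_diag_def n_def K_def by (rule diag_fun_cong) (simp add: chi_unit[OF i])
    have "A $$ (p, q) * ?f q = c * (?f p * A $$ (p, q))" if pq: "p < n" "q < n" for p q
    proof -
      have "(A * diag_fun n ?f) $$ (p, q) = (c \<cdot>\<^sub>m (diag_fun n ?f * A)) $$ (p, q)"
        using c(2) s by simp
      also have "\<dots> = c * (diag_fun n ?f * A) $$ (p, q)"
        using pq Ac by (intro index_smult_mat) (auto simp: diag_fun_def)
      finally show ?thesis
        using diag_fun_left[OF Ac pq, of ?f] diag_fun_right[OF Ac pq, of ?f] by simp
    qed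
    then show ?thesis using c(1) by blast
  qed
  \<comment> \<open>One nonzero entry in row 0 determines \<open>w\<close>.\<close>
  obtain q0 where q0: "q0 < n" "A $$ (0, q0) \<noteq> 0" using A n by (rule GLm_nonzero_entry)
  define w where "w = q0 mod K"
  have w: "w < K" using K by (simp add: w_def)
  \<comment> \<open>At a nonzero entry \<open>c\<close> is the product of the row sign and the
    column sign. In rows of residue 0 the row sign is 1, so each generator fixes one binary digit of
    the column residue.\<close>
  have shape: "q mod K = w" if pq: "p < n" "q < n" "p mod K = 0" "A $$ (p, q) \<noteq> 0" for p q
  proof (rule bits_inj[of _ r])
    show "q mod K < 2 ^ r" "w < 2 ^ r" using K w by (simp_all add: K_def)
    show "bits r (q mod K) = bits r w"
    proof (rule eq_vecI)
      fix i assume "i < dim_vec (bits r w)"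
      then have i: "i < r" by (simp add: bits_def)
      obtain c where c: "\<forall>p<n. \<forall>q<n. A $$ (p, q) * (- 1) ^ (q mod K div 2 ^ i)
          = c * ((- 1) ^ (p mod K div 2 ^ i) * A $$ (p, q))" using entry[OF i] by blast
      have "A $$ (0, q0) * (- 1) ^ (w div 2 ^ i) = c * A $$ (0, q0)"
        using c q0(1) n unfolding w_def by force
      then have 1: "(- 1) ^ (w div 2 ^ i) = c" using q0(2) by (simp add: mult.commute)
      have "A $$ (p, q) * (- 1) ^ (q mod K div 2 ^ i) = c * A $$ (p, q)"
        using c pq by force
      then have "(- 1) ^ (q mod K div 2 ^ i) = c" using pq(4) by (simp add: mult.commute)
      then have "(sg (of_nat (q mod K div 2 ^ i)) :: 'a) = sg (of_nat (w div 2 ^ i))"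
        using 1 by (simp add: sg_of_nat)
      then have "(of_nat (q mod K div 2 ^ i) :: bit) = of_nat (w div 2 ^ i)"
        using sg_eq_1_iff[OF two, of 1]
        by (cases "of_nat (q mod K div 2 ^ i) :: bit"; cases "of_nat (w div 2 ^ i) :: bit") auto
      then show "bits r (q mod K) $ i = bits r w $ i" using i by (simp add: bits_def)
    qed (simp add: bits_def)
  qed
  define z where "z = mat m m (\<lambda>(a, a'). A $$ (a * K, a' * K + w))"
  have zc: "z \<in> carrier_mat m m" by (simp add: z_def)
  have less: "a * K < n" "a * K + w < n" if "a < m" for a
    using block_index_less[OF that K] block_index_less[OF that w] by (simp_all add: n_def)
  obtain B where B: "B \<in> GLm n" "A * B = 1\<^sub>m n" using A by (rule GLm_inverse)
  note Bc = GLm_carrier[OF B(1)]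
  \<comment> \<open>The inverse of \<open>z\<close> is cut out of the inverse of \<open>A\<close>,
    with the residues of rows and columns exchanged.\<close>
  define z' where "z' = mat m m (\<lambda>(a, a'). B $$ (a * K + w, a' * K))"
  have z'c: "z' \<in> carrier_mat m m" by (simp add: z'_def)
  \<comment> \<open>The entries outside residue \<open>w\<close> vanish in these rows, by
    \<open>shape\<close>; this converts products with \<open>A\<close> into products with
    \<open>z\<close>.\<close>
  have collapse: "(\<Sum>q<n. A $$ (a * K, q) * h q) = (\<Sum>a'<m. z $$ (a, a') * h (a' * K + w))"
    if a: "a < m" for a h
  proof -
    have "(\<Sum>q<n. A $$ (a * K, q) * h q) = (\<Sum>a'<m. A $$ (a * K, a' * K + w) * h (a' * K + w))"
      unfolding n_def
    proof (rule sum_residue_class[OF w])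
      fix q assume "q < m * K" "q mod K \<noteq> w"
      then show "A $$ (a * K, q) * h q = 0" using shape[of "a * K" q] less[OF a] by (auto simp: n_def)
    qed
    also have "\<dots> = (\<Sum>a'<m. z $$ (a, a') * h (a' * K + w))"
      using a by (intro sum.cong) (auto simp: z_def)
    finally show ?thesis .
  qed
  have "z * z' = 1\<^sub>m m"
  proof (rule eq_matI)
    fix a a'' assume "a < dim_row (1\<^sub>m m :: 'a mat)" "a'' < dim_col (1\<^sub>m m :: 'a mat)"
    then have a: "a < m" "a'' < m" by auto
    have "(z * z') $$ (a, a'') = (\<Sum>a'<m. z $$ (a, a') * B $$ (a' * K + w, a'' * K))"
      unfolding mult_mat_entry[OF zc z'c a] using a by (intro sum.cong) (auto simp: z'_def)
    also have "\<dots> = (\<Sum>q<n. A $$ (a * K, q) * B $$ (q, a'' * K))"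
      by (rule collapse[OF a(1), symmetric])
    also have "\<dots> = (A * B) $$ (a * K, a'' * K)"
      by (rule mult_mat_entry[OF Ac Bc less(1)[OF a(1)] less(1)[OF a(2)], symmetric])
    also have "\<dots> = 1\<^sub>m m $$ (a, a'')"
      using B(2) less(1)[OF a(1)] less(1)[OF a(2)] a K by simp
    finally show "(z * z') $$ (a, a'') = 1\<^sub>m m $$ (a, a'')" .
  qed (use zc z'c in auto)
  then have zG: "z \<in> GLm m" using GLm_if_right_inverse(1)[OF zc z'c] by blast
  have "z * u = u' * z" if u: "u \<in> carrier_mat m m" "u' \<in> carrier_mat m m"
    and eq: "A * kron_I u (2 ^ r) = kron_I u' (2 ^ r) * A" for u u'
  proof (rule eq_matI)
    fix a a'' assume "a < dim_row (u' * z)" "a'' < dim_col (u' * z)"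
    then have a: "a < m" "a'' < m" using u zc by auto
    note uk = kron_I_carrier[OF u(1), of K, folded n_def] kron_I_carrier[OF u(2), of K, folded n_def]
    have "(z * u) $$ (a, a'') = (\<Sum>a'<m. z $$ (a, a') * kron_I u K $$ (a' * K + w, a'' * K + w))"
      unfolding mult_mat_entry[OF zc u(1) a]
      using less a w K kron_I_entry[OF u(1), of _ K] by (intro sum.cong) (auto simp: n_def)
    also have "\<dots> = (\<Sum>q<n. A $$ (a * K, q) * kron_I u K $$ (q, a'' * K + w))"
      by (rule collapse[OF a(1), symmetric])
    also have "\<dots> = (A * kron_I u K) $$ (a * K, a'' * K + w)"
      by (rule mult_mat_entry[OF Ac uk(1) less(1)[OF a(1)] less(2)[OF a(2)], symmetric])
    also have "\<dots> = (kron_I u' K * A) $$ (a * K, a'' * K + w)" using eq by (simp add: K_def)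
    also have "\<dots> = (\<Sum>q<m * K. kron_I u' K $$ (a * K, q) * A $$ (q, a'' * K + w))"
      using mult_mat_entry[OF uk(2) Ac less(1)[OF a(1)] less(2)[OF a(2)]] by (simp add: n_def)
    \<comment> \<open>Row \<open>a * K\<close> of the lift of \<open>u'\<close> is supported on
      columns of residue 0, so again only rows of \<open>A\<close> that belong to \<open>z\<close>
      occur.\<close>
    also have "\<dots> = (\<Sum>a'<m. kron_I u' K $$ (a * K, a' * K + 0) * A $$ (a' * K + 0, a'' * K + w))"
      using less[OF a(1)] K kron_I_entry[OF u(2), of _ K] by (intro sum_residue_class) (auto simp: n_def)
    also have "\<dots> = (\<Sum>a'<m. u' $$ (a, a') * z $$ (a', a''))"
      using less a K kron_I_entry[OF u(2), of _ K] by (intro sum.cong) (auto simp: n_def z_def)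
    also have "\<dots> = (u' * z) $$ (a, a'')" by (rule mult_mat_entry[OF u(2) zc a, symmetric])
    finally show "(z * u) $$ (a, a'') = (u' * z) $$ (a, a'')" .
  qed (use u zc in auto)
  then show ?thesis using zG by blast
qed

subsection \<open>Embedding the two factors\<close>

text \<open>The choice of representative does not matter, since scaling \<open>u\<close> scales its
  Kronecker lift. Working with classes makes \<open>Ubar\<close> the image of \<open>U1\<close>
  under a homomorphism defined on all of PGL_m.\<close>

definition kron_cls :: "nat \<Rightarrow> 'a::field mat set \<Rightarrow> 'a mat set" where
  "kron_cls r X = cls (kron_I (SOME u. u \<in> X) (2 ^ r))"

lemma kron_cls_cls: "kron_cls r (cls u) = cls (kron_I u (2 ^ r))"
proof -
  have "(SOME v. v \<in> cls u) \<in> cls u" using cls_self by (rule someI)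
  then obtain c where "c \<noteq> 0" "(SOME v. v \<in> cls u) = c \<cdot>\<^sub>m u" by (auto simp: cls_def)
  then show ?thesis by (simp add: kron_cls_def kron_I_smult cls_smult)
qed

lemma kron_cls_hom: "kron_cls r \<in> hom (PGL m) (PGL (m * 2 ^ r) :: 'a::field mat set monoid)"
proof (rule homI)
  fix X :: "'a mat set" assume "X \<in> carrier (PGL m)"
  then obtain A where "A \<in> GLm m" "X = cls A" by (rule PGL_carrierE)
  then show "kron_cls r X \<in> carrier (PGL (m * 2 ^ r))" by (simp add: kron_cls_cls kron_I_GLm cls_in_PGL)
next
  fix X Y :: "'a mat set" assume X: "X \<in> carrier (PGL m)" and Y: "Y \<in> carrier (PGL m)"
  obtain A where A: "A \<in> GLm m" "X = cls A" using X by (rule PGL_carrierE)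
  obtain B where B: "B \<in> GLm m" "Y = cls B" using Y by (rule PGL_carrierE)
  note c = GLm_carrier[OF A(1)] GLm_carrier[OF B(1)]
  show "kron_cls r (X \<otimes>\<^bsub>PGL m\<^esub> Y) = kron_cls r X \<otimes>\<^bsub>PGL (m * 2 ^ r)\<^esub> kron_cls r Y"
    using A(2) B(2) c by (simp add: PGL_mult kron_cls_cls kron_I_carrier kron_I_mult)
qed

lemma kron_cls_inj: "inj_on (kron_cls r) (carrier (PGL m :: 'a::field mat set monoid))"
proof (rule inj_onI)
  fix X Y :: "'a mat set"
  assume X: "X \<in> carrier (PGL m)" and Y: "Y \<in> carrier (PGL m)" and eq: "kron_cls r X = kron_cls r Y"
  obtain A where A: "A \<in> GLm m" "X = cls A" using X by (rule PGL_carrierE)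
  obtain B where B: "B \<in> GLm m" "Y = cls B" using Y by (rule PGL_carrierE)
  obtain c where c: "c \<noteq> 0" "kron_I A (2 ^ r) = c \<cdot>\<^sub>m kron_I B (2 ^ r)"
    using eq A B by (auto simp: kron_cls_cls cls_eq_iff)
  then have "A = c \<cdot>\<^sub>m B"
    using A B GLm_carrier by (intro kron_I_inj[of A m "c \<cdot>\<^sub>m B" "2 ^ r"]) (auto simp: kron_I_smult)
  then show "X = Y" using A B c cls_smult by blast
qed

lemma Ubar_eq:
  assumes "U1 \<subseteq> carrier (PGL m)"
  shows "Ubar r U1 = kron_cls r ` U1"
proof
  show "Ubar r U1 \<subseteq> kron_cls r ` U1"
  proof
    fix X assume "X \<in> Ubar r U1"
    then obtain u Y where u: "X = cls (kron_I u (2 ^ r))" "Y \<in> U1" "u \<in> Y" by (auto simp: Ubar_def)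
    then have "Y = cls u" using PGL_mem(2) assms by blast
    then have "X = kron_cls r Y" using u by (simp add: kron_cls_cls)
    then show "X \<in> kron_cls r ` U1" using u by blast
  qed
  show "kron_cls r ` U1 \<subseteq> Ubar r U1"
  proof
    fix X assume "X \<in> kron_cls r ` U1"
    then obtain Y where Y: "Y \<in> U1" "X = kron_cls r Y" by blast
    obtain u where u: "Y = cls u" using Y(1) assms PGL_carrierE by blast
    have "u \<in> \<Union>U1" using Y(1) u cls_self by blast
    moreover have "X = cls (kron_I u (2 ^ r))" using Y u by (simp add: kron_cls_cls)
    ultimately show "X \<in> Ubar r U1" unfolding Ubar_def by blast
  qed
qed

section \<open>The action of GL_r(2) by permutation matrices\<close>

definition perm_cls :: "nat \<Rightarrow> nat \<Rightarrow> bit mat \<Rightarrow> 'a::field mat set" where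
  "perm_cls m r \<alpha> = cls (perm_fun (m * 2 ^ r) (block_perm r (\<lambda>_ v. \<alpha> *\<^sub>v v)))"

lemma GLm_vec_inj:
  fixes \<alpha> :: "'b::field mat"
  assumes "\<alpha> \<in> GLm r" shows "inj_on ((*\<^sub>v) \<alpha>) (carrier_vec r)"
proof (rule inj_onI)
  fix v w assume v: "v \<in> carrier_vec r" "w \<in> carrier_vec r" and eq: "\<alpha> *\<^sub>v v = \<alpha> *\<^sub>v w"
  obtain \<beta> where \<beta>: "\<beta> \<in> GLm r" "\<beta> * \<alpha> = 1\<^sub>m r" using assms by (rule GLm_inverse)
  note c = GLm_carrier[OF assms] GLm_carrier[OF \<beta>(1)]
  have "\<beta> *\<^sub>v (\<alpha> *\<^sub>v x) = x" if "x \<in> carrier_vec r" for x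
    using that \<beta> assoc_mult_mat_vec[OF c(2,1) that] by simp
  then show "v = w" using v eq by metis
qed

lemma mult_vec_funcset: "\<alpha> \<in> carrier_mat r r \<Longrightarrow> (*\<^sub>v) \<alpha> \<in> carrier_vec r \<rightarrow> carrier_vec r"
  by auto

lemma linear_block_perm_bij:
  "\<alpha> \<in> GLm r \<Longrightarrow> bij_betw (block_perm r (\<lambda>_ v. \<alpha> *\<^sub>v v)) {..<m * 2 ^ r} {..<m * 2 ^ r}"
  using mult_vec_funcset[OF GLm_carrier] GLm_vec_inj by (intro block_perm_bij) blast+

lemma perm_cls_carrier: "\<alpha> \<in> GLm r \<Longrightarrow> perm_cls m r \<alpha> \<in> carrier (PGL (m * 2 ^ r))"
  unfolding perm_cls_def by (intro cls_in_PGL perm_fun_GLm linear_block_perm_bij)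

lemma perm_cls_hom: "perm_cls m r \<in> hom (GL_grp r) (PGL (m * 2 ^ r) :: 'a::field mat set monoid)"
proof (rule homI)
  fix \<alpha> :: "bit mat" assume "\<alpha> \<in> carrier (GL_grp r)"
  then show "perm_cls m r \<alpha> \<in> carrier (PGL (m * 2 ^ r) :: 'a mat set monoid)"
    by (simp add: GL_grp_def perm_cls_carrier)
next
  fix \<alpha> \<beta> :: "bit mat" assume "\<alpha> \<in> carrier (GL_grp r)" "\<beta> \<in> carrier (GL_grp r)"
  then have c: "\<alpha> \<in> carrier_mat r r" "\<beta> \<in> carrier_mat r r" by (simp_all add: GL_grp_def GLm_carrier)
  let ?b = "\<lambda>\<alpha>. block_perm r (\<lambda>_ v. \<alpha> *\<^sub>v v)"
  have "?b \<alpha> (?b \<beta> p) = ?b (\<alpha> * \<beta>) p" for p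
  proof -
    have "bits r (?b \<beta> p mod 2 ^ r) = \<beta> *\<^sub>v bits r (p mod 2 ^ r)"
      using bits_block_perm[of "\<lambda>_ v. \<beta> *\<^sub>v v" p r] mult_vec_funcset[OF c(2)] by simp
    then have "\<alpha> *\<^sub>v bits r (?b \<beta> p mod 2 ^ r) = (\<alpha> * \<beta>) *\<^sub>v bits r (p mod 2 ^ r)"
      using assoc_mult_mat_vec[OF c bits_carrier] by simp
    then show ?thesis
      unfolding block_perm_def[of r "\<lambda>_ v. \<alpha> *\<^sub>v v"] block_perm_def[of r "\<lambda>_ v. (\<alpha> * \<beta>) *\<^sub>v v"]
      by simp
  qed
  then have "?b \<alpha> \<circ> ?b \<beta> = ?b (\<alpha> * \<beta>)" by auto
  then have "perm_fun (m * 2 ^ r) (?b \<alpha>) * perm_fun (m * 2 ^ r) (?b \<beta>) = (perm_fun (m * 2 ^ r) (?b (\<alpha> * \<beta>)) :: 'a mat)"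
    using perm_fun_mult[of "m * 2 ^ r" "?b \<beta>" "?b \<alpha>"] block_perm_less by simp
  then show "perm_cls m r (\<alpha> \<otimes>\<^bsub>GL_grp r\<^esub> \<beta>) = (perm_cls m r \<alpha> \<otimes>\<^bsub>PGL (m * 2 ^ r)\<^esub> perm_cls m r \<beta> :: 'a mat set)"
    by (simp add: perm_cls_def PGL_mult GL_grp_def)
qed

text \<open>Composing the character of \<open>v\<close> with \<open>\<alpha>\<close> gives the
  character of the transpose of \<open>\<alpha>\<close> applied to \<open>v\<close>. Permutation
  matrices thus act on \<open>D_r\<close> by the inverse transpose; placing the transpose at the
  source avoids the inverse.\<close>

lemma perm_cls_sign_diag:
  fixes \<alpha> :: "bit mat"
  assumes \<alpha>: "\<alpha> \<in> GLm r" and v: "v \<in> carrier_vec r"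
  shows "conj_by (PGL (m * 2 ^ r)) (perm_cls m r \<alpha>) (cls (sign_diag m r (transpose_mat \<alpha> *\<^sub>v v)))
    = (cls (sign_diag m r v) :: 'a::field mat set)"
proof -
  note c = GLm_carrier[OF \<alpha>]
  let ?b = "block_perm r (\<lambda>_ v. \<alpha> *\<^sub>v v)"
  have "perm_fun (m * 2 ^ r) ?b * sign_diag m r (transpose_mat \<alpha> *\<^sub>v v)
      = (sign_diag m r v * perm_fun (m * 2 ^ r) ?b :: 'a mat)"
    unfolding sign_diag_def
  proof (rule perm_fun_diag_fun[OF linear_block_perm_bij[OF \<alpha>]])
    fix p :: nat
    have "bits r (?b p mod 2 ^ r) = \<alpha> *\<^sub>v bits r (p mod 2 ^ r)"
      using bits_block_perm[of "\<lambda>_ v. \<alpha> *\<^sub>v v" p r] mult_vec_funcset[OF c] by simp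
    then show "(chi r v (?b p mod 2 ^ r) :: 'a) = chi r (transpose_mat \<alpha> *\<^sub>v v) (p mod 2 ^ r)"
      using transpose_vec_mult_scalar[OF c bits_carrier v] by (simp add: chi_def)
  qed
  then show ?thesis
    unfolding perm_cls_def
    by (intro PGL_conj_eqI perm_fun_GLm linear_block_perm_bij \<alpha> sign_diag_GLm)
qed

lemma perm_cls_kron_cls:
  assumes \<alpha>: "\<alpha> \<in> GLm r" and X: "X \<in> carrier (PGL m)"
  shows "perm_cls m r \<alpha> \<otimes>\<^bsub>PGL (m * 2 ^ r)\<^esub> kron_cls r X = kron_cls r X \<otimes>\<^bsub>PGL (m * 2 ^ r)\<^esub> perm_cls m r \<alpha>"
proof -
  obtain A where A: "A \<in> GLm m" "X = cls A" using X by (rule PGL_carrierE)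
  note c = GLm_carrier[OF A(1)]
  show ?thesis
    using perm_fun_kron_I[OF c mult_vec_funcset[OF GLm_carrier[OF \<alpha>]] GLm_vec_inj[OF \<alpha>]] A c
    by (simp add: perm_cls_def kron_cls_cls PGL_mult kron_I_carrier)
qed

lemma kron_cls_sign_diag:
  assumes X: "X \<in> carrier (PGL m)"
  shows "conj_by (PGL (m * 2 ^ r)) (kron_cls r X) (cls (sign_diag m r v)) = cls (sign_diag m r v)"
proof -
  obtain A where A: "A \<in> GLm m" "X = cls A" using X by (rule PGL_carrierE)
  show ?thesis
    unfolding A(2) kron_cls_cls
    by (intro PGL_conj_eqI kron_I_GLm sign_diag_GLm A(1) sign_diag_kron_I[OF GLm_carrier[OF A(1)], symmetric])
qed

text \<open>A trivial action means that the transpose of \<open>\<alpha>\<close> fixes every vector;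
  the unit vectors then reveal the entries of \<open>\<alpha>\<close>.\<close>

lemma perm_cls_faithful:
  fixes \<alpha> :: "bit mat"
  assumes two: "(2 :: 'a::field) \<noteq> 0" and m: "0 < m" and \<alpha>: "\<alpha> \<in> GLm r"
    and triv: "\<And>v. v \<in> carrier_vec r \<Longrightarrow>
      conj_by (PGL (m * 2 ^ r)) (perm_cls m r \<alpha>) (cls (sign_diag m r v)) = (cls (sign_diag m r v) :: 'a mat set)"
  shows "\<alpha> = 1\<^sub>m r"
proof -
  note c = GLm_carrier[OF \<alpha>]
  have tc: "transpose_mat \<alpha> \<in> carrier_mat r r" using c by simp
  have fix_vec: "transpose_mat \<alpha> *\<^sub>v v = v" if v: "v \<in> carrier_vec r" for v
  proof -
    have w: "transpose_mat \<alpha> *\<^sub>v v \<in> carrier_vec r" using tc v by simp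
    have "cls (sign_diag m r (transpose_mat \<alpha> *\<^sub>v v)) = (cls (sign_diag m r v) :: 'a mat set)"
      using perm_cls_sign_diag[OF \<alpha> v, of m, where ?'a = 'a] triv[OF w] by simp
    then show ?thesis using sign_diag_cls_inj[OF two m w v] by simp
  qed
  show ?thesis
  proof (rule eq_matI)
    fix i j assume "i < dim_row (1\<^sub>m r :: bit mat)" "j < dim_col (1\<^sub>m r :: bit mat)"
    then have ij: "i < r" "j < r" by auto
    have "\<alpha> $$ (i, j) = (transpose_mat \<alpha> *\<^sub>v unit_vec r i) $ j"
      using ij c by (simp add: scalar_prod_right_unit[of _ r])
    also have "\<dots> = unit_vec r i $ j" using fix_vec[of "unit_vec r i"] by simp
    finally show "\<alpha> $$ (i, j) = 1\<^sub>m r $$ (i, j)" using ij by auto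
  qed (use c in auto)
qed

text \<open>An endomorphism of \<open>D_r\<close> is additive on bit vectors, and over the field
  with two elements additive maps are linear. Injectivity makes the matrix \<open>M\<close>
  invertible.\<close>

lemma realize_sign_diag_aut:
  assumes two: "(2 :: 'a::field) \<noteq> 0" and m: "0 < m"
    and \<beta>: "\<beta> \<in> hom (PGL (m * 2 ^ r)\<lparr>carrier := D_r (m * 2 ^ r) r\<rparr>)
      (PGL (m * 2 ^ r)\<lparr>carrier := D_r (m * 2 ^ r) r\<rparr> :: 'a mat set monoid)"
    and inj: "inj_on \<beta> (D_r (m * 2 ^ r) r)"
  shows "\<exists>\<alpha>\<in>GLm r. \<forall>a\<in>D_r (m * 2 ^ r) r. conj_by (PGL (m * 2 ^ r)) (perm_cls m r \<alpha>) a = \<beta> a"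
proof -
  let ?G = "PGL (m * 2 ^ r) :: 'a mat set monoid"
  let ?d = "\<lambda>v. cls (sign_diag m r v) :: 'a mat set"
  have mult: "?d v \<otimes>\<^bsub>?G\<^esub> ?d w = ?d (v + w)" if "v \<in> carrier_vec r" "w \<in> carrier_vec r" for v w
    using that by (simp add: PGL_mult sign_diag_mult)
  have D: "?d v \<in> D_r (m * 2 ^ r) r" if "v \<in> carrier_vec r" for v using that by (simp add: D_r_eq)
  have ex: "\<exists>w. w \<in> carrier_vec r \<and> \<beta> (?d v) = ?d w" if "v \<in> carrier_vec r" for v
  proof -
    have "\<beta> (?d v) \<in> D_r (m * 2 ^ r) r" using hom_in_carrier[OF \<beta>, of "?d v"] D[OF that] by simp
    then show ?thesis by (auto simp: D_r_eq)
  qed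
  define b where "b v = (SOME w. w \<in> carrier_vec r \<and> \<beta> (?d v) = ?d w)" for v
  have b: "b v \<in> carrier_vec r" "\<beta> (?d v) = ?d (b v)" if "v \<in> carrier_vec r" for v
    using someI_ex[OF ex[OF that]] by (auto simp: b_def)
  have b_add: "b (v + w) = b v + b w" if v: "v \<in> carrier_vec r" "w \<in> carrier_vec r" for v w
  proof (rule sign_diag_cls_inj[OF two m])
    have "?d (b (v + w)) = \<beta> (?d v \<otimes>\<^bsub>?G\<^esub> ?d w)" using b(2)[of "v + w"] mult[OF v] v by simp
    also have "\<dots> = \<beta> (?d v) \<otimes>\<^bsub>?G\<^esub> \<beta> (?d w)"
      using hom_mult[OF \<beta>, of "?d v" "?d w"] D v by simp
    also have "\<dots> = ?d (b v + b w)" using b v mult by simp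
    finally show "?d (b (v + w)) = ?d (b v + b w)" .
  qed (use b v in auto)
  define M where "M = mat r r (\<lambda>(i, j). b (unit_vec r j) $ i)"
  have Mc: "M \<in> carrier_mat r r" by (simp add: M_def)
  have Mu: "M *\<^sub>v unit_vec r k = b (unit_vec r k)" if k: "k < r" for k
  proof (rule eq_vecI)
    fix i assume "i < dim_vec (b (unit_vec r k))"
    then have i: "i < r" using b(1)[of "unit_vec r k"] by simp
    then show "(M *\<^sub>v unit_vec r k) $ i = b (unit_vec r k) $ i"
      using k Mc by (simp add: M_def scalar_prod_right_unit[of _ r])
  qed (use b(1)[of "unit_vec r k"] Mc in simp)
  have b0: "b (0\<^sub>v r) = 0\<^sub>v r"
  proof -
    have c: "b (0\<^sub>v r) \<in> carrier_vec r" using b by simp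
    have "b (0\<^sub>v r) = b (0\<^sub>v r) + b (0\<^sub>v r)" using b_add[of "0\<^sub>v r" "0\<^sub>v r"] by simp
    then show ?thesis using bit_vec_add_self[OF c] by simp
  qed
  have bM: "b v = M *\<^sub>v v" if "v \<in> carrier_vec r" for v
    using that
  proof (induction rule: bit_vec_induct)
    case zero
    have "M *\<^sub>v 0\<^sub>v r = 0\<^sub>v r" using Mc by auto
    then show ?case using b0 by simp
  next
    case (add v k)
    then show ?case
      using b_add[of v "unit_vec r k"] Mu mult_add_distrib_mat_vec[OF Mc add(1), of "unit_vec r k"] by simp
  qed
  have "det M \<noteq> 0"
  proof
    assume "det M = 0"
    then obtain v where v: "v \<in> carrier_vec r" "v \<noteq> 0\<^sub>v r" "M *\<^sub>v v = 0\<^sub>v r"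
      using det_0_iff_vec_prod_zero[OF Mc] by blast
    have "\<beta> (?d v) = \<beta> (?d (0\<^sub>v r))" using b(2)[OF v(1)] b(2)[of "0\<^sub>v r"] bM[OF v(1)] v(3) b0 by simp
    then have "?d v = ?d (0\<^sub>v r)" using inj_onD[OF inj _ D[OF v(1)] D[of "0\<^sub>v r"]] by simp
    then show False using sign_diag_cls_inj[OF two m v(1), of "0\<^sub>v r"] v(2) by simp
  qed
  then have MG: "M \<in> GLm r" using Mc by (simp add: GLm_def)
  then obtain B where B: "B \<in> GLm r" "B * M = 1\<^sub>m r" by (rule GLm_inverse)
  note Bc = GLm_carrier[OF B(1)]
  \<comment> \<open>Since permutation matrices act by the inverse transpose, the inverse transpose
    of \<open>M\<close> is needed here.\<close>
  define \<alpha> where "\<alpha> = transpose_mat B"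
  have \<alpha>: "\<alpha> \<in> GLm r" using B(1) Bc det_transpose[OF Bc] by (simp add: GLm_def \<alpha>_def)
  have "conj_by ?G (perm_cls m r \<alpha>) (?d v) = \<beta> (?d v)" if v: "v \<in> carrier_vec r" for v
  proof -
    have "transpose_mat \<alpha> *\<^sub>v (M *\<^sub>v v) = v"
      using assoc_mult_mat_vec[OF Bc Mc v] B(2) v by (simp add: \<alpha>_def)
    then show ?thesis
      using perm_cls_sign_diag[OF \<alpha>, of "M *\<^sub>v v" m, where ?'a = 'a] Mc v b(2)[OF v] bM[OF v] by simp
  qed
  then show ?thesis using \<alpha> by (auto simp: D_r_eq)
qed

subsection \<open>Connected centralizers and toral subgroups\<close>

lemma smult_mat_1 [simp]: "(1 :: 'a::field) \<cdot>\<^sub>m A = A"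
  by auto

lemma smult_mat_smult: "a \<cdot>\<^sub>m (b \<cdot>\<^sub>m A) = (a * b) \<cdot>\<^sub>m (A :: 'a::field mat)"
  by auto

lemma mpoly_fun_sum:
  "finite S \<Longrightarrow> (\<And>k. k \<in> S \<Longrightarrow> f k \<in> mpoly_fun n) \<Longrightarrow> (\<lambda>A. \<Sum>k\<in>S. f k A) \<in> mpoly_fun n"
  by (induction S rule: finite_induct) (auto intro: mpoly_fun.const mpoly_fun.add)

text \<open>Entrywise the relation is a linear equation in the entries of \<open>A\<close>. Being
  homogeneous, it cuts out a union of scalar classes, as closedness in the quotient topology
  requires.\<close>

lemma zar_closed_commutation:
  fixes u :: "'a::field mat"
  assumes u: "u \<in> carrier_mat n n"
  shows "zar_closed_PGL n (cls ` {A \<in> GLm n. A * u = e \<cdot>\<^sub>m (u * A)})"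
proof -
  let ?T = "{A \<in> GLm n. A * u = e \<cdot>\<^sub>m (u * A)}"
  define f where "f i j A = (\<Sum>k<n. A $$ (i, k) * u $$ (k, j)) + (- e) * (\<Sum>k<n. u $$ (i, k) * A $$ (k, j))" for i j A
  have mp: "f i j \<in> mpoly_fun n" if "i < n" "j < n" for i j
    using that unfolding f_def
    by (intro mpoly_fun.add mpoly_fun.mult mpoly_fun_sum mpoly_fun.entry mpoly_fun.const) auto
  have f: "(\<forall>i<n. \<forall>j<n. f i j A = 0) \<longleftrightarrow> A * u = e \<cdot>\<^sub>m (u * A)" if A: "A \<in> GLm n" for A
  proof -
    note Ac = GLm_carrier[OF A]
    have "f i j A = 0 \<longleftrightarrow> (A * u) $$ (i, j) = (e \<cdot>\<^sub>m (u * A)) $$ (i, j)" if "i < n" "j < n" for i j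
      using that u Ac mult_mat_entry[OF Ac u that] mult_mat_entry[OF u Ac that]
      by (simp add: f_def)
    then have "(\<forall>i<n. \<forall>j<n. f i j A = 0) \<longleftrightarrow>
        (\<forall>i<n. \<forall>j<n. (A * u) $$ (i, j) = (e \<cdot>\<^sub>m (u * A)) $$ (i, j))" by simp
    also have "\<dots> \<longleftrightarrow> A * u = e \<cdot>\<^sub>m (u * A)"
    proof
      assume "\<forall>i<n. \<forall>j<n. (A * u) $$ (i, j) = (e \<cdot>\<^sub>m (u * A)) $$ (i, j)"
      then show "A * u = e \<cdot>\<^sub>m (u * A)" by (intro eq_matI) (use Ac u in auto)
    qed simp
    finally show ?thesis .
  qed
  have un: "\<Union>(cls ` ?T) = ?T"
  proof
    show "?T \<subseteq> \<Union>(cls ` ?T)" using cls_self by blast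
    show "\<Union>(cls ` ?T) \<subseteq> ?T"
    proof
      fix B assume "B \<in> \<Union>(cls ` ?T)"
      then obtain A c where A: "A \<in> GLm n" "A * u = e \<cdot>\<^sub>m (u * A)" and c: "c \<noteq> 0" "B = c \<cdot>\<^sub>m A"
        by (auto simp: cls_def)
      note Ac = GLm_carrier[OF A(1)]
      have "B * u = c \<cdot>\<^sub>m (A * u)" using c mult_smult_assoc_mat[OF Ac u] by simp
      also have "\<dots> = e \<cdot>\<^sub>m (c \<cdot>\<^sub>m (u * A))" using A(2) by (simp add: smult_mat_smult mult.commute)
      also have "c \<cdot>\<^sub>m (u * A) = u * B" using c mult_smult_distrib[OF u Ac] by simp
      finally show "B \<in> ?T" using GLm_smult[OF A(1)] c by simp
    qed
  qed
  define F where "F = {f i j | i j. i < n \<and> j < n}"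
  have "(\<forall>g\<in>F. g A = 0) \<longleftrightarrow> (\<forall>i<n. \<forall>j<n. f i j A = 0)" for A by (auto simp: F_def)
  then have "A \<in> ?T \<longleftrightarrow> A \<in> {A \<in> GLm n. \<forall>g\<in>F. g A = 0}" for A using f[of A] by auto
  then have "?T = {A \<in> GLm n. \<forall>g\<in>F. g A = 0}" by blast
  moreover have "F \<subseteq> mpoly_fun n" using mp by (auto simp: F_def)
  ultimately have "zar_closed_GL n (\<Union>(cls ` ?T))"
    unfolding zar_closed_GL_def un by (intro exI[of _ F] conjI)
  moreover have "cls ` ?T \<subseteq> carrier (PGL n)" using cls_in_PGL by blast
  ultimately show ?thesis unfolding zar_closed_PGL_def by (rule conjI[rotated])
qed

text \<open>The commutator of lifts takes values in \<open>{1, -1}\<close>, so it cuts the centralizer into two disjoint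
  closed pieces.\<close>

lemma connected_centralizer_commutes:
  fixes U1 :: "'a::field mat set set"
  assumes two: "(2 :: 'a) \<noteq> 0" and m: "0 < m" and elem: "elem_ab_2 (PGL m) U1"
    and conn: "zar_connected m (centralizer (PGL m) U1)"
    and z: "z \<in> GLm m" "cls z \<in> centralizer (PGL m) U1" and u: "u \<in> \<Union>U1"
  shows "z * u = u * z"
proof -
  interpret group "PGL m :: 'a mat set monoid" by (rule group_PGL)
  obtain X where X: "X \<in> U1" "u \<in> X" using u by blast
  have "subgroup U1 (PGL m)" using elem unfolding elem_ab_2_def by blast
  then have Xc: "X \<in> carrier (PGL m)" using X(1) by (rule subgroup.mem_carrier)
  note uG = PGL_mem(1)[OF Xc X(2)] and Xu = PGL_mem(2)[OF Xc X(2)]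
  note uc = GLm_carrier[OF uG]
  let ?C = "centralizer (PGL m) U1"
  let ?S = "\<lambda>e. cls ` {A \<in> GLm m. A * u = e \<cdot>\<^sub>m (u * A)}"
  have uU: "cls u \<in> U1" using X(1) Xu by metis
  then have "cls u \<otimes>\<^bsub>PGL m\<^esub> cls u = \<one>\<^bsub>PGL m\<^esub>" using elem unfolding elem_ab_2_def by blast
  then have "cls (u * u) = cls (1\<^sub>m m)" using PGL_mult[OF uc uc] by (simp add: PGL_one)
  then obtain d where d: "d \<noteq> 0" "u * u = d \<cdot>\<^sub>m 1\<^sub>m m" unfolding cls_eq_iff by blast
  have cover: "Y \<in> ?S 1 \<or> Y \<in> ?S (- 1)" if Y: "Y \<in> ?C" for Y
  proof -
    have "Y \<in> carrier (PGL m)" using Y by (simp add: centralizer_def)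
    then obtain A where A: "A \<in> GLm m" "Y = cls A" by (rule PGL_carrierE)
    note Ac = GLm_carrier[OF A(1)]
    have "cls A \<otimes>\<^bsub>PGL m\<^esub> cls u = cls u \<otimes>\<^bsub>PGL m\<^esub> cls A"
      using Y uU A(2) by (simp add: centralizer_def)
    then have "cls (A * u) = cls (u * A)" using PGL_mult[OF Ac uc] PGL_mult[OF uc Ac] by simp
    then obtain c where c: "c \<noteq> 0" "A * u = c \<cdot>\<^sub>m (u * A)" unfolding cls_eq_iff by blast
    \<comment> \<open>Moving \<open>A\<close> past \<open>u\<close> twice costs the factor
      \<open>c\<close> twice, but \<open>u * u\<close> is the scalar matrix of \<open>d\<close>;
      hence \<open>c * c = 1\<close>.\<close>
    have "d \<cdot>\<^sub>m A = A * (u * u)" using d Ac mult_smult_distrib[OF Ac one_carrier_mat] by simp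
    also have "\<dots> = (A * u) * u" using Ac uc by simp
    also have "\<dots> = c \<cdot>\<^sub>m (u * A * u)" unfolding c(2)
      using mult_smult_assoc_mat[OF mult_carrier_mat[OF uc Ac] uc] by simp
    also have "u * A * u = u * (A * u)" using Ac uc by simp
    also have "\<dots> = c \<cdot>\<^sub>m (u * (u * A))" unfolding c(2)
      using mult_smult_distrib[OF uc mult_carrier_mat[OF uc Ac]] by simp
    also have "u * (u * A) = (u * u) * A" using Ac uc by simp
    also have "\<dots> = d \<cdot>\<^sub>m A" using d Ac mult_smult_assoc_mat[OF one_carrier_mat Ac] by simp
    also have "c \<cdot>\<^sub>m (c \<cdot>\<^sub>m (d \<cdot>\<^sub>m A)) = (c * c) \<cdot>\<^sub>m (d \<cdot>\<^sub>m A)" by (rule smult_mat_smult)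
    finally have "(c * c) \<cdot>\<^sub>m (d \<cdot>\<^sub>m A) = d \<cdot>\<^sub>m A" by (rule sym)
    then have "c * c = 1" using GLm_smult_eq_self[OF GLm_smult[OF A(1) d(1)] m] by blast
    then consider "c = 1" | "c = - 1" by (auto simp: square_eq_1_iff)
    then show ?thesis
    proof cases
      case 1
      then have "A \<in> {A \<in> GLm m. A * u = 1 \<cdot>\<^sub>m (u * A)}" using A(1) c(2) by simp
      then show ?thesis unfolding A(2) by blast
    next
      case 2
      then have "A \<in> {A \<in> GLm m. A * u = (- 1) \<cdot>\<^sub>m (u * A)}" using A(1) c(2) by simp
      then show ?thesis unfolding A(2) by blast
    qed
  qed
  \<comment> \<open>The identity lies in the piece of sign 1, so connectedness will make the piece
    of sign -1 empty.\<close>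
  have one: "\<one>\<^bsub>PGL m\<^esub> \<in> ?S 1 \<inter> ?C"
  proof -
    have "1\<^sub>m m * u = 1 \<cdot>\<^sub>m (u * 1\<^sub>m m)" using uc by simp
    then have "cls (1\<^sub>m m) \<in> ?S 1" using GLm_one by blast
    moreover have "\<one>\<^bsub>PGL m\<^esub> \<in> ?C"
    proof -
      have "U1 \<subseteq> carrier (PGL m)" using elem subgroup.subset unfolding elem_ab_2_def by blast
      then show ?thesis by (auto simp: centralizer_def)
    qed
    ultimately show ?thesis by (simp add: PGL_one)
  qed
  have disj: "?S 1 \<inter> ?S (- 1) = {}"
  proof (rule ccontr)
    assume "?S 1 \<inter> ?S (- 1) \<noteq> {}"
    then obtain Y where Y: "Y \<in> ?S 1" "Y \<in> ?S (- 1)" by blast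
    obtain A where A: "A \<in> GLm m" "A * u = 1 \<cdot>\<^sub>m (u * A)" "Y = cls A" using Y(1) by blast
    obtain B where B: "B \<in> GLm m" "B * u = (- 1) \<cdot>\<^sub>m (u * B)" "Y = cls B" using Y(2) by blast
    have "cls B = cls A" using A(3) B(3) by simp
    then obtain c where c: "c \<noteq> 0" "B = c \<cdot>\<^sub>m A" unfolding cls_eq_iff by blast
    note Ac = GLm_carrier[OF A(1)]
    have uB: "u * B \<in> GLm m" using uG B GLm_mult by blast
    have "B * u = c \<cdot>\<^sub>m (A * u)" using c mult_smult_assoc_mat[OF Ac uc] by simp
    also have "\<dots> = c \<cdot>\<^sub>m (u * A)" using A(2) by simp
    also have "\<dots> = u * B" using c mult_smult_distrib[OF uc Ac] by simp
    finally have "(- 1) \<cdot>\<^sub>m (u * B) = u * B" using B(2) by simp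
    then have "(- 1 :: 'a) = 1" using GLm_smult_eq_self[OF uB m] by blast
    then show False using sg_eq_1_iff[OF two, of 1] by simp
  qed
  have "?S (- 1) \<inter> ?C = {}"
  proof (rule ccontr)
    assume "?S (- 1) \<inter> ?C \<noteq> {}"
    moreover have "?S 1 \<inter> ?C \<noteq> {}" using one by blast
    moreover have "?C \<subseteq> ?S 1 \<union> ?S (- 1)" using cover by blast
    moreover have "?S 1 \<inter> ?S (- 1) \<inter> ?C = {}" using disj by blast
    moreover note zar_closed_commutation[OF uc, of 1] zar_closed_commutation[OF uc, of "- 1"]
    ultimately have "\<not> zar_connected m ?C"
      unfolding zar_connected_def not_not by (intro exI[of _ "?S 1"] exI[of _ "?S (- 1)"] conjI)
    then show False using conn by contradiction
  qed
  then have "cls z \<in> ?S 1" using cover[OF z(2)] z(2) by blast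
  then obtain A where A: "A \<in> GLm m" "A * u = 1 \<cdot>\<^sub>m (u * A)" "cls z = cls A" by blast
  then obtain c where c: "z = c \<cdot>\<^sub>m A" unfolding cls_eq_iff by blast
  note Ac = GLm_carrier[OF A(1)]
  show ?thesis
    unfolding c mult_smult_assoc_mat[OF Ac uc] mult_smult_distrib[OF uc Ac] using A(2) by simp
qed

text \<open>Torality speaks about classes. The scalar that appears on passing to lifts is absorbed
  into the diagonal matrix.\<close>

lemma toral_simultaneously_diagonal:
  fixes U1 :: "'a::field mat set set"
  assumes sub: "U1 \<subseteq> carrier (PGL m)" and tor: "toral m U1"
  obtains P where "P \<in> GLm m" "\<And>u. u \<in> \<Union>U1 \<Longrightarrow> \<exists>f. P * u = diag_fun m f * P"
proof -
  obtain g where g: "g \<in> carrier (PGL m)" "(\<lambda>x. conj_by (PGL m) g x) ` U1 \<subseteq> std_torus m"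
    using tor unfolding toral_def conj_by_def by blast
  obtain P where P: "P \<in> GLm m" "g = cls P" using g(1) by (rule PGL_carrierE)
  note Pc = GLm_carrier[OF P(1)]
  have "\<exists>f. P * u = diag_fun m f * P" if u: "u \<in> \<Union>U1" for u
  proof -
    obtain X where X: "X \<in> U1" "u \<in> X" using u by blast
    have Xc: "X \<in> carrier (PGL m)" using X sub by blast
    have "conj_by (PGL m) (cls P) (cls u) \<in> std_torus m"
      using g(2) X(1) P(2) PGL_mem(2)[OF Xc X(2)] by blast
    then obtain A where A: "A \<in> GLm m" "diagonal_mat A" "conj_by (PGL m) (cls P) (cls u) = cls A"
      by (auto simp: std_torus_def)
    note Ac = GLm_carrier[OF A(1)]
    obtain c where "P * u = c \<cdot>\<^sub>m (A * P)"
      using A(3) PGL_conj_iff[OF P(1) PGL_mem(1)[OF Xc X(2)] A(1)] by blast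
    then have "P * u = (c \<cdot>\<^sub>m A) * P" using mult_smult_assoc_mat[OF Ac Pc] by simp
    moreover have "c \<cdot>\<^sub>m A = diag_fun m (\<lambda>i. c * A $$ (i, i))"
      using A(2) Ac by (intro eq_matI) (auto simp: diag_fun_def diagonal_mat_def)
    ultimately have "P * u = diag_fun m (\<lambda>i. c * A $$ (i, i)) * P" by simp
    then show ?thesis by blast
  qed
  then show thesis using that[OF P(1)] by blast
qed

lemma alg_closed_sqrt:
  fixes c :: "'a::field"
  assumes "alg_closed_field TYPE('a)"
  obtains s where "s * s = c"
proof -
  have "degree [:- c, 0, 1:] \<ge> 1" by simp
  then obtain s where "poly [:- c, 0, 1:] s = 0" using assms unfolding alg_closed_field_def by blast
  then have "s * s = c" by simp
  then show thesis by (rule that)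
qed

subsection \<open>The Weyl group of the subgroup\<close>

text \<open>\<open>exact\<close> and \<open>diag\<close> are the consequences of connectedness and
  torality on which the argument rests. Assuming them directly treats the trivial \<open>U1\<close>,
  where they hold because its lifts are scalar, together with the other case.\<close>

locale pgl_toral =
  fixes m r :: nat and U1 :: "'a::field mat set set" and P :: "'a mat"
  assumes alg: "alg_closed_field TYPE('a)" and two: "(2 :: 'a) \<noteq> 0" and m: "0 < m"
    and elem: "elem_ab_2 (PGL m) U1"
    and exact: "\<And>z u. z \<in> GLm m \<Longrightarrow> cls z \<in> centralizer (PGL m) U1 \<Longrightarrow> u \<in> \<Union>U1 \<Longrightarrow> z * u = u * z"
    and P: "P \<in> GLm m" and diag: "\<And>u. u \<in> \<Union>U1 \<Longrightarrow> \<exists>f. P * u = diag_fun m f * P"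
begin

abbreviation "n \<equiv> m * 2 ^ r"
abbreviation "G \<equiv> PGL n :: 'a mat set monoid"
abbreviation "kr u \<equiv> kron_I u (2 ^ r) :: 'a mat"
abbreviation "d v \<equiv> sign_diag m r v :: 'a mat"
abbreviation "A \<equiv> D_r n r :: 'a mat set set"
abbreviation "B \<equiv> Ubar r U1"
abbreviation "D \<equiv> A <#>\<^bsub>G\<^esub> B"

sublocale G: group G by (rule group_PGL)

lemma U1_sub: "subgroup U1 (PGL m)" and U1_carrier: "U1 \<subseteq> carrier (PGL m)" and U1_finite: "finite U1"
  using elem subgroup.subset unfolding elem_ab_2_def by blast+

lemma U1_lift: "u \<in> \<Union>U1 \<Longrightarrow> u \<in> GLm m" and U1_lift_cls: "u \<in> \<Union>U1 \<Longrightarrow> cls u \<in> U1"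
  using PGL_mem U1_carrier by blast+

lemma B_eq: "B = kron_cls r ` U1"
  by (rule Ubar_eq[OF U1_carrier])

lemma B_memE:
  assumes "b \<in> B" obtains u where "u \<in> \<Union>U1" "b = cls (kr u)"
  using assms by (auto simp: Ubar_def)

lemma B_memI: "u \<in> \<Union>U1 \<Longrightarrow> cls (kr u) \<in> B"
  by (auto simp: Ubar_def)

lemma kr_GLm: "u \<in> \<Union>U1 \<Longrightarrow> kr u \<in> GLm n"
  using U1_lift kron_I_GLm by blast

lemma subgroup_B: "subgroup B G"
proof -
  interpret k: group_hom "PGL m" G "kron_cls r"
    by (rule group_hom.intro[OF group_PGL group_PGL], rule group_hom_axioms.intro, rule kron_cls_hom)
  show ?thesis unfolding B_eq by (rule k.subgroup_img_is_subgroup[OF U1_sub])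
qed

lemma finite_A: "finite A"
proof -
  have "carrier_vec r \<subseteq> (bits r :: nat \<Rightarrow> bit vec) ` {..<2 ^ r}"
  proof
    fix v :: "bit vec" assume "v \<in> carrier_vec r"
    then have "v = bits r (unbits r v)" by (simp add: bits_unbits)
    then show "v \<in> bits r ` {..<2 ^ r}" using unbits_less[of r v] by blast
  qed
  then have "finite (carrier_vec r :: bit vec set)" by (rule finite_surj[rotated]) simp
  then show ?thesis by (simp add: D_r_eq)
qed

lemma compression:
  assumes X: "X \<in> GLm n" and triv: "\<And>a. a \<in> A \<Longrightarrow> conj_by G (cls X) a = a"
  shows "\<exists>z\<in>GLm m. \<forall>u\<in>carrier_mat m m. \<forall>u'\<in>carrier_mat m m.
    X * kr u = kr u' * X \<longrightarrow> z * u = u' * z"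
proof (rule block_compression[OF two m X])
  fix i assume "i < r"
  have "cls (d (unit_vec r i)) \<in> A" unfolding D_r_eq by (rule imageI) simp
  then have "conj_by G (cls X) (cls (d (unit_vec r i))) = cls (d (unit_vec r i))" by (rule triv)
  then show "\<exists>c. c \<noteq> 0 \<and> X * d (unit_vec r i) = c \<cdot>\<^sub>m (d (unit_vec r i) * X)"
    unfolding PGL_conj_iff[OF X sign_diag_GLm sign_diag_GLm] .
qed

text \<open>The compressed matrix \<open>z\<close> commutes with lifts of \<open>U1\<close> up to
  the same scalars as \<open>X\<close>, because a scalar can be absorbed into the second Kronecker
  lift. So \<open>z\<close> centralizes \<open>U1\<close> in PGL_m, and \<open>exact\<close> makes
  these scalars 1.\<close>

lemma centralizer_commutes:
  assumes X: "X \<in> GLm n" and trivA: "\<And>a. a \<in> A \<Longrightarrow> conj_by G (cls X) a = a"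
    and trivB: "\<And>b. b \<in> B \<Longrightarrow> conj_by G (cls X) b = b" and u: "u \<in> \<Union>U1"
  shows "X * kr u = kr u * X"
proof -
  interpret M: group "PGL m :: 'a mat set monoid" by (rule group_PGL)
  obtain z where z: "z \<in> GLm m"
    "\<forall>u\<in>carrier_mat m m. \<forall>u'\<in>carrier_mat m m. X * kr u = kr u' * X \<longrightarrow> z * u = u' * z"
    using compression[OF X trivA] by blast
  note zc = GLm_carrier[OF z(1)] and Xc = GLm_carrier[OF X]
  have key: "\<exists>c. c \<noteq> 0 \<and> X * kr u = c \<cdot>\<^sub>m (kr u * X) \<and> z * u = c \<cdot>\<^sub>m (u * z)" if u: "u \<in> \<Union>U1" for u
  proof -
    note uc = GLm_carrier[OF U1_lift[OF u]]
    obtain c where c: "c \<noteq> 0" "X * kr u = c \<cdot>\<^sub>m (kr u * X)"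
      using trivB[OF B_memI[OF u]] PGL_conj_iff[OF X kr_GLm[OF u] kr_GLm[OF u]] by blast
    have "X * kr u = kr (c \<cdot>\<^sub>m u) * X"
      using c(2) mult_smult_assoc_mat[OF kron_I_carrier[OF uc] Xc] by (simp add: kron_I_smult)
    then have "z * u = (c \<cdot>\<^sub>m u) * z" using z(2) uc smult_carrier_mat[OF uc] by blast
    then have "z * u = c \<cdot>\<^sub>m (u * z)" using mult_smult_assoc_mat[OF uc zc] by simp
    then show ?thesis using c by blast
  qed
  have "conj_by (PGL m) (cls z) Y = Y" if Y: "Y \<in> U1" for Y
  proof -
    obtain v where v: "v \<in> GLm m" "Y = cls v" using Y U1_carrier PGL_carrierE by blast
    have "v \<in> \<Union>U1" using Y v cls_self by blast
    then show ?thesis using key[of v] PGL_conj_iff[OF z(1) v(1) v(1)] v(2) by blast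
  qed
  then have "cls z \<in> centralizer (PGL m) U1"
    using M.mem_centralizer_iff[OF U1_carrier] cls_in_PGL[OF z(1)] by blast
  then have zu: "z * u = u * z" using exact[OF z(1)] u by blast
  obtain c where c: "X * kr u = c \<cdot>\<^sub>m (kr u * X)" "z * u = c \<cdot>\<^sub>m (u * z)" using key[OF u] by blast
  have "u * z \<in> GLm m" using U1_lift[OF u] z(1) GLm_mult by blast
  then have "c = 1" using GLm_smult_eq_self[OF _ m, of "u * z" c] c(2) zu by simp
  then show ?thesis using c(1) by simp
qed

text \<open>Translation by \<open>w\<close> in every block multiplies the character of
  \<open>x\<close> by the sign of \<open>x \<bullet> w\<close>. The vector \<open>w\<close> is
  picked so that the sign for \<open>v\<close> is -1.\<close>

lemma translation_exists:
  assumes v: "v \<in> carrier_vec r" "v \<noteq> 0\<^sub>v r"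
  obtains T where "T \<in> GLm n" "\<And>u. u \<in> carrier_mat m m \<Longrightarrow> T * kr u = kr u * T"
    "\<And>a. a \<in> A \<Longrightarrow> conj_by G (cls T) a = a" "T * d v = (- 1) \<cdot>\<^sub>m (d v * T)"
proof -
  obtain w where w: "w \<in> carrier_vec r" "(sg (v \<bullet> w) :: 'a) = - 1" using sg_character_separates[OF v] by blast
  let ?F = "\<lambda>x :: bit vec. x + w"
  have F: "?F \<in> carrier_vec r \<rightarrow> carrier_vec r" "inj_on ?F (carrier_vec r)"
  proof -
    show "?F \<in> carrier_vec r \<rightarrow> carrier_vec r" using w(1) by simp
    show "inj_on ?F (carrier_vec r)"
      by (rule inj_on_inverseI[of _ ?F]) (rule bit_vec_add_cancel[OF _ w(1)])
  qed
  let ?\<pi> = "block_perm r (\<lambda>_. ?F)"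
  define T where "T = (perm_fun n ?\<pi> :: 'a mat)"
  have bij: "bij_betw ?\<pi> {..<n} {..<n}" using F by (intro block_perm_bij) blast+
  have T: "T \<in> GLm n" unfolding T_def by (rule perm_fun_GLm[OF bij])
  have Td: "T * d x = sg (x \<bullet> w) \<cdot>\<^sub>m (d x * T)" if x: "x \<in> carrier_vec r" for x
  proof -
    have "T * d x = diag_fun n (\<lambda>p. sg (x \<bullet> w) * chi r x (p mod 2 ^ r)) * T"
      unfolding T_def sign_diag_def
    proof (rule perm_fun_diag_fun[OF bij])
      fix p :: nat
      have "bits r (?\<pi> p mod 2 ^ r) = bits r (p mod 2 ^ r) + w"
        using bits_block_perm[of "\<lambda>_. ?F" p r] F(1) by blast
      then have "x \<bullet> bits r (?\<pi> p mod 2 ^ r) = x \<bullet> bits r (p mod 2 ^ r) + x \<bullet> w"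
        using scalar_prod_add_distrib[OF x bits_carrier w(1)] by simp
      then have "(chi r x (?\<pi> p mod 2 ^ r) :: 'a) = chi r x (p mod 2 ^ r) * sg (x \<bullet> w)"
        by (simp only: chi_def sg_add)
      then show "sg (x \<bullet> w) * chi r x (?\<pi> p mod 2 ^ r) = (chi r x (p mod 2 ^ r) :: 'a)"
        by (simp add: mult.left_commute mult.commute)
    qed
    also have "diag_fun n (\<lambda>p. sg (x \<bullet> w) * chi r x (p mod 2 ^ r)) = sg (x \<bullet> w) \<cdot>\<^sub>m d x"
      by (rule eq_matI) (auto simp: sign_diag_def diag_fun_def)
    finally show ?thesis using mult_smult_assoc_mat[OF sign_diag_carrier GLm_carrier[OF T]] by simp
  qed
  have "conj_by G (cls T) a = a" if a: "a \<in> A" for a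
  proof -
    obtain x where x: "x \<in> carrier_vec r" "a = cls (d x)" using a unfolding D_r_eq by blast
    show ?thesis unfolding x(2) PGL_conj_iff[OF T sign_diag_GLm sign_diag_GLm] using Td[OF x(1)]
      by (intro exI[of _ "sg (x \<bullet> w)"]) simp
  qed
  moreover have "T * kr u = kr u * T" if "u \<in> carrier_mat m m" for u
    unfolding T_def by (rule perm_fun_kron_I[OF that F])
  ultimately show thesis using that[OF T] Td[OF v(1)] w(2) by simp
qed

lemma A_memE:
  assumes "a \<in> A" obtains v where "v \<in> carrier_vec r" "a = cls (d v)"
  using assms unfolding D_r_eq by blast

lemma A_memI: "v \<in> carrier_vec r \<Longrightarrow> cls (d v) \<in> A"
  unfolding D_r_eq by (rule imageI)

lemma A_carrier: "A \<subseteq> carrier G"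
  by (auto elim!: A_memE intro!: cls_in_PGL sign_diag_GLm)

lemma B_carrier: "B \<subseteq> carrier G"
  using subgroup.subset[OF subgroup_B] .

lemma finite_B: "finite B"
  unfolding B_eq using U1_finite by simp

lemma one_in_A: "\<one>\<^bsub>G\<^esub> \<in> A"
  using A_memI[OF zero_carrier_vec] by (simp add: sign_diag_zero PGL_one)

lemma D_eq: "D = {a \<otimes>\<^bsub>G\<^esub> b | a b. a \<in> A \<and> b \<in> B}"
  by (auto simp: set_mult_def)

lemma A_sub_D: "A \<subseteq> D"
proof
  fix a assume a: "a \<in> A"
  then have "a = a \<otimes>\<^bsub>G\<^esub> \<one>\<^bsub>G\<^esub>" using A_carrier by auto
  then show "a \<in> D" unfolding D_eq using a subgroup.one_closed[OF subgroup_B] by blast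
qed

lemma B_sub_D: "B \<subseteq> D"
proof
  fix b assume b: "b \<in> B"
  then have "b = \<one>\<^bsub>G\<^esub> \<otimes>\<^bsub>G\<^esub> b" using B_carrier by auto
  then show "b \<in> D" unfolding D_eq using b one_in_A by blast
qed

lemma D_carrier: "D \<subseteq> carrier G"
  using A_carrier B_carrier by (rule G.set_mult_closed)

lemma finite_D: "finite D"
proof -
  have "D = (\<lambda>(a, b). a \<otimes>\<^bsub>G\<^esub> b) ` (A \<times> B)" by (auto simp: D_eq)
  then show ?thesis using finite_A finite_B by simp
qed

text \<open>Suppose the image of an element of \<open>Ubar\<close> has a nontrivial component
  \<open>v\<close> in \<open>D_r\<close>. Some translation centralizes \<open>D\<close> but
  anticommutes with lifts of this image. Pulled back along \<open>g\<close>, it yields an element of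
  the centralizer of \<open>D\<close> that does not commute with a lift of \<open>Ubar\<close>,
  against \<open>centralizer_commutes\<close>.\<close>

lemma normalizer_preserves_B:
  assumes g: "g \<in> normalizer G D" and b: "b \<in> B"
  shows "conj_by G g b \<in> B"
proof -
  have gc: "g \<in> carrier G" and gD: "\<And>y. y \<in> D \<Longrightarrow> conj_by G g y \<in> D"
    using g G.mem_normalizer_iff[OF D_carrier finite_D] by blast+
  obtain X where X: "X \<in> GLm n" "g = cls X" using gc by (rule PGL_carrierE)
  obtain u where u: "u \<in> \<Union>U1" "b = cls (kr u)" using b by (rule B_memE)
  have "conj_by G g b \<in> D" using gD b B_sub_D by blast
  then obtain a b' where ab: "a \<in> A" "b' \<in> B" "conj_by G g b = a \<otimes>\<^bsub>G\<^esub> b'" unfolding D_eq by blast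
  obtain v where v: "v \<in> carrier_vec r" "a = cls (d v)" using ab(1) by (rule A_memE)
  obtain u' where u': "u' \<in> \<Union>U1" "b' = cls (kr u')" using ab(2) by (rule B_memE)
  show ?thesis
  proof (cases "v = 0\<^sub>v r")
    case True
    then have "a = \<one>\<^bsub>G\<^esub>" using v by (simp add: sign_diag_zero PGL_one)
    then have "conj_by G g b = b'" using ab B_carrier by auto
    then show ?thesis using ab(2) by simp
  next
    case False
    note u'c = GLm_carrier[OF U1_lift[OF u'(1)]]
    obtain T where T: "T \<in> GLm n" "\<And>u. u \<in> carrier_mat m m \<Longrightarrow> T * kr u = kr u * T"
      "\<And>a. a \<in> A \<Longrightarrow> conj_by G (cls T) a = a" "T * d v = (- 1) \<cdot>\<^sub>m (d v * T)"
      using translation_exists[OF v(1) False] by metis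
    obtain X' where X': "X' \<in> GLm n" "X * X' = 1\<^sub>m n" "X' * X = 1\<^sub>m n" using X(1) by (rule GLm_inverse)
    define Y where "Y = d v * kr u'"
    \<comment> \<open>The pulled back translation; it centralizes \<open>D\<close> because
      \<open>g\<close> normalizes \<open>D\<close>.\<close>
    define H where "H = X' * T * X"
    have YG: "Y \<in> GLm n" using sign_diag_GLm kr_GLm[OF u'(1)] GLm_mult unfolding Y_def by blast
    have HG: "H \<in> GLm n" using X(1) X'(1) T(1) GLm_mult unfolding H_def by blast
    note c = GLm_carrier[OF X(1)] GLm_carrier[OF X'(1)] GLm_carrier[OF T(1)] GLm_carrier[OF YG]
      GLm_carrier[OF HG] GLm_carrier[OF kr_GLm[OF u(1)]] GLm_carrier[OF kr_GLm[OF u'(1)]]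
    note as = assoc_mult_mat[of _ n n _ n _ n]
    have TY: "T * Y = (- 1) \<cdot>\<^sub>m (Y * T)"
    proof -
      have "T * Y = (T * d v) * kr u'" using c by (simp add: Y_def as)
      also have "\<dots> = (- 1) \<cdot>\<^sub>m (d v * T * kr u')"
        unfolding T(4) by (rule mult_smult_assoc_mat[OF mult_carrier_mat[OF sign_diag_carrier c(3)] c(7)])
      also have "d v * T * kr u' = d v * (T * kr u')" using c by (simp add: as)
      also have "\<dots> = d v * (kr u' * T)" using T(2)[OF u'c] by simp
      also have "\<dots> = Y * T" using c by (simp add: Y_def as)
      finally show ?thesis .
    qed
    have XH: "X * H = T * X"
    proof -
      have "X * H = (X * X') * T * X" using c by (simp add: H_def as)
      then show ?thesis using X'(2) c by simp
    qed
    have Tc: "cls T \<in> carrier G" using T(1) by (rule cls_in_PGL)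
    have TD: "conj_by G (cls T) y = y" if y: "y \<in> D" for y
    proof -
      obtain a b where ab: "a \<in> A" "b \<in> B" "y = a \<otimes>\<^bsub>G\<^esub> b" using y unfolding D_eq by blast
      obtain w where w: "w \<in> \<Union>U1" "b = cls (kr w)" using ab(2) by (rule B_memE)
      have "conj_by G (cls T) b = b"
        unfolding w(2) by (rule PGL_conj_eqI[OF T(1) kr_GLm kr_GLm T(2)]) (use w U1_lift GLm_carrier in blast)+
      moreover have "a \<in> carrier G" "b \<in> carrier G" using ab A_carrier B_carrier by auto
      ultimately show ?thesis using T(3)[OF ab(1)] ab(3) G.conj_by_mult[OF Tc] by simp
    qed
    have H: "cls H = inv\<^bsub>G\<^esub> g \<otimes>\<^bsub>G\<^esub> cls T \<otimes>\<^bsub>G\<^esub> g"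
      using PGL_inv[OF X(1) X'(1) X'(3)] c X(2) by (simp add: PGL_mult H_def)
    have HD: "conj_by G (cls H) y = y" if y: "y \<in> D" for y
    proof -
      have yc: "y \<in> carrier G" using y D_carrier by blast
      have "conj_by G (cls H) y = conj_by G (inv\<^bsub>G\<^esub> g) (conj_by G (cls T) (conj_by G g y))"
        unfolding H using gc Tc yc by (simp add: G.conj_by_mult_left)
      then show ?thesis using TD[OF gD[OF y]] gc yc by simp
    qed
    have Hu: "H * kr u = kr u * H"
      by (rule centralizer_commutes[OF HG _ _ u(1)]) (use HD A_sub_D B_sub_D in blast)+
    have "conj_by G (cls X) (cls (kr u)) = cls Y"
      using ab(3) X(2) u(2) v(2) u'(2) PGL_mult[OF sign_diag_carrier c(7)] by (simp add: Y_def)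
    then obtain k where k: "k \<noteq> 0" "X * kr u = k \<cdot>\<^sub>m (Y * X)"
      unfolding PGL_conj_iff[OF X(1) kr_GLm[OF u(1)] YG] by blast
    have YX: "Y * X \<in> carrier_mat n n" using c by simp
    \<comment> \<open>The exact relation \<open>Hu\<close> is carried through \<open>X\<close>; the
      projective factor \<open>k\<close> occurs on both sides and cancels, so \<open>T\<close>
      commutes with \<open>Y\<close> on the nose.\<close>
    have "k \<cdot>\<^sub>m (T * (Y * X)) = T * (X * kr u)"
      unfolding k(2) by (rule mult_smult_distrib[OF c(3) YX, symmetric])
    also have "\<dots> = (T * X) * kr u" using c by (simp add: as)
    also have "\<dots> = X * (H * kr u)" unfolding XH[symmetric] using c by (simp add: as)
    also have "\<dots> = (X * kr u) * H" unfolding Hu using c by (simp add: as)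
    also have "\<dots> = k \<cdot>\<^sub>m (Y * X * H)" unfolding k(2) by (rule mult_smult_assoc_mat[OF YX c(5)])
    also have "Y * X * H = Y * (X * H)" using c by (simp add: as)
    also have "\<dots> = Y * (T * X)" unfolding XH ..
    finally have "k \<cdot>\<^sub>m (T * (Y * X)) = k \<cdot>\<^sub>m (Y * (T * X))" .
    then have "inverse k \<cdot>\<^sub>m (k \<cdot>\<^sub>m (T * (Y * X))) = inverse k \<cdot>\<^sub>m (k \<cdot>\<^sub>m (Y * (T * X)))"
      by (rule arg_cong)
    then have e1: "T * (Y * X) = Y * (T * X)" using k(1) unfolding smult_mat_smult by simp
    have e2: "T * (Y * X) = (- 1) \<cdot>\<^sub>m (Y * (T * X))"
    proof -
      have "T * (Y * X) = (T * Y) * X" using c by (simp add: as)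
      also have "\<dots> = (- 1) \<cdot>\<^sub>m (Y * T * X)"
        unfolding TY by (rule mult_smult_assoc_mat[OF mult_carrier_mat[OF c(4,3)] c(1)])
      also have "Y * T * X = Y * (T * X)" using c by (simp add: as)
      finally show ?thesis .
    qed
    have "(- 1) \<cdot>\<^sub>m (Y * (T * X)) = Y * (T * X)" using e2[symmetric] e1 by (rule trans)
    moreover have "Y * (T * X) \<in> GLm n" using YG T(1) X(1) GLm_mult by blast
    moreover have "0 < n" using m by simp
    ultimately have "(- 1 :: 'a) = 1" using GLm_smult_eq_self by blast
    then show ?thesis using sg_eq_1_iff[OF two, of 1] by simp
  qed
qed

text \<open>Compression preserves intertwining relations together with their scalars, so the
  Kronecker lift of the compressed matrix moves \<open>B\<close> as \<open>g\<close> does.\<close>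

lemma acts_as_block:
  assumes g: "g \<in> carrier G" and triv: "\<forall>a\<in>A. conj_by G g a = a" and pres: "\<forall>b\<in>B. conj_by G g b \<in> B"
  shows "\<exists>Z\<in>carrier (PGL m). \<forall>b\<in>B. conj_by G g b = conj_by G (kron_cls r Z) b"
proof -
  obtain X where X: "X \<in> GLm n" "g = cls X" using g by (rule PGL_carrierE)
  obtain z where z: "z \<in> GLm m"
    "\<forall>u\<in>carrier_mat m m. \<forall>u'\<in>carrier_mat m m. X * kr u = kr u' * X \<longrightarrow> z * u = u' * z"
    using compression[OF X(1)] triv X(2) by blast
  note zc = GLm_carrier[OF z(1)] and Xc = GLm_carrier[OF X(1)]
  have "conj_by G g b = conj_by G (kron_cls r (cls z)) b" if b: "b \<in> B" for b
  proof -
    obtain u where u: "u \<in> \<Union>U1" "b = cls (kr u)" using b by (rule B_memE)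
    have "conj_by G g b \<in> B" using pres b by blast
    then obtain u' where u': "u' \<in> \<Union>U1" "conj_by G g b = cls (kr u')" by (rule B_memE)
    note uc = GLm_carrier[OF U1_lift[OF u(1)]] and u'c = GLm_carrier[OF U1_lift[OF u'(1)]]
    obtain c where c: "c \<noteq> 0" "X * kr u = c \<cdot>\<^sub>m (kr u' * X)"
      using u'(2) X(2) u(2) PGL_conj_iff[OF X(1) kr_GLm[OF u(1)] kr_GLm[OF u'(1)]] by blast
    have "X * kr u = kr (c \<cdot>\<^sub>m u') * X"
      using c(2) mult_smult_assoc_mat[OF kron_I_carrier[OF u'c] Xc] by (simp add: kron_I_smult)
    then have "z * u = (c \<cdot>\<^sub>m u') * z" using z(2) uc smult_carrier_mat[OF u'c] by blast
    then have "z * u = c \<cdot>\<^sub>m (u' * z)" using mult_smult_assoc_mat[OF u'c zc] by simp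
    then have "kr z * kr u = c \<cdot>\<^sub>m (kr u' * kr z)"
      using kron_I_mult[OF zc uc] kron_I_mult[OF u'c zc] by (simp add: kron_I_smult)
    then have "conj_by G (cls (kr z)) (cls (kr u)) = cls (kr u')"
      unfolding PGL_conj_iff[OF kron_I_GLm[OF z(1)] kr_GLm[OF u(1)] kr_GLm[OF u'(1)]] using c(1) by blast
    then show ?thesis using u'(2) u(2) by (simp add: kron_cls_cls)
  qed
  then show ?thesis using cls_in_PGL[OF z(1)] by blast
qed

text \<open>The square of a lift is a scalar \<open>c\<close>, so all its eigenvalues are square
  roots of \<open>c\<close>. Dividing by one square root, which exists over an algebraically closed
  field, leaves signs.\<close>

lemma sign_lift:
  assumes b: "b \<in> B"
  shows "\<exists>u \<epsilon>. u \<in> GLm m \<and> b = cls (kr u) \<and> P * u = diag_fun m \<epsilon> * P \<and> (\<forall>a<m. \<epsilon> a = 1 \<or> \<epsilon> a = - 1)"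
proof -
  obtain u where u: "u \<in> \<Union>U1" "b = cls (kr u)" using b by (rule B_memE)
  note uG = U1_lift[OF u(1)]
  note uc = GLm_carrier[OF uG] and Pc = GLm_carrier[OF P]
  have "cls u \<otimes>\<^bsub>PGL m\<^esub> cls u = \<one>\<^bsub>PGL m\<^esub>"
    using elem U1_lift_cls[OF u(1)] unfolding elem_ab_2_def by blast
  then have "cls (u * u) = cls (1\<^sub>m m)" using PGL_mult[OF uc uc] by (simp add: PGL_one)
  then obtain c where c: "c \<noteq> 0" "u * u = c \<cdot>\<^sub>m 1\<^sub>m m" unfolding cls_eq_iff by blast
  obtain f where f: "P * u = diag_fun m f * P" using diag[OF u(1)] by blast
  note as = assoc_mult_mat[of _ m m _ m _ m]
  have "c \<cdot>\<^sub>m P = P * (u * u)" unfolding c(2) using mult_smult_distrib[OF Pc one_carrier_mat] Pc by simp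
  also have "\<dots> = (P * u) * u" using Pc uc by (simp add: as)
  also have "\<dots> = (diag_fun m f * P) * u" by (simp only: f)
  also have "\<dots> = diag_fun m f * (P * u)" by (rule assoc_mult_mat[OF diag_fun_carrier Pc uc])
  also have "\<dots> = diag_fun m f * (diag_fun m f * P)" by (simp only: f)
  also have "\<dots> = (diag_fun m f * diag_fun m f) * P"
    by (rule assoc_mult_mat[OF diag_fun_carrier diag_fun_carrier Pc, symmetric])
  also have "\<dots> = diag_fun m (\<lambda>a. f a * f a) * P" by (simp only: diag_fun_mult)
  finally have e: "c \<cdot>\<^sub>m P = diag_fun m (\<lambda>a. f a * f a) * P" .
  have sq: "f a * f a = c" if a: "a < m" for a
  proof -
    obtain j where j: "j < m" "P $$ (a, j) \<noteq> 0" using P a by (rule GLm_nonzero_entry)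
    have "c * P $$ (a, j) = f a * f a * P $$ (a, j)"
      using arg_cong[OF e, of "\<lambda>Y. Y $$ (a, j)"] diag_fun_left[OF Pc a j(1), of "\<lambda>a. f a * f a"] a j Pc by simp
    then show ?thesis using j(2) by simp
  qed
  obtain s where s: "s * s = c" by (rule alg_closed_sqrt[OF alg])
  have s0: "s \<noteq> 0" using s c(1) by auto
  define \<epsilon> where "\<epsilon> a = inverse s * f a" for a
  have "P * (inverse s \<cdot>\<^sub>m u) = inverse s \<cdot>\<^sub>m (diag_fun m f * P)"
    unfolding f[symmetric] by (rule mult_smult_distrib[OF Pc uc])
  also have "\<dots> = (inverse s \<cdot>\<^sub>m diag_fun m f) * P"
    by (rule mult_smult_assoc_mat[OF diag_fun_carrier Pc, symmetric])
  also have "inverse s \<cdot>\<^sub>m diag_fun m f = diag_fun m \<epsilon>"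
    by (rule eq_matI) (auto simp: diag_fun_def \<epsilon>_def)
  finally have "P * (inverse s \<cdot>\<^sub>m u) = diag_fun m \<epsilon> * P" .
  moreover have "\<epsilon> a = 1 \<or> \<epsilon> a = - 1" if "a < m" for a
  proof -
    have "f a * f a = s * s" using sq[OF that] s by simp
    then have "f a = s \<or> f a = - s" by (simp add: square_eq_iff)
    then show ?thesis using s0 by (auto simp: \<epsilon>_def)
  qed
  moreover have "inverse s \<cdot>\<^sub>m u \<in> GLm m" using uG s0 by (intro GLm_smult) simp_all
  moreover have "b = cls (kr (inverse s \<cdot>\<^sub>m u))" using u(2) s0 by (simp add: kron_I_smult cls_smult)
  ultimately show ?thesis by blast
qed

text \<open>In an eigenbasis of \<open>U1\<close>, the twist translates the block of index \<open>a\<close> by the bit vector that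
  records the signs of the prescribed elements on the eigenvector of index \<open>a\<close>.\<close>

lemma twist_realized:
  assumes f: "f \<in> {..<r} \<rightarrow> B"
  shows "\<exists>g\<in>carrier G. (\<forall>b\<in>B. conj_by G g b = b) \<and>
    (\<forall>i<r. conj_by G g (Abar n r i) = Abar n r i \<otimes>\<^bsub>G\<^esub> f i)"
proof -
  define R where "R i u \<epsilon> \<longleftrightarrow> u \<in> GLm m \<and> f i = cls (kr u) \<and> P * u = diag_fun m \<epsilon> * P \<and>
      (\<forall>a<m. \<epsilon> a = 1 \<or> \<epsilon> a = - 1)" for i u \<epsilon>
  \<comment> \<open>The guard \<open>i < r\<close> permits total functions \<open>u\<close> and
    \<open>\<epsilon>\<close>, with arbitrary values from \<open>r\<close> on.\<close>
  have "\<forall>i. \<exists>u \<epsilon>. i < r \<longrightarrow> R i u \<epsilon>"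
  proof
    fix i
    show "\<exists>u \<epsilon>. i < r \<longrightarrow> R i u \<epsilon>"
    proof (cases "i < r")
      case True
      then have "f i \<in> B" using f by auto
      then show ?thesis unfolding R_def using sign_lift by blast
    qed simp
  qed
  then obtain u \<epsilon> where "\<forall>i. i < r \<longrightarrow> R i (u i) (\<epsilon> i)" by metis
  then have u: "u i \<in> GLm m" "f i = cls (kr (u i))" "P * u i = diag_fun m (\<epsilon> i) * P"
    and \<epsilon>: "\<And>a. a < m \<Longrightarrow> \<epsilon> i a = 1 \<or> \<epsilon> i a = - 1" if "i < r" for i
    using that unfolding R_def by blast+
  \<comment> \<open>Translation by \<open>\<tau> a\<close> changes the character of
    \<open>unit_vec r i\<close> on block \<open>a\<close> by the sign \<open>\<epsilon> i a\<close>,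
    which is the effect there of multiplication by the lift of \<open>f i\<close>.\<close>
  define \<tau> where "\<tau> a = vec r (\<lambda>i. if \<epsilon> i a = 1 then 0 else 1 :: bit)" for a
  have \<tau>c: "\<tau> a \<in> carrier_vec r" for a by (simp add: \<tau>_def)
  let ?F = "\<lambda>a x. x + \<tau> a"
  let ?\<pi> = "block_perm r ?F"
  have F: "?F a \<in> carrier_vec r \<rightarrow> carrier_vec r" "inj_on (?F a) (carrier_vec r)" for a
  proof -
    show "?F a \<in> carrier_vec r \<rightarrow> carrier_vec r" using \<tau>c by simp
    show "inj_on (?F a) (carrier_vec r)"
      by (rule inj_on_inverseI[of _ "?F a"]) (rule bit_vec_add_cancel[OF _ \<tau>c])
  qed
  have bij: "bij_betw ?\<pi> {..<n} {..<n}" using F by (intro block_perm_bij)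
  define Q where "Q = (perm_fun n ?\<pi> :: 'a mat)"
  have QG: "Q \<in> GLm n" unfolding Q_def by (rule perm_fun_GLm[OF bij])
  obtain P' where P': "P' \<in> GLm m" "P * P' = 1\<^sub>m m" "P' * P = 1\<^sub>m m" using P by (rule GLm_inverse)
  note Pc = GLm_carrier[OF P] and P'c = GLm_carrier[OF P'(1)]
  note kc = kron_I_carrier[OF Pc, of "2 ^ r"] kron_I_carrier[OF P'c, of "2 ^ r"]
  \<comment> \<open>Pass to the eigenbasis of \<open>U1\<close>, translate the blocks, and
    return.\<close>
  define S where "S = kr P' * Q * kr P"
  have SG: "S \<in> GLm n" unfolding S_def by (intro GLm_mult kron_I_GLm P P'(1) QG)
  \<comment> \<open>The eigenvector relation rewritten for \<open>P'\<close>, as the third factor of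
    \<open>S\<close> requires.\<close>
  have P'_diag: "P' * diag_fun m h = v * P'" if v: "v \<in> carrier_mat m m" "P * v = diag_fun m h * P" for v h
  proof -
    note as = assoc_mult_mat[of _ m m _ m _ m]
    have "P' * (diag_fun m h * P) * P' = P' * (diag_fun m h * P * P')"
      by (rule assoc_mult_mat[OF P'c mult_carrier_mat[OF diag_fun_carrier Pc] P'c])
    also have "diag_fun m h * P * P' = diag_fun m h * (P * P')"
      by (rule assoc_mult_mat[OF diag_fun_carrier Pc P'c])
    also have "\<dots> = diag_fun m h" using P'(2) right_mult_one_mat[OF diag_fun_carrier] by simp
    finally have "P' * diag_fun m h = P' * (diag_fun m h * P) * P'" by (rule sym)
    also have "\<dots> = (P' * P) * v * P'" unfolding v(2)[symmetric] using v(1) Pc P'c by (simp add: as)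
    also have "\<dots> = v * P'" using P'(3) v(1) by simp
    finally show ?thesis .
  qed
  have "conj_by G (cls S) b = b" if b: "b \<in> B" for b
  proof -
    obtain v where v: "v \<in> \<Union>U1" "b = cls (kr v)" using b by (rule B_memE)
    note vc = GLm_carrier[OF U1_lift[OF v(1)]]
    obtain h where h: "P * v = diag_fun m h * P" using diag[OF v(1)] by blast
    have "S * kr v = kr v * S"
      unfolding S_def
    proof (rule sandwich_intertwines[where n = "m * 2 ^ r" and X = "kr (diag_fun m h)" and Y = "kr (diag_fun m h)"])
      show "kr P * kr v = kr (diag_fun m h) * kr P"
        using kron_I_mult[OF Pc vc] kron_I_mult[OF diag_fun_carrier Pc] h by simp
      \<comment> \<open>The translations stay inside blocks, and a lifted diagonal matrix is
        constant on each block.\<close>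
      show "Q * kr (diag_fun m h) = kr (diag_fun m h) * Q"
        unfolding Q_def kron_I_diag_fun by (rule perm_fun_diag_fun[OF bij]) simp
      show "kr P' * kr (diag_fun m h) = kr v * kr P'"
        using kron_I_mult[OF P'c diag_fun_carrier] kron_I_mult[OF vc P'c] P'_diag[OF vc h] by simp
    qed (simp_all add: kc kron_I_carrier vc GLm_carrier[OF QG])
    then show ?thesis unfolding v(2) by (intro PGL_conj_eqI SG kr_GLm v(1))
  qed
  moreover have "conj_by G (cls S) (Abar n r i) = Abar n r i \<otimes>\<^bsub>G\<^esub> f i" if i: "i < r" for i
  proof -
    let ?e = "d (unit_vec r i)"
    note uc = GLm_carrier[OF u(1)[OF i]]
    note dk = kron_I_carrier[OF diag_fun_carrier[of m "\<epsilon> i"], of "2 ^ r"] kron_I_carrier[OF uc, of "2 ^ r"]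
    have kk: "?e * kr (diag_fun m (\<epsilon> i)) = diag_fun n (\<lambda>p. chi r (unit_vec r i) (p mod 2 ^ r) * \<epsilon> i (p div 2 ^ r))"
      unfolding sign_diag_def kron_I_diag_fun diag_fun_mult ..
    have "S * ?e = (?e * kr (u i)) * S"
      unfolding S_def
    proof (rule sandwich_intertwines[where n = "m * 2 ^ r" and X = ?e and Y = "?e * kr (diag_fun m (\<epsilon> i))"])
      show "kr P * ?e = ?e * kr P" by (rule sign_diag_kron_I[OF Pc, symmetric])
      show "Q * ?e = ?e * kr (diag_fun m (\<epsilon> i)) * Q"
        unfolding kk unfolding Q_def sign_diag_def
      proof (rule perm_fun_diag_fun[OF bij])
        fix p assume "p < n"
        then have a: "p div 2 ^ r < m" by (simp add: less_mult_imp_div_less)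
        let ?a = "p div 2 ^ r"
        have "bits r (?\<pi> p mod 2 ^ r) = bits r (p mod 2 ^ r) + \<tau> ?a"
          using bits_block_perm[of ?F p r] F(1) by blast
        then have "unit_vec r i \<bullet> bits r (?\<pi> p mod 2 ^ r)
            = unit_vec r i \<bullet> bits r (p mod 2 ^ r) + unit_vec r i \<bullet> \<tau> ?a"
          using scalar_prod_add_distrib[OF unit_vec_carrier bits_carrier \<tau>c] by simp
        moreover have "unit_vec r i \<bullet> \<tau> ?a = \<tau> ?a $ i" using i \<tau>c by (simp add: scalar_prod_left_unit[of _ r])
        ultimately have "(chi r (unit_vec r i) (?\<pi> p mod 2 ^ r) :: 'a)
            = chi r (unit_vec r i) (p mod 2 ^ r) * sg (\<tau> ?a $ i)"
          by (simp only: chi_def sg_add)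
        \<comment> \<open>Both factors are the same sign, so their product is 1.\<close>
        moreover have "sg (\<tau> ?a $ i) * \<epsilon> i ?a = 1" using \<epsilon>[OF i a] i by (auto simp: \<tau>_def)
        ultimately show "chi r (unit_vec r i) (?\<pi> p mod 2 ^ r) * \<epsilon> i (?\<pi> p div 2 ^ r)
            = chi r (unit_vec r i) (p mod 2 ^ r)"
          by (simp add: mult.assoc)
      qed
      have "kr P' * (?e * kr (diag_fun m (\<epsilon> i))) = (kr P' * ?e) * kr (diag_fun m (\<epsilon> i))"
        by (rule assoc_mult_mat[OF kc(2) sign_diag_carrier dk(1), symmetric])
      also have "\<dots> = ?e * (kr P' * kr (diag_fun m (\<epsilon> i)))"
        unfolding sign_diag_kron_I[OF P'c, symmetric] by (rule assoc_mult_mat[OF sign_diag_carrier kc(2) dk(1)])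
      also have "kr P' * kr (diag_fun m (\<epsilon> i)) = kr (u i) * kr P'"
        using kron_I_mult[OF P'c diag_fun_carrier] kron_I_mult[OF uc P'c] P'_diag[OF uc u(3)[OF i]] by simp
      also have "?e * (kr (u i) * kr P') = ?e * kr (u i) * kr P'"
        by (rule assoc_mult_mat[OF sign_diag_carrier dk(2) kc(2), symmetric])
      finally show "kr P' * (?e * kr (diag_fun m (\<epsilon> i))) = ?e * kr (u i) * kr P'" .
    qed (rule kc GLm_carrier[OF QG] sign_diag_carrier mult_carrier_mat[OF sign_diag_carrier dk(1)]
        mult_carrier_mat[OF sign_diag_carrier dk(2)])+
    then have "conj_by G (cls S) (cls ?e) = cls (?e * kr (u i))"
      by (intro PGL_conj_eqI SG sign_diag_GLm GLm_mult kron_I_GLm u(1)[OF i])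
    then show ?thesis
      unfolding Abar_eq[OF i] u(2)[OF i] PGL_mult[OF sign_diag_carrier dk(2)] .
  qed
  ultimately show ?thesis using cls_in_PGL[OF SG] by blast
qed

section \<open>Verification of the hypotheses of \<open>weyl_extension\<close>\<close>

lemma commute_AB:
  assumes y: "y \<in> A \<union> B" and z: "z \<in> A \<union> B"
  shows "y \<otimes>\<^bsub>G\<^esub> z = z \<otimes>\<^bsub>G\<^esub> y"
proof -
  have AA: "y \<otimes>\<^bsub>G\<^esub> z = z \<otimes>\<^bsub>G\<^esub> y" if y: "y \<in> A" and z: "z \<in> A" for y z
  proof -
    obtain v where v: "v \<in> carrier_vec r" "y = cls (d v)" using y by (rule A_memE)
    obtain w where w: "w \<in> carrier_vec r" "z = cls (d w)" using z by (rule A_memE)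
    show ?thesis
      using sign_diag_mult[OF v(1) w(1), of m, where ?'a = 'a] sign_diag_mult[OF w(1) v(1), of m, where ?'a = 'a]
        comm_add_vec[OF v(1) w(1)] v(2) w(2) by (simp add: PGL_mult)
  qed
  have AB: "y \<otimes>\<^bsub>G\<^esub> z = z \<otimes>\<^bsub>G\<^esub> y" if y: "y \<in> A" and z: "z \<in> B" for y z
  proof -
    obtain v where v: "v \<in> carrier_vec r" "y = cls (d v)" using y by (rule A_memE)
    obtain u where u: "u \<in> \<Union>U1" "z = cls (kr u)" using z by (rule B_memE)
    note uc = GLm_carrier[OF U1_lift[OF u(1)]]
    show ?thesis
      unfolding v(2) u(2) PGL_mult[OF sign_diag_carrier kron_I_carrier[OF uc]]
        PGL_mult[OF kron_I_carrier[OF uc] sign_diag_carrier] sign_diag_kron_I[OF uc] ..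
  qed
  have BB: "y \<otimes>\<^bsub>G\<^esub> z = z \<otimes>\<^bsub>G\<^esub> y" if y: "y \<in> B" and z: "z \<in> B" for y z
  proof -
    obtain Y Z where Y: "Y \<in> U1" "y = kron_cls r Y" and Z: "Z \<in> U1" "z = kron_cls r Z"
      using y z unfolding B_eq by blast
    have "Y \<in> carrier (PGL m)" "Z \<in> carrier (PGL m)" using Y Z U1_carrier by auto
    moreover have "Y \<otimes>\<^bsub>PGL m\<^esub> Z = Z \<otimes>\<^bsub>PGL m\<^esub> Y" using elem Y(1) Z(1) unfolding elem_ab_2_def by blast
    ultimately show ?thesis
      unfolding Y(2) Z(2) using hom_mult[OF kron_cls_hom, of Y m Z r] hom_mult[OF kron_cls_hom, of Z m Y r] by simp
  qed
  show ?thesis using y z AA AB AB[symmetric] BB by blast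
qed

lemma square_B: "b \<in> B \<Longrightarrow> b \<otimes>\<^bsub>G\<^esub> b = \<one>\<^bsub>G\<^esub>"
proof -
  assume "b \<in> B"
  then obtain Y where Y: "Y \<in> U1" "b = kron_cls r Y" unfolding B_eq by blast
  have Yc: "Y \<in> carrier (PGL m)" using Y U1_carrier by blast
  have "Y \<otimes>\<^bsub>PGL m\<^esub> Y = \<one>\<^bsub>PGL m\<^esub>" using elem Y(1) unfolding elem_ab_2_def by blast
  moreover have "kron_cls r \<one>\<^bsub>PGL m\<^esub> = \<one>\<^bsub>G\<^esub>" by (simp add: PGL_one kron_cls_cls kron_I_one)
  ultimately show ?thesis
    using hom_mult[OF kron_cls_hom Yc Yc, of r] Y(2) by simp
qed

lemma A_Int_B: "A \<inter> B = {\<one>\<^bsub>G\<^esub>}"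
proof
  show "{\<one>\<^bsub>G\<^esub>} \<subseteq> A \<inter> B" using one_in_A subgroup.one_closed[OF subgroup_B] by blast
  show "A \<inter> B \<subseteq> {\<one>\<^bsub>G\<^esub>}"
  proof
    fix y assume y: "y \<in> A \<inter> B"
    obtain v where v: "v \<in> carrier_vec r" "y = cls (d v)" using y A_memE by blast
    obtain u where u: "u \<in> \<Union>U1" "y = cls (kr u)" using y B_memE by blast
    have "v = 0\<^sub>v r"
      using sign_diag_eq_kron_I[OF two v(1) m GLm_carrier[OF U1_lift[OF u(1)]]] v(2) u(2) by simp
    then show "y \<in> {\<one>\<^bsub>G\<^esub>}" using v(2) by (simp add: sign_diag_zero PGL_one)
  qed
qed

lemma weyl_extension_pgl:
  "weyl_extension G (GL_grp r) (PGL m) A B (Abar n r) r U1 (perm_cls m r) (kron_cls r)"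
proof -
  interpret GLr: group "GL_grp r :: bit mat monoid" by (rule group_GL_grp)
  interpret M: group "PGL m :: 'a mat set monoid" by (rule group_PGL)
  have gl: "carrier (GL_grp r) = (GLm r :: bit mat set)" by (simp add: GL_grp_def)
  have gens: "{Abar n r i | i. i < r} = (Abar n r ` {..<r} :: 'a mat set set)" by auto
  show ?thesis
  proof (intro weyl_extension.intro weyl_extension_axioms.intro)
    show "A = generate G (Abar n r ` {..<r})" unfolding D_r_def gens ..
    show "Abar n r ` {..<r} \<subseteq> carrier G"
    proof
      fix y :: "'a mat set" assume "y \<in> Abar n r ` {..<r}"
      then obtain i where i: "i < r" "y = Abar n r i" by blast
      show "y \<in> carrier G" unfolding i(2) Abar_eq[OF i(1)] by (rule cls_in_PGL[OF sign_diag_GLm])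
    qed
    show "finite A" by (rule finite_A)
    show "subgroup B G" by (rule subgroup_B)
    show "finite B" by (rule finite_B)
    show "y \<otimes>\<^bsub>G\<^esub> z = z \<otimes>\<^bsub>G\<^esub> y" if "y \<in> A \<union> B" "z \<in> A \<union> B" for y z
      using that by (rule commute_AB)
    show "b \<otimes>\<^bsub>G\<^esub> b = \<one>\<^bsub>G\<^esub>" if "b \<in> B" for b using that by (rule square_B)
    show "A \<inter> B = {\<one>\<^bsub>G\<^esub>}" by (rule A_Int_B)
    show "subgroup U1 (PGL m)" by (rule U1_sub)
    show "perm_cls m r \<in> hom (GL_grp r) G" by (rule perm_cls_hom)
    show "kron_cls r \<in> hom (PGL m) G" by (rule kron_cls_hom)
    show "inj_on (kron_cls r) (carrier (PGL m))" by (rule kron_cls_inj)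
    show "kron_cls r ` U1 = B" by (rule B_eq[symmetric])
    show "conj_by G (perm_cls m r l) a \<in> A" if l: "l \<in> carrier (GL_grp r)" and a: "a \<in> A" for l a
    proof -
      have l: "l \<in> GLm r" using l gl by simp
      obtain k where k: "k \<in> GLm r" "l * k = 1\<^sub>m r" using l by (rule GLm_inverse)
      note lc = GLm_carrier[OF l] and kc = GLm_carrier[OF k(1)]
      obtain v where v: "v \<in> carrier_vec r" "a = cls (d v)" using a by (rule A_memE)
      \<comment> \<open>\<open>perm_cls_sign_diag\<close> has the transpose of \<open>l\<close> at
        its source, so the transpose of the inverse \<open>k\<close> has to be applied to
        \<open>v\<close>.\<close>
      define w where "w = transpose_mat k *\<^sub>v v"
      have w: "w \<in> carrier_vec r" using kc v by (simp add: w_def)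
      have "k * l = 1\<^sub>m r" using mat_mult_left_right_inverse[OF lc kc k(2)] .
      then have "transpose_mat l * transpose_mat k = 1\<^sub>m r"
        using transpose_mult[OF kc lc] by simp
      then have "transpose_mat l *\<^sub>v w = v"
        using assoc_mult_mat_vec[of "transpose_mat l" r r "transpose_mat k" r v] lc kc v by (simp add: w_def)
      then have "conj_by G (perm_cls m r l) a = cls (d w)"
        using perm_cls_sign_diag[OF l w, of m, where ?'a = 'a] v(2) by simp
      then show ?thesis using A_memI[OF w] by simp
    qed
    show "l = \<one>\<^bsub>GL_grp r\<^esub>" if l: "l \<in> carrier (GL_grp r)" "\<forall>a\<in>A. conj_by G (perm_cls m r l) a = a" for l
    proof -
      have "l = 1\<^sub>m r"
        by (rule perm_cls_faithful[OF two m]) (use l gl A_memI in auto)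
      then show ?thesis by (simp add: GL_grp_def)
    qed
    show "perm_cls m r l \<otimes>\<^bsub>G\<^esub> kron_cls r z = kron_cls r z \<otimes>\<^bsub>G\<^esub> perm_cls m r l"
      if "l \<in> carrier (GL_grp r)" "z \<in> carrier (PGL m)" for l z
      using perm_cls_kron_cls that gl by blast
    show "conj_by G (kron_cls r z) a = a" if "z \<in> carrier (PGL m)" "a \<in> A" for z a
      using that(2) kron_cls_sign_diag[OF that(1)] by (auto elim!: A_memE)
    show "conj_by G g b \<in> B" if "g \<in> normalizer G (A <#>\<^bsub>G\<^esub> B)" "b \<in> B" for g b
      using that by (rule normalizer_preserves_B)
    show "\<exists>g\<in>carrier G. (\<forall>b\<in>B. conj_by G g b = b) \<and> (\<forall>i<r. conj_by G g (Abar n r i) = Abar n r i \<otimes>\<^bsub>G\<^esub> f i)"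
      if "f \<in> {..<r} \<rightarrow> B" for f using that by (rule twist_realized)
    show "\<exists>l\<in>carrier (GL_grp r). \<forall>a\<in>A. conj_by G (perm_cls m r l) a = \<beta> a"
      if "\<beta> \<in> hom (G\<lparr>carrier := A\<rparr>) (G\<lparr>carrier := A\<rparr>)" "inj_on \<beta> A" for \<beta>
      unfolding gl by (rule realize_sign_diag_aut[OF two m that])
    show "\<exists>z\<in>carrier (PGL m). \<forall>b\<in>B. conj_by G g b = conj_by G (kron_cls r z) b"
      if "g \<in> carrier G" "\<forall>a\<in>A. conj_by G g a = a" "\<forall>b\<in>B. conj_by G g b \<in> B" for g
      using that by (rule acts_as_block)
  qed (rule group_PGL group_GL_grp)+
qed

text \<open>As \<open>rk\<close> is a definite description, a power of 2 has to be exhibited first;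
  it comes from the exponent of \<open>B\<close>.\<close>

lemma card_B: "card B = 2 ^ rk B"
proof -
  interpret B: group "G\<lparr>carrier := B\<rparr>" by (rule G.subgroup_imp_group[OF subgroup_B])
  have "\<exists>k. card (carrier (G\<lparr>carrier := B\<rparr>)) = 2 ^ k"
    by (rule B.card_exponent_2) (use finite_B square_B in auto)
  then obtain k where k: "card B = 2 ^ k" by auto
  then have "rk B = k" unfolding rk_def by (intro the_equality) auto
  then show ?thesis using k by simp
qed

theorem weyl_structure:
  "\<exists>E Q. E \<lhd> Weyl G D \<and> elem_ab_2 (Weyl G D) E \<and> card E = 2 ^ (rk B * r) \<and> subgroup Q (Weyl G D) \<and>
     E \<inter> Q = {\<one>\<^bsub>Weyl G D\<^esub>} \<and> E <#>\<^bsub>Weyl G D\<^esub> Q = carrier (Weyl G D) \<and>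
     (Weyl G D)\<lparr>carrier := Q\<rparr> \<cong> (GL_grp r :: bit mat monoid) \<times>\<times> Weyl (PGL m) U1"
  using weyl_extension.weyl_split[OF weyl_extension_pgl] unfolding card_B power_mult[symmetric] .

end

theorem theorem4p14:
  fixes s t r :: nat and U1 :: "'a::field mat set set"
  assumes "alg_closed_field TYPE('a)"
    and "(2::'a) \<noteq> 0"
    and "odd t" and "s \<ge> 1" and "t \<ge> 1"
    and "1 \<le> r" and "r \<le> s"
    and "subgroup U1 (PGL (2 ^ (s - r) * t))"
    and "U1 = {\<one>\<^bsub>PGL (2 ^ (s - r) * t)\<^esub>} \<or>
         (elem_ab_2 (PGL (2 ^ (s - r) * t)) U1 \<and> toral (2 ^ (s - r) * t) U1 \<and>
          zar_connected (2 ^ (s - r) * t) (centralizer (PGL (2 ^ (s - r) * t)) U1))"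
  shows "let G = PGL (2 ^ s * t);
             D = D_r (2 ^ s * t) r <#>\<^bsub>G\<^esub> Ubar r U1;
             W = Weyl G D
         in \<exists>E Q. E \<lhd> W \<and> elem_ab_2 W E \<and> card E = 2 ^ (rk (Ubar r U1) * r) \<and>
                  subgroup Q W \<and> E \<inter> Q = {\<one>\<^bsub>W\<^esub>} \<and> E <#>\<^bsub>W\<^esub> Q = carrier W \<and>
                  W\<lparr>carrier := Q\<rparr> \<cong> (GL_grp r :: bit mat monoid) \<times>\<times> Weyl (PGL (2 ^ (s - r) * t)) U1"
proof -
  define m where "m = 2 ^ (s - r) * t"
  have m: "0 < m" using assms(5) by (simp add: m_def)
  have n: "2 ^ s * t = m * 2 ^ r"
  proof -
    have "(2::nat) ^ s = 2 ^ (s - r) * 2 ^ r" using assms(7) by (simp flip: power_add)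
    then show ?thesis by (simp add: m_def)
  qed
  note U1 = assms(9)[folded m_def]
  interpret M: group "PGL m :: 'a mat set monoid" by (rule group_PGL)
  have "\<exists>P. pgl_toral m U1 P"
    using U1
  proof
    assume triv: "U1 = {\<one>\<^bsub>PGL m\<^esub>}"
    \<comment> \<open>Lifts of the trivial group are scalar: they commute with everything and are
      already diagonal, so the identity matrix serves as eigenbasis.\<close>
    have lifts: "\<exists>c. u = c \<cdot>\<^sub>m 1\<^sub>m m" if "u \<in> \<Union>U1" for u
      using that triv by (auto simp: PGL_one cls_def)
    have "pgl_toral m U1 (1\<^sub>m m)"
    proof
      show "elem_ab_2 (PGL m) U1"
        using assms(8)[folded m_def] unfolding triv elem_ab_2_def by simp
      show "z * u = u * z" if z: "z \<in> GLm m" and u: "u \<in> \<Union>U1" for z u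
      proof -
        obtain c where c: "u = c \<cdot>\<^sub>m 1\<^sub>m m" using lifts[OF u] by blast
        note zc = GLm_carrier[OF z]
        show ?thesis
          unfolding c mult_smult_distrib[OF zc one_carrier_mat] mult_smult_assoc_mat[OF one_carrier_mat zc]
          using zc by simp
      qed
      show "\<exists>f. 1\<^sub>m m * u = diag_fun m f * 1\<^sub>m m" if u: "u \<in> \<Union>U1" for u
      proof -
        obtain c where c: "u = c \<cdot>\<^sub>m 1\<^sub>m m" using lifts[OF u] by blast
        have "u = diag_fun m (\<lambda>_. c)" unfolding c by (rule eq_matI) (auto simp: diag_fun_def)
        then have "1\<^sub>m m * u = diag_fun m (\<lambda>_. c) * 1\<^sub>m m"
          using left_mult_one_mat[OF diag_fun_carrier] right_mult_one_mat[OF diag_fun_carrier] by metis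
        then show ?thesis by blast
      qed
    qed (use assms(1,2) m GLm_one in blast)+
    then show ?thesis by blast
  next
    assume U: "elem_ab_2 (PGL m) U1 \<and> toral m U1 \<and> zar_connected m (centralizer (PGL m) U1)"
    have sub: "U1 \<subseteq> carrier (PGL m)" using assms(8)[folded m_def] by (rule subgroup.subset)
    obtain P where P: "P \<in> GLm m" "\<And>u. u \<in> \<Union>U1 \<Longrightarrow> \<exists>f. P * u = diag_fun m f * P"
      using toral_simultaneously_diagonal[OF sub] U by blast
    have "pgl_toral m U1 P"
    proof
      show "z * u = u * z" if "z \<in> GLm m" "cls z \<in> centralizer (PGL m) U1" "u \<in> \<Union>U1" for z u
        using connected_centralizer_commutes[OF assms(2) m _ _ that] U by blast
    qed (use assms(1,2) m U P in blast)+
    then show ?thesis by blast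
  qed
  then obtain P where "pgl_toral m U1 P" by blast
  then show ?thesis
    unfolding Let_def n m_def[symmetric] by (rule pgl_toral.weyl_structure)
qed

end
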